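(* For every $r$-partial $d$-Dyck path $\pi\in\mathbb D_r(d)$ and every marking $\Sigma$ of $\pi$, $$\mathcal G^{\pm,\mathrm{row}}_r(\pi,\Sigma)=\chi^{\mathsf P}_r(\pi,\Sigma)\quad\text{in }\mathcal P(r).$$
   Context: $\mathbb F=\mathbb Q(q,t)$; $\mathcal P(r)=\mathbb F[x_1,\dots,x_r]\otimes\Lambda_{\mathbb F}(x_{r+1},\dots)$ inside $\mathbb F[[x_1,x_2,\dots]]$, $\mathcal P(r)\subseteq\mathcal P(r+1)$. Box $(c,r)$ is the unit square with northeast corner $(c,r)$. $\mathbb D_r(d)$ is the set of paths of unit north/east steps from $(0,r)$ to $(d,d)$ weakly above the line from $(0,0)$ to $(d,d)$; for such $\pi$, $\mathrm{Area}(\pi)$ is the set of full boxes below $\pi$ and above that diagonal, where $\pi$ is extended by $r$ north steps from $(0,0)$. A corner is a box above $\pi$ whose south and east neighbouring boxes are below $\pi$; a marking is a set of corners. Alphabet $\mathcal A$: $1<\bar1<2<\bar2<\cdots$ with positive letters $v$ and negative letters $\bar v$, $|v|=|\bar v|=v$. For $a,b\in\mathcal A$, $ab$ is row-increasing if $a<b$ or $a=b$ is positive. A flagged $(\pi,\Sigma)$-row super word is a map $T:[d]\to\mathcal A$ with $T(j)T(i)$ row-increasing for every $(i,j)\in\Sigma$ and $T(i)\le i$ for $i=1,\dots,r$. $\mathrm{inv}(T)$ is the number of $(i,j)\in\mathrm{Area}(\pi)$ with $T(j)T(i)$ row-increasing; $m(T)$ is the number of negative letters; $\mathbf x^{|T|}=\prod_{i\in[d]}x_{|T(i)|}$.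 Then $\mathcal G^{\pm,\mathrm{row}}_r(\pi,\Sigma)=\sum_T t^{\mathrm{inv}(T)}(-t)^{m(T)}\mathbf x^{|T|}$ over all such $T$. Operators: $T_if=s_if+(1-t)x_i\frac{f-s_if}{x_i-x_{i+1}}$. Plethystic notation as usual, $\Omega[A]=\exp\sum_kp_k[A]/k$, $\mathcal B_nf(Z)=\langle u^0\rangle u^nf[Z-u]\Omega[(1-t)u^{-1}Z]$. $d_-^{\mathsf P}:\mathcal P(s)\to\mathcal P(s-1)$: $x_1^{\eta_1}\cdots x_s^{\eta_s}g(x_{s+1},\dots)\mapsto x_1^{\eta_1}\cdots x_{s-1}^{\eta_{s-1}}\mathcal B_{\eta_s}(g[Z])$, $Z=x_s+x_{s+1}+\cdots$, $g$ symmetric. $d_+^{\mathsf P}:\mathcal P(s)\to\mathcal P(s+1)$: $f\mapsto -T_1\cdots T_s(x_{s+1}f)$. $\chi^{\mathsf P}_r(\pi,\Sigma)$ is obtained from $1\in\mathcal P(0)$ by traversing $\pi$ backwards from $(d,d)$ to $(0,r)$ and applying successively: for each east step not part of a marked corner, $-d_+^{\mathsf P}$; for each north step not part of a marked corner, $d_-^{\mathsf P}$; for each marked corner (the north step on its east side together with the east step on its south side), in place of those two steps the operator $\frac{1}{t-1}\big(d_-^{\mathsf P}\circ(-d_+^{\mathsf P})-(-d_+^{\mathsf P})\circ d_-^{\mathsf P}\big)$. *)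

theory Defs
  imports
    "HOL-Library.Poly_Mapping"
    "HOL-Library.FuncSet"
    "HOL-Combinatorics.Permutations"
    "HOL-Computational_Algebra.Formal_Laurent_Series"
    "HOL-Computational_Algebra.Fraction_Field"
    "HOL-Computational_Algebra.Polynomial"
begin

section \<open>Formal power series in infinitely many variables\<close>

text \<open>A monomial \<open>x\<^sup>\<alpha>\<close> is its exponent vector \<open>\<alpha>\<close>, a finitely supported function on the variable
  indices. The variables of interest are \<open>x\<^sub>1, x\<^sub>2, \<dots>\<close>; the index \<open>0\<close> is never used.\<close>

type_synonym expo = "nat \<Rightarrow>\<^sub>0 nat"

typedef 'a mfps = "UNIV :: (expo \<Rightarrow> 'a) set"
  morphisms mcoeff Mfps ..

lemma mcoeff_Mfps [simp]: "mcoeff (Mfps f) = f"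
  by (simp add: Mfps_inverse)

lemma mfps_eqI: "(\<And>\<alpha>. mcoeff f \<alpha> = mcoeff g \<alpha>) \<Longrightarrow> f = g"
  by (rule iffD1[OF mcoeff_inject], rule ext)

definition splits :: "expo \<Rightarrow> (expo \<times> expo) set" where
  "splits \<alpha> = {(\<beta>, \<gamma>). \<beta> + \<gamma> = \<alpha>}"

lemma finite_splits [simp]: "finite (splits \<alpha>)"
proof -
  define F where "F = {f :: nat \<Rightarrow> nat. \<forall>x.
    (x \<in> Poly_Mapping.keys \<alpha> \<longrightarrow> f x \<in> (\<Union>i\<in>Poly_Mapping.keys \<alpha>. {..Poly_Mapping.lookup \<alpha> i})) \<and>
    (x \<notin> Poly_Mapping.keys \<alpha> \<longrightarrow> f x = 0)}"
  have fin: "finite F"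
    unfolding F_def by (rule finite_set_of_finite_funs) simp_all
  have sub: "(\<lambda>p. Poly_Mapping.lookup (fst p)) ` splits \<alpha> \<subseteq> F"
  proof
    fix h assume "h \<in> (\<lambda>p. Poly_Mapping.lookup (fst p)) ` splits \<alpha>"
    then obtain \<beta> \<gamma> where h: "h = Poly_Mapping.lookup \<beta>" and \<alpha>: "\<alpha> = \<beta> + \<gamma>"
      by (auto simp: splits_def)
    have le: "h x \<le> Poly_Mapping.lookup \<alpha> x" for x
      by (simp add: h \<alpha> lookup_add)
    have "h x = 0" if "x \<notin> Poly_Mapping.keys \<alpha>" for x
      using le[of x] that by (simp add: in_keys_iff)
    moreover have "h x \<in> (\<Union>i\<in>Poly_Mapping.keys \<alpha>. {..Poly_Mapping.lookup \<alpha> i})"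
      if "x \<in> Poly_Mapping.keys \<alpha>" for x
      by (rule UN_I[OF that]) (simp add: le)
    ultimately show "h \<in> F"
      unfolding F_def mem_Collect_eq by iprover
  qed
  have inj: "inj_on (\<lambda>p. Poly_Mapping.lookup (fst p)) (splits \<alpha>)"
  proof (rule inj_onI)
    fix p q :: "expo \<times> expo"
    assume p: "p \<in> splits \<alpha>" and q: "q \<in> splits \<alpha>"
      and "Poly_Mapping.lookup (fst p) = Poly_Mapping.lookup (fst q)"
    then have f: "fst p = fst q"
      by (simp only: poly_mapping.lookup_inject)
    have "fst p + snd p = fst q + snd q"
      using p q by (simp add: splits_def case_prod_unfold)
    with f show "p = q"
      by (simp add: prod_eq_iff)
  qed
  show ?thesis
    by (rule inj_on_finite[OF inj sub fin])
qed

instantiation mfps :: (zero) zero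
begin
definition "0 = Mfps (\<lambda>_. 0)"
instance ..
end

instantiation mfps :: (zero_neq_one) one
begin
definition "1 = Mfps (\<lambda>\<alpha>. if \<alpha> = 0 then 1 else 0)"
instance ..
end

instantiation mfps :: (plus) plus
begin
definition "f + g = Mfps (\<lambda>\<alpha>. mcoeff f \<alpha> + mcoeff g \<alpha>)"
instance ..
end

instantiation mfps :: (uminus) uminus
begin
definition "- f = Mfps (\<lambda>\<alpha>. - mcoeff f \<alpha>)"
instance ..
end

instantiation mfps :: (minus) minus
begin
definition "f - g = Mfps (\<lambda>\<alpha>. mcoeff f \<alpha> - mcoeff g \<alpha>)"
instance ..
end

instantiation mfps :: (comm_semiring_0) times
begin
definition "f * g = Mfps (\<lambda>\<alpha>. \<Sum>(\<beta>, \<gamma>)\<in>splits \<alpha>. mcoeff f \<beta> * mcoeff g \<gamma>)"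
instance ..
end

lemma mcoeff_0 [simp]: "mcoeff 0 \<alpha> = 0"
  by (simp add: zero_mfps_def)

lemma mcoeff_1: "mcoeff 1 \<alpha> = (if \<alpha> = 0 then 1 else 0)"
  by (simp add: one_mfps_def)

lemma mcoeff_add [simp]: "mcoeff (f + g) \<alpha> = mcoeff f \<alpha> + mcoeff g \<alpha>"
  by (simp add: plus_mfps_def)

lemma mcoeff_uminus [simp]: "mcoeff (- f) \<alpha> = - mcoeff f \<alpha>"
  by (simp add: uminus_mfps_def)

lemma mcoeff_minus [simp]: "mcoeff (f - g) \<alpha> = mcoeff f \<alpha> - mcoeff g \<alpha>"
  by (simp add: minus_mfps_def)

lemma mcoeff_mult: "mcoeff (f * g) \<alpha> = (\<Sum>(\<beta>, \<gamma>)\<in>splits \<alpha>. mcoeff f \<beta> * mcoeff g \<gamma>)"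
  by (simp add: times_mfps_def)

instance mfps :: (comm_ring_1) comm_ring_1
proof
  fix f g h :: "'a mfps"
  show "f + g + h = f + (g + h)"
    by (rule mfps_eqI) (simp add: add.assoc)
  show "f + g = g + f"
    by (rule mfps_eqI) (simp add: add.commute)
  show "0 + f = f" "- f + f = 0" "f - g = f + - g"
    by (rule mfps_eqI, simp)+
  show "f * g = g * f"
    by (rule mfps_eqI, unfold mcoeff_mult,
        rule sum.reindex_bij_witness[where i = prod.swap and j = prod.swap])
       (auto simp: splits_def add.commute mult.commute)
  show "(f + g) * h = f * h + g * h"
    by (rule mfps_eqI) (simp add: mcoeff_mult case_prod_unfold sum.distrib distrib_right)
  show "1 * f = f"
  proof (rule mfps_eqI)
    fix \<alpha>
    have "mcoeff (1 * f) \<alpha> = (\<Sum>p\<in>splits \<alpha>. if p = (0, \<alpha>) then mcoeff f \<alpha> else 0)"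
      unfolding mcoeff_mult by (rule sum.cong) (auto simp: splits_def mcoeff_1 split: if_splits)
    moreover have "(0, \<alpha>) \<in> splits \<alpha>" by (simp add: splits_def)
    ultimately show "mcoeff (1 * f) \<alpha> = mcoeff f \<alpha>" by simp
  qed
  show "(0 :: 'a mfps) \<noteq> 1"
    proof
    assume "(0 :: 'a mfps) = 1"
    then have "mcoeff (0 :: 'a mfps) 0 = mcoeff 1 0" by simp
    then show False by (simp add: mcoeff_1)
  qed
  show "f * g * h = f * (g * h)"
  proof (rule mfps_eqI)
    fix \<alpha>
    have "mcoeff (f * g * h) \<alpha> =
        (\<Sum>(p, q)\<in>(SIGMA p:splits \<alpha>. splits (fst p)). mcoeff f (fst q) * mcoeff g (snd q) * mcoeff h (snd p))"
      by (simp add: mcoeff_mult case_prod_unfold sum_distrib_right sum.Sigma)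
    also have "\<dots> = (\<Sum>(p, q)\<in>(SIGMA p:splits \<alpha>. splits (snd p)). mcoeff f (fst p) * (mcoeff g (fst q) * mcoeff h (snd q)))"
      by (rule sum.reindex_bij_witness[where
            i = "\<lambda>(p, q). ((fst p + fst q, snd q), (fst p, fst q))" and
            j = "\<lambda>(p, q). ((fst q, snd q + snd p), (snd q, snd p))"])
         (auto simp: splits_def add.assoc mult.assoc)
    also have "\<dots> = mcoeff (f * (g * h)) \<alpha>"
      by (simp add: mcoeff_mult case_prod_unfold sum_distrib_left sum.Sigma)
    finally show "mcoeff (f * g * h) \<alpha> = mcoeff (f * (g * h)) \<alpha>" .
  qed
qed

definition mconst :: "'a::zero \<Rightarrow> 'a mfps" where
  "mconst c = Mfps (\<lambda>\<alpha>. if \<alpha> = 0 then c else 0)"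

definition mmonom :: "expo \<Rightarrow> 'a::zero_neq_one mfps" where
  "mmonom \<eta> = Mfps (\<lambda>\<alpha>. if \<alpha> = \<eta> then 1 else 0)"

definition mvar :: "nat \<Rightarrow> 'a::zero_neq_one mfps" where
  "mvar i = mmonom (Poly_Mapping.single i 1)"

definition mperm :: "(nat \<Rightarrow> nat) \<Rightarrow> 'a mfps \<Rightarrow> 'a mfps" where
  "mperm \<sigma> f = Mfps (\<lambda>\<alpha>. mcoeff f (Poly_Mapping.map_key \<sigma> \<alpha>))"

definition total_degree :: "expo \<Rightarrow> nat" where
  "total_degree \<alpha> = (\<Sum>i\<in>Poly_Mapping.keys \<alpha>. Poly_Mapping.lookup \<alpha> i)"


section \<open>The ground field and the spaces \<open>\<P>(r)\<close>\<close>

text \<open>The field \<open>\<rat>(q, t)\<close>: the inner polynomial variable is \<open>q\<close>, the outer one is \<open>t\<close>.\<close>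

type_synonym qt = "rat poly poly fract"

definition tt :: qt where
  "tt = Fract [:0, 1:] 1"

text \<open>\<open>Lam a\<close> is the ring of symmetric functions in \<open>x\<^sub>a, x\<^sub>a\<^sub>+\<^sub>1, \<dots>\<close>.\<close>

definition Lam :: "nat \<Rightarrow> qt mfps set" where
  "Lam a = {g. (\<forall>\<alpha>. mcoeff g \<alpha> \<noteq> 0 \<longrightarrow> Poly_Mapping.keys \<alpha> \<subseteq> {a..})
             \<and> (\<exists>n. \<forall>\<alpha>. mcoeff g \<alpha> \<noteq> 0 \<longrightarrow> total_degree \<alpha> \<le> n)
             \<and> (\<forall>\<sigma>. \<sigma> permutes {a..} \<longrightarrow> mperm \<sigma> g = g)}"

definition PP :: "nat \<Rightarrow> qt mfps set" where
  "PP r = {f. \<exists>S g. finite S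
             \<and> (\<forall>\<eta>\<in>S. Poly_Mapping.keys \<eta> \<subseteq> {1..r} \<and> g \<eta> \<in> Lam (Suc r))
             \<and> f = (\<Sum>\<eta>\<in>S. mmonom \<eta> * g \<eta>)}"


section \<open>Plethysm\<close>

definition psum :: "nat \<Rightarrow> nat \<Rightarrow> qt mfps" where
  "psum a k = Mfps (\<lambda>\<alpha>. if \<exists>i\<ge>a. \<alpha> = Poly_Mapping.single i k then 1 else 0)"

text \<open>The value at \<open>p\<^sub>k = A k\<close> of a polynomial in variables \<open>p\<^sub>1, p\<^sub>2, \<dots>\<close>, given by its coefficients
  \<open>c\<close>; the map \<open>emb\<close> embeds the scalars in the target ring.\<close>

definition ppoly_eval :: "(qt \<Rightarrow> 'r::comm_ring_1) \<Rightarrow> (expo \<Rightarrow>\<^sub>0 qt) \<Rightarrow> (nat \<Rightarrow> 'r) \<Rightarrow> 'r" where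
  "ppoly_eval emb c A = (\<Sum>m\<in>Poly_Mapping.keys c. emb (Poly_Mapping.lookup c m) *
      (\<Prod>k\<in>Poly_Mapping.keys m. A k ^ Poly_Mapping.lookup m k))"

text \<open>The unique expression of a symmetric function in \<open>x\<^sub>a, x\<^sub>a\<^sub>+\<^sub>1, \<dots>\<close> as a polynomial in the power
  sums \<open>p\<^sub>k\<close> with \<open>k \<ge> 1\<close>.\<close>

definition power_sum_expansion :: "nat \<Rightarrow> qt mfps \<Rightarrow> (expo \<Rightarrow>\<^sub>0 qt)" where
  "power_sum_expansion a f = (THE c.
      (\<forall>m\<in>Poly_Mapping.keys c. Poly_Mapping.keys m \<subseteq> {1..}) \<and> ppoly_eval mconst c (psum a) = f)"

text \<open>For \<open>f\<close> in \<open>Lam a\<close>, the plethystic evaluation \<open>f[A]\<close>, where the plethystic alphabet \<open>A\<close> is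
  represented by the function \<open>k \<mapsto> p\<^sub>k[A]\<close>.\<close>

definition plethysm :: "(qt \<Rightarrow> 'r::comm_ring_1) \<Rightarrow> nat \<Rightarrow> qt mfps \<Rightarrow> (nat \<Rightarrow> 'r) \<Rightarrow> 'r" where
  "plethysm emb a f A = ppoly_eval emb (power_sum_expansion a f) A"

definition mexp :: "qt mfps fps \<Rightarrow> qt mfps fps" where
  "mexp g = Abs_fps (\<lambda>n. mconst (1 / of_nat (fact n))) oo g"

text \<open>The operator \<open>\<B>\<^sub>n\<close> on symmetric functions in \<open>Z = x\<^sub>a + x\<^sub>a\<^sub>+\<^sub>1 + \<dots>\<close>. Since \<open>\<Omega>[(1 - t) u\<^sup>-\<^sup>1 Z]\<close> is a
  power series in \<open>u\<^sup>-\<^sup>1\<close>, while \<open>f[Z - u]\<close> is a polynomial in \<open>u\<close>, the product is formed in Laurent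
  series in the variable \<open>u\<^sup>-\<^sup>1\<close>, so that \<^const>\<open>fls_X_inv\<close> is \<open>u\<close>. The plethystic rules used are
  \<open>p\<^sub>k[Z - u] = p\<^sub>k[Z] - u\<^sup>k\<close> and \<open>p\<^sub>k[(1 - t) u\<^sup>-\<^sup>1 Z] = (1 - t\<^sup>k) u\<^sup>-\<^sup>k p\<^sub>k[Z]\<close>.\<close>

definition Omega_series :: "nat \<Rightarrow> qt mfps fps" where
  "Omega_series a =
     mexp (Abs_fps (\<lambda>k. if k = 0 then 0 else mconst ((1 - tt ^ k) / of_nat k) * psum a k))"

definition BB :: "nat \<Rightarrow> nat \<Rightarrow> qt mfps \<Rightarrow> qt mfps" where
  "BB a n f = fls_nth
     (fls_X_inv ^ n
      * plethysm (\<lambda>c. fls_const (mconst c)) a f (\<lambda>k. fls_const (psum a k) - fls_X_inv ^ k)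
      * fps_to_fls (Omega_series a)) 0"


section \<open>The operators on \<open>\<P>(s)\<close>\<close>

definition TT :: "nat \<Rightarrow> qt mfps \<Rightarrow> qt mfps" where
  "TT i f = (let sf = mperm (transpose i (Suc i)) f in
     sf + mconst (1 - tt) * mvar i * (THE h. (mvar i - mvar (Suc i)) * h = f - sf))"

text \<open>\<open>T\<^sub>1 T\<^sub>2 \<dots> T\<^sub>s\<close>, where \<open>T\<^sub>s\<close> acts first.\<close>

definition d_plus :: "nat \<Rightarrow> qt mfps \<Rightarrow> qt mfps" where
  "d_plus s f = - foldr TT [1..<Suc s] (mvar (Suc s) * f)"

text \<open>Every \<open>f\<close> in \<open>PP s\<close> is uniquely the sum of \<open>x\<^sup>\<eta> g\<^sub>\<eta>\<close> over the \<open>\<eta>\<close> supported on \<open>{1..s}\<close>, with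
  \<open>g\<^sub>\<eta>\<close> symmetric in the remaining variables and almost all \<open>g\<^sub>\<eta>\<close> zero; this is \<open>g\<^sub>\<eta>\<close>.\<close>

definition sym_part :: "nat \<Rightarrow> expo \<Rightarrow> qt mfps \<Rightarrow> qt mfps" where
  "sym_part s \<eta> f =
     Mfps (\<lambda>\<beta>. if Poly_Mapping.keys \<beta> \<subseteq> {Suc s..} then mcoeff f (\<eta> + \<beta>) else 0)"

text \<open>The operator from \<open>PP s\<close> to \<open>PP (s - 1)\<close>, for \<open>s \<ge> 1\<close>, linearly extended from the products
  \<open>x\<^sup>\<eta> g\<close>. Here \<open>g(x\<^sub>s\<^sub>+\<^sub>1, \<dots>)\<close> is first turned into \<open>g[Z]\<close> with \<open>Z = x\<^sub>s + x\<^sub>s\<^sub>+\<^sub>1 + \<dots>\<close>.\<close>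

definition d_minus :: "nat \<Rightarrow> qt mfps \<Rightarrow> qt mfps" where
  "d_minus s f = (\<Sum>\<eta> | Poly_Mapping.keys \<eta> \<subseteq> {1..s} \<and> sym_part s \<eta> f \<noteq> 0.
     mmonom (Poly_Mapping.update s 0 \<eta>)
     * BB s (Poly_Mapping.lookup \<eta> s) (plethysm mconst (Suc s) (sym_part s \<eta> f) (psum s)))"

definition corner_op :: "nat \<Rightarrow> qt mfps \<Rightarrow> qt mfps" where
  "corner_op s f = mconst (1 / (tt - 1)) *
     (d_minus (Suc s) (- d_plus s f) - (- d_plus (s - 1) (d_minus s f)))"


section \<open>Partial Dyck paths, area and corners\<close>

datatype step = North | East

definition norths :: "step list \<Rightarrow> nat" where
  "norths w = count_list w North"

definition easts :: "step list \<Rightarrow> nat" where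
  "easts w = count_list w East"

text \<open>A path from \<open>(0, r)\<close> is given by its list of steps.\<close>

definition Dyck :: "nat \<Rightarrow> nat \<Rightarrow> step list set" where
  "Dyck r d = {w. easts w = d \<and> r + norths w = d \<and>
                  (\<forall>k\<le>length w. easts (take k w) \<le> r + norths (take k w))}"

text \<open>The boxes below a path, the path being extended by \<open>r\<close> north steps from \<open>(0, 0)\<close>: an east step
  ending at \<open>(i, h)\<close> has the boxes \<open>(i, 1), \<dots>, (i, h)\<close> below it, boxes being named by their
  northeast corners.\<close>

definition boxes_below :: "nat \<Rightarrow> step list \<Rightarrow> (nat \<times> nat) set" where
  "boxes_below r w = (let e = replicate r North @ w in
     {(i, j). \<exists>k<length e. e ! k = East \<and> i = easts (take (Suc k) e)
              \<and> 1 \<le> j \<and> j \<le> norths (take (Suc k) e)})"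

text \<open>The box \<open>(i, j)\<close> lies entirely above the diagonal iff its southeast corner \<open>(i, j - 1)\<close> is
  weakly above it, that is, iff \<open>i < j\<close>.\<close>

definition Area :: "nat \<Rightarrow> step list \<Rightarrow> (nat \<times> nat) set" where
  "Area r w = {(i, j) \<in> boxes_below r w. i < j}"

definition corners :: "nat \<Rightarrow> step list \<Rightarrow> (nat \<times> nat) set" where
  "corners r w = {(i, j). (i, j) \<notin> boxes_below r w
                        \<and> (i, j - 1) \<in> boxes_below r w \<and> (Suc i, j) \<in> boxes_below r w}"


section \<open>The series \<open>\<G>\<close> and the characteristic function \<open>\<chi>\<close>\<close>

datatype letter = Pos nat | Neg nat

fun absl :: "letter \<Rightarrow> nat" where
  "absl (Pos v) = v"
| "absl (Neg v) = v"

fun is_neg :: "letter \<Rightarrow> bool" where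
  "is_neg (Pos v) = False"
| "is_neg (Neg v) = True"

instantiation letter :: linorder
begin

definition less_letter :: "letter \<Rightarrow> letter \<Rightarrow> bool" where
  "a < b \<longleftrightarrow> absl a < absl b \<or> (absl a = absl b \<and> \<not> is_neg a \<and> is_neg b)"

definition less_eq_letter :: "letter \<Rightarrow> letter \<Rightarrow> bool" where
  "a \<le> b \<longleftrightarrow> a < b \<or> a = (b :: letter)"

instance
proof
  fix a b c :: letter
  show "a < b \<longleftrightarrow> a \<le> b \<and> \<not> b \<le> a" "a \<le> a" "a \<le> b \<Longrightarrow> b \<le> c \<Longrightarrow> a \<le> c"
    "a \<le> b \<Longrightarrow> b \<le> a \<Longrightarrow> a = b" "a \<le> b \<or> b \<le> a"
    by (cases a; cases b; cases c; auto simp: less_letter_def less_eq_letter_def)+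
qed

end

definition alphabet :: "letter set" where
  "alphabet = {a. 1 \<le> absl a}"

definition row_increasing :: "letter \<Rightarrow> letter \<Rightarrow> bool" where
  "row_increasing a b \<longleftrightarrow> a < b \<or> (a = b \<and> \<not> is_neg a)"

definition flagged_row_words :: "nat \<Rightarrow> nat \<Rightarrow> (nat \<times> nat) set \<Rightarrow> (nat \<Rightarrow> letter) set" where
  "flagged_row_words r d S = {T \<in> {1..d} \<rightarrow>\<^sub>E alphabet.
      (\<forall>(i, j)\<in>S. row_increasing (T j) (T i)) \<and> (\<forall>i\<in>{1..r}. T i \<le> Pos i)}"

definition inv_count :: "nat \<Rightarrow> step list \<Rightarrow> (nat \<Rightarrow> letter) \<Rightarrow> nat" where
  "inv_count r w T = card {(i, j) \<in> Area r w. row_increasing (T j) (T i)}"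

definition neg_count :: "nat \<Rightarrow> (nat \<Rightarrow> letter) \<Rightarrow> nat" where
  "neg_count d T = card {i \<in> {1..d}. is_neg (T i)}"

definition weight :: "nat \<Rightarrow> (nat \<Rightarrow> letter) \<Rightarrow> expo" where
  "weight d T = (\<Sum>i\<in>{1..d}. Poly_Mapping.single (absl (T i)) 1)"

text \<open>The sum over words is infinite, but only finitely many words have a given weight, so the
  series is given coefficientwise.\<close>

definition GG :: "nat \<Rightarrow> nat \<Rightarrow> step list \<Rightarrow> (nat \<times> nat) set \<Rightarrow> qt mfps" where
  "GG r d w S = Mfps (\<lambda>\<alpha>. \<Sum>T | T \<in> flagged_row_words r d S \<and> weight d T = \<alpha>.
     tt ^ inv_count r w T * (- tt) ^ neg_count d T)"

text \<open>Backward traversal of a path from its current end \<open>(x, y)\<close>, the remaining steps being listed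
  last step first; at \<open>(x, y)\<close> the current series lies in \<open>PP (y - x)\<close>. The two steps of a corner
  \<open>(x, y)\<close> are the east step into \<open>(x, y - 1)\<close> and the north step from there to \<open>(x, y)\<close>, so the condition on \<open>w\<close>
  in the corner case is automatic when \<open>S\<close> consists of corners.\<close>

fun traverse :: "(nat \<times> nat) set \<Rightarrow> nat \<Rightarrow> nat \<Rightarrow> step list \<Rightarrow> qt mfps \<Rightarrow> qt mfps" where
  "traverse S x y [] f = f"
| "traverse S x y (East # w) f = traverse S (x - 1) y w (- d_plus (y - x) f)"
| "traverse S x y (North # w) f =
     (if (x, y) \<in> S \<and> w \<noteq> [] \<and> hd w = East
      then traverse S (x - 1) (y - 1) (tl w) (corner_op (y - x) f)
      else traverse S x (y - 1) w (d_minus (y - x) f))"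

definition chi :: "nat \<Rightarrow> step list \<Rightarrow> (nat \<times> nat) set \<Rightarrow> qt mfps" where
  "chi d w S = traverse S d d (rev w) 1"

end

theory Submission
  imports Defs
begin

text \<open>Summing over the signs kills every word whose absolute values are not a proper colouring of
  the graph with edge set \<open>Area(\<pi>)\<close>, and the flags then force \<open>T(i) = i\<close> for \<open>i \<le> r\<close>. So
  \<open>\<G>\<^sub>r\<close> is a power of \<open>1 - t\<close> times the generating function of proper colourings, weighted by
  \<open>t\<close> to the number of edges \<open>i < j\<close> with \<open>c(j) < c(i)\<close>, whose first \<open>r\<close> letters are fixed.

  The positions coloured \<open>k\<close> or \<open>k + 1\<close> span a disjoint union of paths. Following the path of a
  fixed position to the left of all free positions shows that raising its letter from \<open>k\<close> to
  \<open>k + 1\<close> is the operator \<open>t T\<^sub>k\<^sup>-\<^sup>1\<close>.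

  For an east step, \<open>T\<^sub>1 \<dots> T\<^sub>s x\<^sub>s\<^sub>+\<^sub>1 = x\<^sub>1 (t T\<^sub>1\<^sup>-\<^sup>1) \<dots> (t T\<^sub>s\<^sup>-\<^sup>1)\<close> raises the fixed letters by one
  and adds a new position with letter 1. For a north step, \<open>d\<^sub>-\<close> is linear over the symmetric
  functions in \<open>x\<^sub>s, x\<^sub>s\<^sub>+\<^sub>1, \<dots>\<close> and replaces \<open>x\<^sub>s\<^sup>n\<close> by the \<open>n\<close>-th coefficient of \<open>\<Omega>\<close>; on multiples of
  \<open>x\<^sub>s\<close> this is \<open>1 - t\<close> times the sum of all \<open>(t T\<^sub>k\<^sub>-\<^sub>1\<^sup>-\<^sup>1) \<dots> (t T\<^sub>s\<^sup>-\<^sup>1)\<close>, that is, the letter of the last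
  fixed position is set free. A marked corner is the difference of the graphs with and without the
  corner box, divided by \<open>t - 1\<close>.\<close>

section \<open>Monomials, permutations and truncation\<close>

text \<open>The operators \<open>T_k\<close> divide and the sums over letters are infinite, and the
  statements are arranged to avoid both. The relation \<open>g = t T_k^-1 f\<close> is used as a
  polynomial identity; it determines \<open>g\<close> because \<open>x_k - x_{k+1}\<close> is no
  zero divisor. Series over colourings are compared after all but finitely many variables are set to
  zero.

  Inverse operators enter through \<open>T_k x_{k+1} = t x_k T_k^-1\<close>, by which the factor
  \<open>x_{s+1}\<close> in \<open>d_+\<close> passes to the left of all the \<open>T_k\<close>.

  The two-letter graphs are paths because the area contains, with a pair of positions, every pair
  inside it. If two positions of such a graph are adjacent and a third lies between them, the three
  form a triangle, and no proper colouring with two letters exists. So a recursion on the leftmost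
  position suffices.

  The powers of \<open>1 - t\<close> have different origins. A free position of a word without an
  equal left neighbour has two signs, with total \<open>1 - t\<close>; each \<open>d_-\<close>
  contributes the \<open>1 - t\<close> that telescopes out of \<open>\<Omega>\<close>.\<close>

abbreviation lookup :: "expo \<Rightarrow> nat \<Rightarrow> nat" where "lookup \<equiv> Poly_Mapping.lookup"
abbreviation keys :: "expo \<Rightarrow> nat set" where "keys \<equiv> Poly_Mapping.keys"
abbreviation single :: "nat \<Rightarrow> nat \<Rightarrow> expo" where "single \<equiv> Poly_Mapping.single"
abbreviation map_key :: "(nat \<Rightarrow> nat) \<Rightarrow> expo \<Rightarrow> expo" where "map_key \<equiv> Poly_Mapping.map_key"

lemma expo_eqI: "(\<And>i. lookup \<alpha> i = lookup \<beta> i) \<Longrightarrow> \<alpha> = \<beta>"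
  by (rule poly_mapping_eqI)

lemma lookup_map_key: "inj \<sigma> \<Longrightarrow> lookup (map_key \<sigma> \<alpha>) i = lookup \<alpha> (\<sigma> i)"
  by (simp add: map_key.rep_eq)

lemma keys_add_expo: "keys (\<alpha> + \<beta>) = keys \<alpha> \<union> keys \<beta>"
  by (auto simp: in_keys_iff lookup_add)

lemma mcoeff_mmonom: "mcoeff (mmonom \<eta>) \<alpha> = (if \<alpha> = \<eta> then 1 else 0)"
  by (simp add: mmonom_def)

lemma mcoeff_mconst: "mcoeff (mconst c) \<alpha> = (if \<alpha> = 0 then c else 0)"
  by (simp add: mconst_def)

lemma mcoeff_mmonom_mult_eq_0:
  assumes "\<And>\<gamma>. \<alpha> \<noteq> \<eta> + \<gamma>"
  shows "mcoeff (mmonom \<eta> * f) \<alpha> = 0"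
  unfolding mcoeff_mult using assms
  by (intro sum.neutral) (auto simp: splits_def mcoeff_mmonom)

lemma mcoeff_mmonom_mult_add:
  "mcoeff (mmonom \<eta> * f) (\<eta> + \<gamma>) = mcoeff (f :: 'a::comm_ring_1 mfps) \<gamma>"
proof -
  have "mcoeff (mmonom \<eta> * f) (\<eta> + \<gamma>) =
      (\<Sum>p\<in>splits (\<eta> + \<gamma>). if p = (\<eta>, \<gamma>) then mcoeff f \<gamma> else 0)"
    unfolding mcoeff_mult by (rule sum.cong) (auto simp: splits_def mcoeff_mmonom split: if_splits)
  also have "\<dots> = mcoeff f \<gamma>"
    by (subst sum.delta[OF finite_splits]) (auto simp: splits_def)
  finally show ?thesis .
qed

lemma expo_diff_add: "lookup \<alpha> i \<noteq> 0 \<Longrightarrow> single i 1 + (\<alpha> - single i 1) = (\<alpha> :: expo)"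
  by (rule expo_eqI) (auto simp: lookup_add lookup_minus lookup_single when_def)

lemma mcoeff_mvar_mult:
  "mcoeff (mvar i * f) \<alpha> =
     (if lookup \<alpha> i = 0 then 0 else mcoeff (f :: 'a::comm_ring_1 mfps) (\<alpha> - single i 1))"
proof (cases "lookup \<alpha> i = 0")
  case True
  then have "\<alpha> \<noteq> single i 1 + \<gamma>" for \<gamma> by (auto simp: lookup_add)
  then show ?thesis using True by (simp add: mvar_def mcoeff_mmonom_mult_eq_0)
next
  case False
  then show ?thesis
    using mcoeff_mmonom_mult_add[of "single i 1" f "\<alpha> - single i 1"] expo_diff_add[OF False]
    by (simp only: mvar_def if_False)
qed

lemma mcoeff_mconst_mult [simp]:
  "mcoeff (mconst c * f) \<alpha> = c * mcoeff (f :: 'a::comm_ring_1 mfps) \<alpha>"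
proof -
  have "mcoeff (mconst c * f) \<alpha> = (\<Sum>p\<in>splits \<alpha>. if p = (0, \<alpha>) then c * mcoeff f \<alpha> else 0)"
    unfolding mcoeff_mult by (rule sum.cong) (auto simp: splits_def mcoeff_mconst split: if_splits)
  also have "\<dots> = c * mcoeff f \<alpha>"
    by (subst sum.delta[OF finite_splits]) (auto simp: splits_def)
  finally show ?thesis .
qed

lemma mcoeff_sum: "mcoeff (\<Sum>i\<in>A. f i) \<alpha> = (\<Sum>i\<in>A. mcoeff (f i :: 'a::comm_ring_1 mfps) \<alpha>)"
  by (induct A rule: infinite_finite_induct) auto

lemma mmonom_0: "mmonom 0 = 1"
  by (rule mfps_eqI) (simp add: mcoeff_mmonom mcoeff_1)

lemma mmonom_add: "mmonom (\<alpha> + \<beta>) = (mmonom \<alpha> * mmonom \<beta> :: 'a::comm_ring_1 mfps)"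
proof (rule mfps_eqI)
  fix \<gamma>
  show "mcoeff (mmonom (\<alpha> + \<beta>)) \<gamma> = mcoeff (mmonom \<alpha> * mmonom \<beta> :: 'a mfps) \<gamma>"
  proof (cases "\<exists>\<delta>. \<gamma> = \<alpha> + \<delta>")
    case True
    then show ?thesis by (auto simp: mcoeff_mmonom_mult_add mcoeff_mmonom)
  next
    case False
    then show ?thesis
      by (subst mcoeff_mmonom_mult_eq_0) (auto simp: mcoeff_mmonom)
  qed
qed

lemma mmonom_sum: "mmonom (\<Sum>i\<in>A. f i) = (\<Prod>i\<in>A. mmonom (f i) :: 'a::comm_ring_1 mfps)"
  by (induct A rule: infinite_finite_induct) (auto simp: mmonom_0 mmonom_add)

lemma mmonom_single: "mmonom (single i n) = (mvar i ^ n :: 'a::comm_ring_1 mfps)"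
proof (induct n)
  case (Suc n)
  have "single i (Suc n) = single i 1 + single i n" by (simp flip: single_add)
  then show ?case using Suc by (simp add: mmonom_add mvar_def)
qed (simp add: mmonom_0)

lemma mconst_0 [simp]: "mconst 0 = (0 :: 'a::comm_ring_1 mfps)"
  and mconst_1 [simp]: "mconst 1 = (1 :: 'a::comm_ring_1 mfps)"
  by (rule mfps_eqI, simp add: mcoeff_mconst mcoeff_1)+

lemma mconst_add: "mconst (a + b) = (mconst a + mconst b :: 'a::comm_ring_1 mfps)"
  and mconst_diff: "mconst (a - b) = (mconst a - mconst b :: 'a::comm_ring_1 mfps)"
  by (rule mfps_eqI, simp add: mcoeff_mconst)+

lemma mconst_mult: "mconst (a * b) = (mconst a * mconst b :: 'a::comm_ring_1 mfps)"
  by (rule mfps_eqI) (simp add: mcoeff_mconst)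

lemma mconst_sum: "mconst (\<Sum>i\<in>A. f i) = (\<Sum>i\<in>A. mconst (f i) :: 'a::comm_ring_1 mfps)"
  by (induct A rule: infinite_finite_induct) (auto simp: mconst_add)

lemma mconst_prod: "mconst (\<Prod>i\<in>A. f i) = (\<Prod>i\<in>A. mconst (f i) :: 'a::comm_ring_1 mfps)"
  by (induct A rule: infinite_finite_induct) (auto simp: mconst_mult)

lemma mconst_of_nat: "mconst (of_nat n) = (of_nat n :: 'a::comm_ring_1 mfps)"
  by (induct n) (simp_all add: mconst_add)

text \<open>Compared at \<open>x_i x^\<beta>\<close>, the hypothesis equates the coefficient of
  \<open>h\<close> at \<beta> with the one where a factor \<open>x_j\<close> is traded for
  \<open>x_i\<close>. Induction on the exponent of \<open>x_j\<close> ends at 0, where that second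
  term is absent.\<close>

lemma mvar_diff_nonzero_divisor:
  fixes h :: "'a::comm_ring_1 mfps"
  assumes "(mvar i - mvar j) * h = 0" "i \<noteq> j"
  shows "h = 0"
proof -
  have "mcoeff h \<beta> = 0" if "lookup \<beta> j = n" for n \<beta>
    using that
  proof (induct n arbitrary: \<beta>)
    case (0 \<beta>)
    have "mcoeff ((mvar i - mvar j) * h) (single i 1 + \<beta>) = 0" by (simp add: assms(1))
    then show ?case using 0 assms(2)
      by (simp add: left_diff_distrib mcoeff_mvar_mult lookup_add lookup_single when_def)
  next
    case (Suc n \<beta>)
    let ?\<gamma> = "single i 1 + \<beta> - single j 1"
    have "mcoeff ((mvar i - mvar j) * h) (single i 1 + \<beta>) = 0" by (simp add: assms(1))
    then have "mcoeff h \<beta> = mcoeff h ?\<gamma>" using Suc.prems assms(2)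
      by (simp add: left_diff_distrib mcoeff_mvar_mult lookup_add lookup_single when_def)
    also have "\<dots> = 0"
      by (rule Suc.hyps) (use Suc.prems assms(2) in \<open>simp add: lookup_add lookup_minus lookup_single when_def\<close>)
    finally show ?case .
  qed
  then show ?thesis by (intro mfps_eqI) simp
qed

section \<open>Permutations of the variables\<close>

lemma mcoeff_mperm: "mcoeff (mperm \<sigma> f) \<alpha> = mcoeff f (map_key \<sigma> \<alpha>)"
  by (simp add: mperm_def)

lemma mperm_0 [simp]: "mperm \<sigma> 0 = 0"
  and mperm_add: "mperm \<sigma> (f + g) = mperm \<sigma> f + mperm \<sigma> g"
  and mperm_diff: "mperm \<sigma> (f - g) = mperm \<sigma> f - mperm \<sigma> g"
  for f g :: "'a::comm_ring_1 mfps"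
  by (rule mfps_eqI, simp add: mcoeff_mperm)+

lemma mperm_sum: "mperm \<sigma> (\<Sum>i\<in>A. f i) = (\<Sum>i\<in>A. mperm \<sigma> (f i :: 'a::comm_ring_1 mfps))"
  by (induct A rule: infinite_finite_induct) (auto simp: mperm_add)

lemma map_key_eq_0_iff: "bij \<sigma> \<Longrightarrow> map_key \<sigma> \<alpha> = 0 \<longleftrightarrow> \<alpha> = 0"
proof
  assume \<sigma>: "bij \<sigma>" and 0: "map_key \<sigma> \<alpha> = 0"
  show "\<alpha> = 0"
  proof (rule expo_eqI)
    fix i
    have "lookup (map_key \<sigma> \<alpha>) (inv \<sigma> i) = 0" using 0 by simp
    then show "lookup \<alpha> i = lookup 0 i"
      using \<sigma> by (simp add: lookup_map_key bij_is_inj bij_is_surj surj_f_inv_f)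
  qed
qed (simp add: map_key_zero bij_is_inj)

lemma map_key_inv_cancel:
  "bij \<sigma> \<Longrightarrow> map_key \<sigma> (map_key (inv \<sigma>) \<alpha>) = \<alpha>"
  "bij \<sigma> \<Longrightarrow> map_key (inv \<sigma>) (map_key \<sigma> \<alpha>) = \<alpha>"
  by (rule expo_eqI; simp add: lookup_map_key bij_is_inj bij_imp_bij_inv bij_is_surj surj_f_inv_f)+

lemma mperm_mult:
  fixes f g :: "'a::comm_ring_1 mfps"
  assumes "bij \<sigma>" shows "mperm \<sigma> (f * g) = mperm \<sigma> f * mperm \<sigma> g"
proof (rule mfps_eqI)
  fix \<alpha>
  have i: "inj \<sigma>" "inj (inv \<sigma>)" using assms by (simp_all add: bij_is_inj bij_imp_bij_inv)
  show "mcoeff (mperm \<sigma> (f * g)) \<alpha> = mcoeff (mperm \<sigma> f * mperm \<sigma> g) \<alpha>"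
    unfolding mcoeff_mperm mcoeff_mult
    by (rule sum.reindex_bij_witness[where i = "map_prod (map_key \<sigma>) (map_key \<sigma>)"
          and j = "map_prod (map_key (inv \<sigma>)) (map_key (inv \<sigma>))"])
       (auto simp: splits_def map_key_inv_cancel assms i simp flip: map_key_plus)
qed

lemma mperm_mconst [simp]: "bij \<sigma> \<Longrightarrow> mperm \<sigma> (mconst c) = mconst c"
  by (rule mfps_eqI) (simp add: mcoeff_mperm mcoeff_mconst map_key_eq_0_iff)

lemma mperm_1 [simp]: "bij \<sigma> \<Longrightarrow> mperm \<sigma> (1 :: 'a::comm_ring_1 mfps) = 1"
  using mperm_mconst[of \<sigma> "1 :: 'a"] by simp

lemma mperm_mvar: "bij \<sigma> \<Longrightarrow> mperm \<sigma> (mvar i) = mvar (\<sigma> i)"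
proof (rule mfps_eqI)
  fix \<alpha> assume \<sigma>: "bij \<sigma>"
  have "map_key \<sigma> \<alpha> = single i 1 \<longleftrightarrow> \<alpha> = single (\<sigma> i) 1"
    using \<sigma> map_key_inv_cancel[OF \<sigma>] map_key_single[OF bij_is_inj[OF \<sigma>]] by metis
  then show "mcoeff (mperm \<sigma> (mvar i)) \<alpha> = mcoeff (mvar (\<sigma> i)) \<alpha>"
    by (simp add: mcoeff_mperm mvar_def mcoeff_mmonom)
qed

lemma mperm_prod:
  "bij \<sigma> \<Longrightarrow> mperm \<sigma> (\<Prod>i\<in>A. f i) = (\<Prod>i\<in>A. mperm \<sigma> (f i :: 'a::comm_ring_1 mfps))"
  by (induct A rule: infinite_finite_induct) (auto simp: mperm_mult)

lemma mperm_power: "bij \<sigma> \<Longrightarrow> mperm \<sigma> (f ^ n) = mperm \<sigma> (f :: 'a::comm_ring_1 mfps) ^ n"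
  by (induct n) (auto simp: mperm_mult)

text \<open>Truncation sets \<open>x\<^sub>i = 0\<close> for \<open>i > N\<close>; it makes the sums over colourings finite.\<close>

definition trunc :: "nat \<Rightarrow> 'a mfps \<Rightarrow> 'a::zero mfps" where
  "trunc N f = Mfps (\<lambda>\<alpha>. if keys \<alpha> \<subseteq> {..N} then mcoeff f \<alpha> else 0)"

lemma mcoeff_trunc: "mcoeff (trunc N f) \<alpha> = (if keys \<alpha> \<subseteq> {..N} then mcoeff f \<alpha> else 0)"
  by (simp add: trunc_def)

lemma trunc_eqI:
  assumes "\<And>N. N \<ge> M \<Longrightarrow> trunc N f = trunc N g" shows "f = g"
proof (rule mfps_eqI)
  fix \<alpha>
  define N where "N = max M (Max (insert 0 (keys \<alpha>)))"
  have "keys \<alpha> \<subseteq> {..N}" unfolding N_def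
    by (auto intro!: max.coboundedI2 Max_ge)
  moreover have "trunc N f = trunc N g" by (rule assms) (simp add: N_def)
  ultimately show "mcoeff f \<alpha> = mcoeff g \<alpha>" by (metis mcoeff_trunc)
qed

lemma trunc_0 [simp]: "trunc N 0 = (0 :: 'a::comm_ring_1 mfps)"
  and trunc_add: "trunc N (f + g) = trunc N f + trunc N g"
  and trunc_diff: "trunc N (f - g) = trunc N f - trunc N g"
  for f g :: "'a::comm_ring_1 mfps"
  by (rule mfps_eqI, simp add: mcoeff_trunc)+

lemma trunc_mult: "trunc N (f * g) = trunc N f * trunc N (g :: 'a::comm_ring_1 mfps)"
proof (rule mfps_eqI)
  fix \<alpha>
  show "mcoeff (trunc N (f * g)) \<alpha> = mcoeff (trunc N f * trunc N g) \<alpha>"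
  proof (cases "keys \<alpha> \<subseteq> {..N}")
    case True
    then show ?thesis
      by (auto simp: mcoeff_trunc mcoeff_mult splits_def keys_add_expo intro!: sum.cong)
  next
    case False
    then have "mcoeff (trunc N f * trunc N g) \<alpha> = 0"
      unfolding mcoeff_mult
      by (intro sum.neutral) (auto simp: mcoeff_trunc splits_def keys_add_expo)
    then show ?thesis using False by (simp add: mcoeff_trunc)
  qed
qed

lemma trunc_mconst [simp]: "trunc N (mconst c) = mconst c"
  by (rule mfps_eqI) (simp add: mcoeff_trunc mcoeff_mconst)

lemma trunc_1 [simp]: "trunc N (1 :: 'a::comm_ring_1 mfps) = 1"
  using trunc_mconst[of N "1 :: 'a"] by simp

lemma trunc_mvar: "trunc N (mvar i) = (if i \<le> N then mvar i else (0 :: 'a::comm_ring_1 mfps))"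
  by (rule mfps_eqI) (auto simp: mcoeff_trunc mvar_def mcoeff_mmonom split: if_splits)

lemma trunc_sum: "trunc N (\<Sum>i\<in>A. f i) = (\<Sum>i\<in>A. trunc N (f i :: 'a::comm_ring_1 mfps))"
  by (induct A rule: infinite_finite_induct) (auto simp: trunc_add)

lemma trunc_mperm:
  assumes "\<sigma> permutes {..N}" shows "trunc N (mperm \<sigma> f) = mperm \<sigma> (trunc N f)"
proof (rule mfps_eqI)
  fix \<alpha>
  have "\<sigma> -` keys \<alpha> \<subseteq> {..N} \<longleftrightarrow> keys \<alpha> \<subseteq> {..N}"
    using permutes_vimage[OF assms] permutes_surj[OF assms]
    by (metis surj_image_vimage_eq permutes_image[OF assms] image_mono vimage_mono)
  then show "mcoeff (trunc N (mperm \<sigma> f)) \<alpha> = mcoeff (mperm \<sigma> (trunc N f)) \<alpha>"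
    using permutes_inj[OF assms] by (simp add: mcoeff_trunc mcoeff_mperm keys_map_key)
qed

abbreviation adj :: "nat \<Rightarrow> 'a mfps \<Rightarrow> 'a mfps" where
  "adj k \<equiv> mperm (transpose k (Suc k))"

lemma trunc_adj: "Suc k \<le> N \<Longrightarrow> trunc N (adj k f) = adj k (trunc N f)"
  by (rule trunc_mperm) (simp add: permutes_swap_id)

section \<open>Colourings with two letters\<close>

text \<open>Area sets have this property: a box that lies to the right of and below a box under the
  path is again under the path, as long as it stays above the diagonal.\<close>

definition interval_closed :: "(nat \<times> nat) set \<Rightarrow> bool" where
  "interval_closed E \<longleftrightarrow>
     (\<forall>i j i' j'. (i, j) \<in> E \<longrightarrow> i \<le> i' \<longrightarrow> i' < j' \<longrightarrow> j' \<le> j \<longrightarrow> (i', j') \<in> E)"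

text \<open>The arguments are the colours of the left and the right end of an edge, so
  \<open>t\<close> records a descent and a monochromatic edge kills the term.\<close>

definition edge2 :: "'r::comm_ring_1 \<Rightarrow> bool \<Rightarrow> bool \<Rightarrow> 'r" where
  "edge2 t u v = (if u = v then 0 else if u then t else 1)"

text \<open>The colour \<open>True\<close> stands for the larger letter, with variable \<open>b\<close>; \<open>W\<close> is the set of positions
  with this colour. The position \<open>p\<close>, coloured \<open>\<gamma>\<close>, is smaller than all of \<open>U\<close> and does not
  contribute a variable.\<close>

definition two_col ::
  "(nat \<times> nat) set \<Rightarrow> 'r::comm_ring_1 \<Rightarrow> 'r \<Rightarrow> 'r \<Rightarrow> bool \<Rightarrow> nat \<Rightarrow> nat set \<Rightarrow> 'r" where
  "two_col E t a b \<gamma> p U = (\<Sum>W\<in>Pow U. (\<Prod>i\<in>U. if i \<in> W then b else a) *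
     (\<Prod>e\<in>E \<inter> insert p U \<times> insert p U.
        edge2 t (if fst e = p then \<gamma> else fst e \<in> W) (if snd e = p then \<gamma> else snd e \<in> W)))"

text \<open>The sum over \<open>W\<close> is split by the colour \<delta> of the leftmost position
  \<open>u\<close>. Then \<open>u\<close> takes over the role of the fixed position, and
  \<open>p\<close> is tied to the rest only through the last product.\<close>

lemma two_col_step:
  assumes "finite U" "p < u" "\<forall>i\<in>U. u < i" "finite E" "\<forall>(i, j)\<in>E. i < j"
  shows "two_col E t a b \<gamma> p (insert u U) = (\<Sum>\<delta>\<in>UNIV. (if \<delta> then b else a) *
    (\<Sum>W\<in>Pow U. (\<Prod>i\<in>U. if i \<in> W then b else a) *
       (\<Prod>e\<in>E \<inter> insert u U \<times> insert u U.
          edge2 t (if fst e = u then \<delta> else fst e \<in> W) (if snd e = u then \<delta> else snd e \<in> W)) *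
       (\<Prod>i\<in>{i\<in>insert u U. (p, i) \<in> E}. edge2 t \<gamma> (if i = u then \<delta> else i \<in> W))))"
proof -
  have u: "u \<notin> U" and pu: "p \<notin> insert u U" using assms by auto
  define T where "T W = (\<Prod>i\<in>insert u U. if i \<in> W then b else a) *
     (\<Prod>e\<in>E \<inter> insert p (insert u U) \<times> insert p (insert u U).
        edge2 t (if fst e = p then \<gamma> else fst e \<in> W) (if snd e = p then \<gamma> else snd e \<in> W))" for W
  define R where "R \<delta> W = (if \<delta> then b else a) * ((\<Prod>i\<in>U. if i \<in> W then b else a) *
       (\<Prod>e\<in>E \<inter> insert u U \<times> insert u U.
          edge2 t (if fst e = u then \<delta> else fst e \<in> W) (if snd e = u then \<delta> else snd e \<in> W)) *
       (\<Prod>i\<in>{i\<in>insert u U. (p, i) \<in> E}. edge2 t \<gamma> (if i = u then \<delta> else i \<in> W)))" for \<delta> W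
  have split: "E \<inter> insert p (insert u U) \<times> insert p (insert u U) =
      (E \<inter> insert u U \<times> insert u U) \<union> Pair p ` {i\<in>insert u U. (p, i) \<in> E}"
    using assms by fastforce
  have T: "T (if \<delta> then insert u W else W) = R \<delta> W" if W: "W \<subseteq> U" for \<delta> W
  proof -
    let ?W = "if \<delta> then insert u W else W"
    have uW: "u \<notin> W" using u W by auto
    have 1: "(\<Prod>i\<in>insert u U. if i \<in> ?W then b else a) =
        (if \<delta> then b else a) * (\<Prod>i\<in>U. if i \<in> W then b else a)"
    proof -
      have "(\<Prod>i\<in>U. if i \<in> ?W then b else a) = (\<Prod>i\<in>U. if i \<in> W then b else a)"
        by (rule prod.cong) (use u in auto)
      moreover have "u \<notin> W" using u W by auto
      ultimately show ?thesis using u assms(1) by simp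
    qed
    have 2: "(\<Prod>e\<in>E \<inter> insert u U \<times> insert u U.
        edge2 t (if fst e = p then \<gamma> else fst e \<in> ?W) (if snd e = p then \<gamma> else snd e \<in> ?W)) =
      (\<Prod>e\<in>E \<inter> insert u U \<times> insert u U.
          edge2 t (if fst e = u then \<delta> else fst e \<in> W) (if snd e = u then \<delta> else snd e \<in> W))"
      using u pu W by (intro prod.cong) (auto split: if_splits intro!: arg_cong2[of _ _ _ _ "edge2 t"])
    have 3: "(\<Prod>e\<in>Pair p ` {i\<in>insert u U. (p, i) \<in> E}.
        edge2 t (if fst e = p then \<gamma> else fst e \<in> ?W) (if snd e = p then \<gamma> else snd e \<in> ?W)) =
      (\<Prod>i\<in>{i\<in>insert u U. (p, i) \<in> E}. edge2 t \<gamma> (if i = u then \<delta> else i \<in> W))"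
      using u uW pu W by (subst prod.reindex) (auto simp: inj_on_def intro!: prod.cong)
    have dj: "(E \<inter> insert u U \<times> insert u U) \<inter> Pair p ` {i\<in>insert u U. (p, i) \<in> E} = {}"
      using pu by auto
    have fin: "finite (E \<inter> insert u U \<times> insert u U)" "finite (Pair p ` {i\<in>insert u U. (p, i) \<in> E})"
      using assms(1) by auto
    show ?thesis unfolding T_def R_def split prod.union_disjoint[OF fin dj] 1 2 3
      by (simp only: mult.assoc)
  qed
  have "two_col E t a b \<gamma> p (insert u U) = sum T (Pow U \<union> insert u ` Pow U)"
    unfolding two_col_def T_def by (simp add: Pow_insert)
  also have "\<dots> = sum T (Pow U) + sum T (insert u ` Pow U)"
    using u assms(1) by (intro sum.union_disjoint) auto
  also have "sum T (insert u ` Pow U) = (\<Sum>W\<in>Pow U. T (insert u W))"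
    using u by (subst sum.reindex) (auto simp: inj_on_def)
  also have "\<dots> = (\<Sum>W\<in>Pow U. R True W)"
    using T[of _ True] by (intro sum.cong) auto
  also have "sum T (Pow U) = (\<Sum>W\<in>Pow U. R False W)"
    using T[of _ False] by (intro sum.cong) auto
  finally show ?thesis
    by (simp add: UNIV_bool R_def sum_distrib_left mult.assoc)
qed

lemma two_col_step_nonadj:
  assumes "finite U" "p < u" "\<forall>i\<in>U. u < i" "finite E" "\<forall>(i, j)\<in>E. i < j"
    and "\<forall>i\<in>insert u U. (p, i) \<notin> E"
  shows "two_col E t a b \<gamma> p (insert u U) =
     a * two_col E t a b False u U + b * two_col E t a b True u U"
proof -
  have "{i\<in>insert u U. (p, i) \<in> E} = {}" using assms by auto
  then show ?thesis
    by (simp only: two_col_step[OF assms(1-5)]) (simp add: two_col_def UNIV_bool add.commute)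
qed

lemma two_col_step_adj:
  assumes "finite U" "p < u" "\<forall>i\<in>U. u < i" "finite E" "\<forall>(i, j)\<in>E. i < j"
    and "(p, u) \<in> E" "\<forall>i\<in>U. (p, i) \<notin> E"
  shows "two_col E t a b \<gamma> p (insert u U) =
     (if \<gamma> then t * a * two_col E t a b False u U else b * two_col E t a b True u U)"
proof -
  have "{i\<in>insert u U. (p, i) \<in> E} = {u}" using assms by auto
  then show ?thesis
    by (simp only: two_col_step[OF assms(1-5)])
       (simp add: two_col_def UNIV_bool edge2_def sum_distrib_left sum_distrib_right mult_ac)
qed

text \<open>Interval closure completes the edge from \<open>p\<close> to \<open>v\<close> to a
  triangle \<open>p\<close>, \<open>u\<close>, \<open>v\<close>, whose vertices cannot be pairwise
  different with two colours.\<close>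

lemma two_col_step_triangle:
  assumes "finite U" "p < u" "\<forall>i\<in>U. u < i" "finite E" "\<forall>(i, j)\<in>E. i < j"
    and "interval_closed E" "v \<in> U" "(p, v) \<in> E"
  shows "two_col E t a b \<gamma> p (insert u U) = 0"
proof -
  have pu: "(p, u) \<in> E" "(u, v) \<in> E"
    using assms unfolding interval_closed_def by (meson less_imp_le order_refl)+
  have vu: "v \<noteq> u" using assms by auto
  have "(\<Prod>e\<in>E \<inter> insert u U \<times> insert u U.
          edge2 t (if fst e = u then \<delta> else fst e \<in> W) (if snd e = u then \<delta> else snd e \<in> W)) *
       (\<Prod>i\<in>{i\<in>insert u U. (p, i) \<in> E}. edge2 t \<gamma> (if i = u then \<delta> else i \<in> W)) = 0" for \<delta> W
  proof -
    consider "\<delta> = (v \<in> W)" | "\<gamma> = \<delta>" | "\<gamma> = (v \<in> W)" by blast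
    then show ?thesis
    proof cases
      case 1
      have "(\<Prod>e\<in>E \<inter> insert u U \<times> insert u U. edge2 t (if fst e = u then \<delta> else fst e \<in> W)
          (if snd e = u then \<delta> else snd e \<in> W)) = 0"
        by (rule prod_zero[OF _ bexI[of _ "(u, v)"]]) (use assms pu vu 1 in \<open>auto simp: edge2_def\<close>)
      then show ?thesis by simp
    next
      case 2
      have "(\<Prod>i\<in>{i\<in>insert u U. (p, i) \<in> E}. edge2 t \<gamma> (if i = u then \<delta> else i \<in> W)) = 0"
        by (rule prod_zero[OF _ bexI[of _ u]]) (use assms pu 2 in \<open>auto simp: edge2_def\<close>)
      then show ?thesis by simp
    next
      case 3
      have "(\<Prod>i\<in>{i\<in>insert u U. (p, i) \<in> E}. edge2 t \<gamma> (if i = u then \<delta> else i \<in> W)) = 0"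
        by (rule prod_zero[OF _ bexI[of _ v]]) (use assms pu vu 3 in \<open>auto simp: edge2_def\<close>)
      then show ?thesis by simp
    qed
  qed
  then show ?thesis
    by (simp only: two_col_step[OF assms(1-5)] mult.assoc mult_zero_right sum.neutral_const)
qed

lemma two_col_empty:
  assumes "\<forall>(i, j)\<in>E. i < j"
  shows "two_col E t a b \<gamma> p {} = 1"
proof -
  have "E \<inter> {p} \<times> {p} = {}" using assms by auto
  then show ?thesis by (simp add: two_col_def)
qed

text \<open>Primes mark quantities with \<open>a\<close> and \<open>b\<close> exchanged, so the
  conclusion is a symmetry. Multiplied by \<open>a - b\<close>, the difference of its two sides is a
  combination of the two given relations.\<close>

lemma hecke_pair_symmetric:
  fixes a b t F G F' G' :: "'r::comm_ring_1"
  assumes "(a - b) * G = (1 - t) * a * F + (t * a - b) * F'"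
    and "(b - a) * G' = (1 - t) * b * F' + (t * b - a) * F"
    and "\<And>h. (a - b) * h = 0 \<Longrightarrow> h = 0"
  shows "a * F + b * G = b * F' + a * G'"
proof -
  have "(a - b) * ((a * F + b * G) - (b * F' + a * G')) =
      b * ((a - b) * G - ((1 - t) * a * F + (t * a - b) * F')) +
      a * ((b - a) * G' - ((1 - t) * b * F' + (t * b - a) * F))"
    by (simp add: algebra_simps)
  also have "\<dots> = 0" by (simp add: assms(1,2))
  finally have "(a * F + b * G) - (b * F' + a * G') = 0" by (rule assms(3))
  then show ?thesis by simp
qed

text \<open>Induction along the path starting at \<open>p\<close>. If \<open>p\<close> has no
  neighbour, both colours of \<open>p\<close> give the same sum, and this sum is symmetric in
  \<open>a\<close> and \<open>b\<close>. If the next position is its only neighbour, the colour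
  there is forced and the relation for that position gives the claim. The induction ranges over all
  \<open>a\<close> and \<open>b\<close> because the relation with the two exchanged is used as
  well.\<close>

lemma two_col_hecke:
  fixes a b t :: "'r::comm_ring_1"
  assumes "finite E" "\<forall>(i, j)\<in>E. i < j" "interval_closed E"
    and "finite U" "\<forall>i\<in>U. p < i" "\<And>h. (a - b) * h = 0 \<Longrightarrow> h = 0"
  shows "(a - b) * two_col E t a b True p U =
    (1 - t) * a * two_col E t a b False p U + (t * a - b) * two_col E t b a False p U"
  using assms(4-6)
proof (induct "card U" arbitrary: U p a b)
  case 0
  then have "U = {}" using 0(2) by (metis card_0_eq)
  then show ?case by (simp add: two_col_empty[OF assms(2)] algebra_simps)
next
  case (Suc n)
  define u where "u = Min U"
  define U' where "U' = U - {u}"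
  have "U \<noteq> {}" using Suc.hyps(2) by auto
  then have uU: "u \<in> U" and "\<forall>i\<in>U. u \<le> i" using Suc.prems(1) by (auto simp: u_def)
  then have U: "U = insert u U'" "finite U'" "\<forall>i\<in>U'. u < i" and pu: "p < u" and "n = card U'"
    using Suc.prems(1,2) Suc.hyps(2) by (auto simp: U'_def le_less)
  note step = U(2) pu U(3) assms(1,2)
  have cancel: "(b - a) * h = 0 \<Longrightarrow> h = 0" for h
    by (rule Suc.prems(3)) (simp add: algebra_simps)
  note IH = Suc.hyps(1)[OF \<open>n = card U'\<close> U(2,3)]
  define F where "F = two_col E t a b False u U'"
  define G where "G = two_col E t a b True u U'"
  define F' where "F' = two_col E t b a False u U'"
  define G' where "G' = two_col E t b a True u U'"
  have FG: "(a - b) * G = (1 - t) * a * F + (t * a - b) * F'"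
    and FG': "(b - a) * G' = (1 - t) * b * F' + (t * b - a) * F"
    unfolding F_def G_def F'_def G'_def by (rule IH, erule Suc.prems(3) cancel)+
  consider "\<forall>i\<in>insert u U'. (p, i) \<notin> E" | v where "v \<in> U'" "(p, v) \<in> E"
    | "(p, u) \<in> E" "\<forall>i\<in>U'. (p, i) \<notin> E" by auto
  then show ?case
  proof cases
    case 1
    have *: "a * F + b * G = b * F' + a * G'"
      by (rule hecke_pair_symmetric[OF FG FG']) (rule Suc.prems(3))
    show ?thesis
      unfolding U(1) two_col_step_nonadj[OF step 1] F_def[symmetric] G_def[symmetric]
        F'_def[symmetric] G'_def[symmetric] *[symmetric]
      by (simp add: algebra_simps)
  next
    case 2
    show ?thesis
      unfolding U(1) by (simp add: two_col_step_triangle[OF step assms(3) 2])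
  next
    case 3
    have "(a - b) * ((1 - t) * a * (b * G) + (t * a - b) * (a * G') - (a - b) * (t * a * F)) =
        (1 - t) * a * b * ((a - b) * G - ((1 - t) * a * F + (t * a - b) * F')) -
        (t * a - b) * a * ((b - a) * G' - ((1 - t) * b * F' + (t * b - a) * F))"
      by (simp add: algebra_simps)
    also have "\<dots> = 0" by (simp add: FG FG')
    finally have "(1 - t) * a * (b * G) + (t * a - b) * (a * G') - (a - b) * (t * a * F) = 0"
      by (rule Suc.prems(3))
    then show ?thesis
      unfolding U(1) two_col_step_adj[OF step 3] F_def[symmetric] G_def[symmetric]
        F'_def[symmetric] G'_def[symmetric]
      by (simp add: mult.assoc)
  qed
qed

text \<open>An isolated \<open>p\<close> leaves the colour of the next position free, and the
  relations of \<open>two_col_hecke\<close> for that position make the sum over its two colours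
  symmetric.\<close>

lemma two_col_sym:
  fixes a b t :: "'r::comm_ring_1"
  assumes "finite E" "\<forall>(i, j)\<in>E. i < j" "interval_closed E"
    and "finite U" "\<forall>i\<in>U. p < i" "\<forall>i\<in>U. (p, i) \<notin> E" "\<And>h. (a - b) * h = 0 \<Longrightarrow> h = 0"
  shows "two_col E t a b \<gamma> p U = two_col E t b a \<gamma> p U"
proof (cases "U = {}")
  case True
  then show ?thesis by (simp add: two_col_empty[OF assms(2)])
next
  case False
  define u where "u = Min U"
  define U' where "U' = U - {u}"
  have uU: "u \<in> U" and "\<forall>i\<in>U. u \<le> i" using assms(4) False by (auto simp: u_def)
  then have U: "U = insert u U'" "finite U'" "\<forall>i\<in>U'. u < i" and pu: "p < u"
    using assms(4,5) by (auto simp: U'_def le_less)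
  note step = U(2) pu U(3) assms(1,2)
  have cancel: "(b - a) * h = 0 \<Longrightarrow> h = 0" for h
    by (rule assms(7)) (simp add: algebra_simps)
  define F where "F = two_col E t a b False u U'"
  define G where "G = two_col E t a b True u U'"
  define F' where "F' = two_col E t b a False u U'"
  define G' where "G' = two_col E t b a True u U'"
  have FG: "(a - b) * G = (1 - t) * a * F + (t * a - b) * F'"
    and FG': "(b - a) * G' = (1 - t) * b * F' + (t * b - a) * F"
    unfolding F_def G_def F'_def G'_def
    by (rule two_col_hecke[OF assms(1-3) U(2,3)], erule assms(7) cancel)+
  have *: "a * F + b * G = b * F' + a * G'" by (rule hecke_pair_symmetric[OF FG FG']) (rule assms(7))
  have na: "\<forall>i\<in>insert u U'. (p, i) \<notin> E" using assms(6) U(1) by simp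
  show ?thesis
    unfolding U(1) two_col_step_nonadj[OF step na] F_def[symmetric] G_def[symmetric]
      F'_def[symmetric] G'_def[symmetric] by (rule *)
qed

section \<open>Generating functions of colourings\<close>

lemma tt_neq_1: "tt \<noteq> 1" and tt_neq_0: "tt \<noteq> 0"
  by (simp_all add: tt_def One_fract_def Zero_fract_def eq_fract one_pCons)

definition edge_wt :: "nat \<Rightarrow> nat \<Rightarrow> qt" where
  "edge_wt u v = (if u = v then 0 else if v < u then tt else 1)"

text \<open>The value on equal letters reflects that a marked pair with equal absolute values admits
  only the positive sign at its right end: that position contributes 1, where a free position
  otherwise contributes the factor \<open>1 - t\<close> that is pulled out globally.\<close>

definition mark_wt :: "nat \<Rightarrow> nat \<Rightarrow> qt" where
  "mark_wt u v = (if u = v then 1 / (1 - tt) else if v < u then 1 else 0)"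

text \<open>This is how a mark arises as a difference of two graphs.\<close>

lemma mark_wt_eq: "mark_wt u v = (edge_wt u v - 1) / (tt - 1)"
  using tt_neq_1 by (auto simp: mark_wt_def edge_wt_def field_simps)

definition col_wt :: "(nat \<times> nat) set \<Rightarrow> (nat \<times> nat) set \<Rightarrow> (nat \<Rightarrow> nat) \<Rightarrow> qt" where
  "col_wt E S c = (\<Prod>e\<in>E. edge_wt (c (fst e)) (c (snd e))) * (\<Prod>e\<in>S. mark_wt (c (fst e)) (c (snd e)))"

definition glue :: "nat set \<Rightarrow> (nat \<Rightarrow> 'a) \<Rightarrow> (nat \<Rightarrow> 'a) \<Rightarrow> nat \<Rightarrow> 'a" where
  "glue P c f i = (if i \<in> P then c i else f i)"

definition col_series ::
  "nat set \<Rightarrow> (nat \<Rightarrow> nat) \<Rightarrow> (nat \<times> nat) set \<Rightarrow> (nat \<times> nat) set \<Rightarrow> qt mfps" where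
  "col_series P f E S = Mfps (\<lambda>\<alpha>. \<Sum>c | c \<in> P \<rightarrow>\<^sub>E {1..} \<and> (\<Sum>i\<in>P. single (c i) 1) = \<alpha>.
     col_wt E S (glue P c f))"

lemma mcoeff_col_series:
  "mcoeff (col_series P f E S) \<alpha> = (\<Sum>c | c \<in> P \<rightarrow>\<^sub>E {1..} \<and> (\<Sum>i\<in>P. single (c i) 1) = \<alpha>.
     col_wt E S (glue P c f))"
  by (simp add: col_series_def)

lemma keys_sum_single: "finite P \<Longrightarrow> keys (\<Sum>i\<in>P. single (c i) 1) = c ` P"
  by (induct P rule: finite_induct) (auto simp: keys_add_expo)

lemma trunc_col_series:
  assumes "finite P"
  shows "trunc N (col_series P f E S) =
    (\<Sum>c\<in>P \<rightarrow>\<^sub>E {1..N}. mconst (col_wt E S (glue P c f)) * (\<Prod>i\<in>P. mvar (c i)))"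
proof (rule mfps_eqI)
  fix \<alpha>
  have fin: "finite (P \<rightarrow>\<^sub>E {1..N})" using assms by (intro finite_PiE) auto
  have "mcoeff (\<Sum>c\<in>P \<rightarrow>\<^sub>E {1..N}. mconst (col_wt E S (glue P c f)) * (\<Prod>i\<in>P. mvar (c i))) \<alpha> =
      (\<Sum>c\<in>P \<rightarrow>\<^sub>E {1..N}. if (\<Sum>i\<in>P. single (c i) 1) = \<alpha> then col_wt E S (glue P c f) else 0)"
    unfolding mcoeff_sum mvar_def mmonom_sum[symmetric]
    by (intro sum.cong) (auto simp: mcoeff_mmonom)
  also have "\<dots> = (\<Sum>c\<in>{c \<in> P \<rightarrow>\<^sub>E {1..N}. (\<Sum>i\<in>P. single (c i) 1) = \<alpha>}. col_wt E S (glue P c f))"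
    using fin by (simp add: sum.inter_filter)
  also have "\<dots> = mcoeff (trunc N (col_series P f E S)) \<alpha>"
  proof (cases "keys \<alpha> \<subseteq> {..N}")
    case True
    have "{c \<in> P \<rightarrow>\<^sub>E {1..N}. (\<Sum>i\<in>P. single (c i) 1) = \<alpha>} =
        {c \<in> P \<rightarrow>\<^sub>E {1..}. (\<Sum>i\<in>P. single (c i) 1) = \<alpha>}" (is "?L = ?R")
    proof
      show "?R \<subseteq> ?L"
      proof
        fix c assume c: "c \<in> ?R"
        then have "c ` P \<subseteq> {..N}" using True keys_sum_single[OF assms, of c] by auto
        with c show "c \<in> ?L" by (auto simp: PiE_iff)
      qed
    qed (auto simp: PiE_iff)
    then show ?thesis using True by (simp add: mcoeff_trunc mcoeff_col_series)
  next
    case False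
    have empty: "{c \<in> P \<rightarrow>\<^sub>E {1..N}. (\<Sum>i\<in>P. single (c i) 1) = \<alpha>} = {}"
      using False keys_sum_single[OF assms] by (fastforce simp: PiE_iff)
    show ?thesis unfolding empty using False by (simp add: mcoeff_trunc)
  qed
  finally show "mcoeff (trunc N (col_series P f E S)) \<alpha> = mcoeff (\<Sum>c\<in>P \<rightarrow>\<^sub>E {1..N}.
      mconst (col_wt E S (glue P c f)) * (\<Prod>i\<in>P. mvar (c i))) \<alpha>" by simp
qed

text \<open>Colourings are grouped by the colouring \<open>b\<close> that results from lowering
  every letter \<open>k + 1\<close> to \<open>k\<close>; \<open>W\<close> remembers the lowered
  positions.\<close>

lemma sum_PiE_split_letter:
  assumes "finite P" "1 \<le> k" "Suc k \<le> N"
  shows "(\<Sum>c\<in>P \<rightarrow>\<^sub>E {1..N}. G c) =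
    (\<Sum>b\<in>P \<rightarrow>\<^sub>E {1..N} - {Suc k}. \<Sum>W\<in>Pow {i\<in>P. b i = k}. G (\<lambda>i. if i \<in> W then Suc k else b i))"
proof -
  have "(\<Sum>b\<in>P \<rightarrow>\<^sub>E {1..N} - {Suc k}. \<Sum>W\<in>Pow {i\<in>P. b i = k}. G (\<lambda>i. if i \<in> W then Suc k else b i)) =
      (\<Sum>(b, W)\<in>(SIGMA b:P \<rightarrow>\<^sub>E {1..N} - {Suc k}. Pow {i\<in>P. b i = k}).
         G (\<lambda>i. if i \<in> W then Suc k else b i))"
    by (rule sum.Sigma) (use assms in \<open>auto intro!: finite_PiE\<close>)
  also have "\<dots> = (\<Sum>c\<in>P \<rightarrow>\<^sub>E {1..N}. G c)"
    by (rule sum.reindex_bij_witness[where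
          i = "\<lambda>c. (\<lambda>i. if i \<in> P then if c i = Suc k then k else c i else undefined, {i\<in>P. c i = Suc k})"
          and j = "\<lambda>(b, W) i. if i \<in> W then Suc k else b i"])
       (use assms in \<open>auto simp: PiE_iff extensional_def fun_eq_iff split: if_splits\<close>)
  finally show ?thesis by simp
qed

lemma mconst_edge2: "mconst (edge2 t u v) = edge2 (mconst t :: 'a::comm_ring_1 mfps) u v"
  by (simp add: edge2_def)

lemma edge_wt_two: "edge_wt (if u then Suc k else k) (if v then Suc k else k) = edge2 tt u v"
  by (auto simp: edge_wt_def edge2_def)

text \<open>A letter outside \<open>{k, k + 1}\<close> compares in the same way with
  \<open>k\<close> and with \<open>k + 1\<close>.\<close>

lemma edge_wt_cong:
  assumes "u = u' \<and> u \<noteq> k \<and> u \<noteq> Suc k \<or> u \<in> {k, Suc k} \<and> u' = k"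
    "v = v' \<and> v \<noteq> k \<and> v \<noteq> Suc k \<or> v \<in> {k, Suc k} \<and> v' = k"
    "\<not> (u \<in> {k, Suc k} \<and> v \<in> {k, Suc k})"
  shows "edge_wt u v = edge_wt u' v'"
  using assms by (auto simp: edge_wt_def)

text \<open>The factor shared by all colourings that are lowered to \<open>b\<close>: the edges not
  joining two positions of letter \<open>k\<close> or \<open>k + 1\<close>, and the variables of the
  remaining letters. The fixed position \<open>p\<close> counts among the positions of letter
  \<open>k\<close>.\<close>

definition off_letter ::
  "nat \<Rightarrow> nat \<Rightarrow> nat set \<Rightarrow> (nat \<Rightarrow> nat) \<Rightarrow> (nat \<times> nat) set \<Rightarrow> (nat \<Rightarrow> nat) \<Rightarrow> qt mfps" where
  "off_letter k p P f E b = (let U = {i\<in>P. b i = k}; Q = insert p U; g = glue P b (f(p := k)) in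
     mconst (\<Prod>e\<in>E - Q \<times> Q. edge_wt (g (fst e)) (g (snd e))) * (\<Prod>i\<in>P - U. mvar (b i)))"

text \<open>This makes \<open>p\<close> the only fixed position that takes part in the graph of the
  letters \<open>k\<close> and \<open>k + 1\<close>.\<close>

definition avoids :: "nat set \<Rightarrow> nat \<Rightarrow> (nat \<Rightarrow> nat) \<Rightarrow> (nat \<times> nat) set \<Rightarrow> nat \<Rightarrow> bool" where
  "avoids P p f E k \<longleftrightarrow> (\<forall>i\<in>fst ` E \<union> snd ` E. i \<notin> P \<longrightarrow> i \<noteq> p \<longrightarrow> f i \<noteq> k \<and> f i \<noteq> Suc k)"

lemma trunc_col_series_split:
  assumes "finite P" "finite E" "p \<notin> P" "1 \<le> k" "Suc k \<le> N" "avoids P p f E k"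
  shows "trunc N (col_series P (f(p := if \<gamma> then Suc k else k)) E {}) =
    (\<Sum>b\<in>P \<rightarrow>\<^sub>E {1..N} - {Suc k}. off_letter k p P f E b *
       two_col E (mconst tt) (mvar k) (mvar (Suc k)) \<gamma> p {i\<in>P. b i = k})"
  unfolding trunc_col_series[OF assms(1)] sum_PiE_split_letter[OF assms(1,4,5)] two_col_def sum_distrib_left
proof (rule sum.cong[OF refl], rule sum.cong[OF refl])
  fix b W assume b: "b \<in> P \<rightarrow>\<^sub>E {1..N} - {Suc k}" and "W \<in> Pow {i\<in>P. b i = k}"
  then have W: "W \<subseteq> {i\<in>P. b i = k}" by simp
  define U where "U = {i\<in>P. b i = k}"
  define Q where "Q = insert p U"
  define c where "c = (\<lambda>i. if i \<in> W then Suc k else b i)"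
  define h where "h = glue P c (f(p := if \<gamma> then Suc k else k))"
  define g where "g = glue P b (f(p := k))"
  have hQ: "h i = (if (if i = p then \<gamma> else i \<in> W) then Suc k else k)" if "i \<in> Q" for i
    using that W assms(3) by (auto simp: h_def glue_def c_def Q_def U_def)
  have gQ: "g i = k" if "i \<in> Q" for i
    using that assms(3) by (auto simp: g_def glue_def Q_def U_def)
  have hg: "h i = g i \<and> h i \<noteq> k \<and> h i \<noteq> Suc k" if "i \<notin> Q" "i \<in> fst ` E \<union> snd ` E" for i
    using that W assms(3,6) b
    by (auto simp: h_def g_def glue_def c_def Q_def U_def avoids_def PiE_iff)
  have split: "E = (E - Q \<times> Q) \<union> (E \<inter> Q \<times> Q)" by blast
  have "(\<Prod>e\<in>E. edge_wt (h (fst e)) (h (snd e))) =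
      (\<Prod>e\<in>E - Q \<times> Q. edge_wt (h (fst e)) (h (snd e))) * (\<Prod>e\<in>E \<inter> Q \<times> Q. edge_wt (h (fst e)) (h (snd e)))"
    by (subst split, rule prod.union_disjoint) (use assms in auto)
  also have "(\<Prod>e\<in>E - Q \<times> Q. edge_wt (h (fst e)) (h (snd e))) = (\<Prod>e\<in>E - Q \<times> Q. edge_wt (g (fst e)) (g (snd e)))"
  proof (rule prod.cong[OF refl])
    fix e assume e: "e \<in> E - Q \<times> Q"
    then have m: "fst e \<in> fst ` E \<union> snd ` E" "snd e \<in> fst ` E \<union> snd ` E" by auto
    have nQ: "\<not> (fst e \<in> Q \<and> snd e \<in> Q)" using e by (auto simp: mem_Times_iff)
    show "edge_wt (h (fst e)) (h (snd e)) = edge_wt (g (fst e)) (g (snd e))"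
      by (rule edge_wt_cong[where k = k])
         (use nQ hg[OF _ m(1)] hg[OF _ m(2)] hQ[of "fst e"] hQ[of "snd e"] gQ[of "fst e"] gQ[of "snd e"]
           in \<open>cases "fst e \<in> Q"; cases "snd e \<in> Q"; auto\<close>)+
  qed
  also have "(\<Prod>e\<in>E \<inter> Q \<times> Q. edge_wt (h (fst e)) (h (snd e))) =
      (\<Prod>e\<in>E \<inter> Q \<times> Q. edge2 tt (if fst e = p then \<gamma> else fst e \<in> W) (if snd e = p then \<gamma> else snd e \<in> W))"
    by (rule prod.cong[OF refl]) (auto simp only: hQ edge_wt_two mem_Times_iff Int_iff)
  finally have wt: "mconst (col_wt E {} h) = mconst (\<Prod>e\<in>E - Q \<times> Q. edge_wt (g (fst e)) (g (snd e))) *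
      (\<Prod>e\<in>E \<inter> Q \<times> Q. edge2 (mconst tt) (if fst e = p then \<gamma> else fst e \<in> W) (if snd e = p then \<gamma> else snd e \<in> W))"
    by (simp add: col_wt_def mconst_mult mconst_prod mconst_edge2)
  have "(\<Prod>i\<in>P. mvar (c i) :: qt mfps) = (\<Prod>i\<in>P - U. mvar (c i)) * (\<Prod>i\<in>U. mvar (c i))"
    using assms(1) by (simp add: U_def prod.subset_diff)
  also have "(\<Prod>i\<in>P - U. mvar (c i) :: qt mfps) = (\<Prod>i\<in>P - U. mvar (b i))"
    by (rule prod.cong) (use W in \<open>auto simp: c_def U_def\<close>)
  also have "(\<Prod>i\<in>U. mvar (c i) :: qt mfps) = (\<Prod>i\<in>U. if i \<in> W then mvar (Suc k) else mvar k)"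
    by (rule prod.cong) (auto simp: c_def U_def)
  finally show "mconst (col_wt E {} (glue P (\<lambda>i. if i \<in> W then Suc k else b i) (f(p := if \<gamma> then Suc k else k)))) *
      (\<Prod>i\<in>P. mvar (if i \<in> W then Suc k else b i)) =
    off_letter k p P f E b *
      ((\<Prod>i\<in>{i\<in>P. b i = k}. if i \<in> W then mvar (Suc k) else mvar k) *
      (\<Prod>e\<in>E \<inter> insert p {i\<in>P. b i = k} \<times> insert p {i\<in>P. b i = k}.
        edge2 (mconst tt) (if fst e = p then \<gamma> else fst e \<in> W) (if snd e = p then \<gamma> else snd e \<in> W)))"
    unfolding off_letter_def Let_def U_def[symmetric] Q_def[symmetric] c_def[symmetric]
      h_def[symmetric] g_def[symmetric] wt
    by (simp only: c_def mult_ac)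
qed

lemma adj_two_col:
  "adj k (two_col E (mconst t) (mvar k) (mvar (Suc k)) \<gamma> p U) =
    (two_col E (mconst t) (mvar (Suc k)) (mvar k) \<gamma> p U :: qt mfps)"
proof -
  have [simp]: "adj k (if P then mvar (Suc k) else mvar k) = (if P then mvar k else mvar (Suc k) :: qt mfps)"
    "adj k (edge2 (mconst t) u v) = (edge2 (mconst t) u v :: qt mfps)" for P u v
    by (simp_all add: mperm_mvar flip: mconst_edge2)
  show ?thesis by (simp add: two_col_def mperm_sum mperm_mult mperm_prod)
qed

lemma adj_off_letter:
  assumes "b \<in> P \<rightarrow>\<^sub>E {1..N} - {Suc k}"
  shows "adj k (off_letter k p P f E b) = off_letter k p P f E b"
proof -
  have "(\<Prod>i\<in>P - {i\<in>P. b i = k}. adj k (mvar (b i))) = (\<Prod>i\<in>P - {i\<in>P. b i = k}. mvar (b i) :: qt mfps)"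
    by (rule prod.cong) (use assms in \<open>auto simp: mperm_mvar PiE_iff transpose_def\<close>)
  then show ?thesis by (simp add: off_letter_def Let_def mperm_mult mperm_prod)
qed

text \<open>All proper subintervals of \<open>m\<close> are edges already, so adding
  \<open>m\<close> to an interval-closed set keeps it interval-closed. The corners of a path arise
  in this way.\<close>

definition addable :: "(nat \<times> nat) set \<Rightarrow> nat \<times> nat \<Rightarrow> bool" where
  "addable E m \<longleftrightarrow> fst m < snd m \<and>
     (\<forall>i j. fst m \<le> i \<longrightarrow> i < j \<longrightarrow> j \<le> snd m \<longrightarrow> (i, j) = m \<or> (i, j) \<in> E)"

text \<open>Areas with marked corners, described without a path. The conditions survive both
  dropping a mark and turning it into an edge, which is what the inductions over marks rely
  on.\<close>

definition dyck_graph :: "(nat \<times> nat) set \<Rightarrow> (nat \<times> nat) set \<Rightarrow> bool" where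
  "dyck_graph E S \<longleftrightarrow> finite E \<and> finite S \<and> E \<inter> S = {} \<and> (\<forall>(i, j)\<in>E. i < j) \<and> interval_closed E \<and>
     (\<forall>m\<in>S. addable E m)"

lemma dyck_graph_insertD:
  assumes "dyck_graph E (insert m S)" "m \<notin> S"
  shows "dyck_graph E S" "dyck_graph (insert m E) S" "m \<notin> E" "finite E" "finite S"
proof -
  have E: "finite E" "finite S" "m \<notin> E" "E \<inter> S = {}" "\<forall>(i, j)\<in>E. i < j" "interval_closed E"
    "addable E m" "\<forall>m'\<in>S. addable E m'"
    using assms(1) unfolding dyck_graph_def by auto
  show "m \<notin> E" "finite E" "finite S" by fact+
  show "dyck_graph E S" using E unfolding dyck_graph_def by auto
  have "interval_closed (insert m E)"
    unfolding interval_closed_def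
  proof (intro allI impI)
    fix i j i' j' assume ij: "(i, j) \<in> insert m E" and le: "i \<le> i'" "i' < j'" "j' \<le> j"
    show "(i', j') \<in> insert m E"
    proof (cases "(i, j) = m")
      case True
      then have "fst m = i" "snd m = j" by auto
      then show ?thesis using E(7) le unfolding addable_def by blast
    next
      case False
      then have "(i, j) \<in> E" using ij by simp
      then show ?thesis using E(6) le unfolding interval_closed_def by blast
    qed
  qed
  moreover have "\<forall>m'\<in>S. addable (insert m E) m'"
    using E(8) unfolding addable_def by blast
  moreover have "\<forall>(i, j)\<in>insert m E. i < j" using E(5,7) by (cases m) (auto simp: addable_def)
  moreover have "insert m E \<inter> S = {}" using E(4) assms(2) by blast
  ultimately show "dyck_graph (insert m E) S"
    using E(1,2) unfolding dyck_graph_def by blast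
qed

lemma col_wt_insert_mark:
  assumes "finite E" "finite S" "m \<notin> E" "m \<notin> S"
  shows "col_wt E (insert m S) c = (col_wt (insert m E) S c - col_wt E S c) / (tt - 1)"
  using assms tt_neq_1 by (simp add: col_wt_def mark_wt_eq field_simps)

lemma col_series_insert_mark:
  assumes "finite E" "finite S" "m \<notin> E" "m \<notin> S"
  shows "col_series P f E (insert m S) =
    mconst (1 / (tt - 1)) * (col_series P f (insert m E) S - col_series P f E S)"
  by (rule mfps_eqI)
     (simp add: mcoeff_col_series col_wt_insert_mark[OF assms] sum_subtractf[symmetric] sum_divide_distrib)

text \<open>\<open>hecke k f g\<close> says \<open>g = t T\<^sub>k\<^sup>-\<^sup>1 f\<close>, with the denominator cleared; \<open>hecke_letter k f g\<close> says the
  same of \<open>x\<^sub>k f\<close> and \<open>x\<^sub>k\<^sub>+\<^sub>1 g\<close>, after cancelling \<open>x\<^sub>k\<^sub>+\<^sub>1\<close>.\<close>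

definition hecke :: "nat \<Rightarrow> qt mfps \<Rightarrow> qt mfps \<Rightarrow> bool" where
  "hecke k f g \<longleftrightarrow> (mvar k - mvar (Suc k)) * g =
     mconst (1 - tt) * mvar (Suc k) * f + (mconst tt * mvar k - mvar (Suc k)) * adj k f"

definition hecke_letter :: "nat \<Rightarrow> qt mfps \<Rightarrow> qt mfps \<Rightarrow> bool" where
  "hecke_letter k f g \<longleftrightarrow> (mvar k - mvar (Suc k)) * g =
     mconst (1 - tt) * mvar k * f + (mconst tt * mvar k - mvar (Suc k)) * adj k f"

lemma hecke_if_hecke_letter: "hecke_letter k f g \<Longrightarrow> hecke k (mvar k * f) (mvar (Suc k) * g)"
proof -
  assume "hecke_letter k f g"
  then have "mvar (Suc k) * ((mvar k - mvar (Suc k)) * g) = mvar (Suc k) *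
      (mconst (1 - tt) * mvar k * f + (mconst tt * mvar k - mvar (Suc k)) * adj k f)"
    by (simp add: hecke_letter_def)
  then show ?thesis by (simp add: hecke_def mperm_mult mperm_mvar algebra_simps)
qed

lemma hecke_letter_diff_scale:
  "hecke_letter k f g \<Longrightarrow> hecke_letter k f' g' \<Longrightarrow>
     hecke_letter k (mconst c * (f - f')) (mconst c * (g - g'))"
proof -
  assume *: "hecke_letter k f g" "hecke_letter k f' g'"
  have "mconst c * ((mvar k - mvar (Suc k)) * g - (mvar k - mvar (Suc k)) * g') = mconst c *
     ((mconst (1 - tt) * mvar k * f + (mconst tt * mvar k - mvar (Suc k)) * adj k f) -
      (mconst (1 - tt) * mvar k * f' + (mconst tt * mvar k - mvar (Suc k)) * adj k f'))"
    using * by (simp add: hecke_letter_def)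
  then show ?thesis by (simp add: hecke_letter_def mperm_mult mperm_diff algebra_simps)
qed

text \<open>For a single lowered colouring this is \<open>two_col_hecke\<close> with
  \<open>x_k\<close> and \<open>x_{k+1}\<close> for \<open>a\<close> and \<open>b\<close>. The
  transposition of these variables fixes \<open>off_letter\<close> and exchanges the two in
  \<open>two_col\<close>, so the relation can be summed over all lowered colourings.\<close>

lemma hecke_letter_col_series_unmarked:
  assumes "finite P" "dyck_graph E {}" "\<forall>i\<in>P. p < i" "1 \<le> k" "avoids P p f E k"
  shows "hecke_letter k (col_series P (f(p := k)) E {}) (col_series P (f(p := Suc k)) E {})"
  unfolding hecke_letter_def
proof (rule trunc_eqI[where M = "Suc k"])
  fix N assume N: "Suc k \<le> N"
  have p: "p \<notin> P" using assms by auto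
  have E: "finite E" "\<forall>(i, j)\<in>E. i < j" "interval_closed E" using assms by (auto simp: dyck_graph_def)
  note split = trunc_col_series_split[OF assms(1) E(1) p assms(4) N assms(5)]
  note split2 = split[of False, unfolded if_False] split[of True, unfolded if_True]
  let ?B = "P \<rightarrow>\<^sub>E {1..N} - {Suc k}"
  let ?U = "\<lambda>b. {i\<in>P. b i = k}"
  let ?a = "mvar k :: qt mfps" and ?b = "mvar (Suc k) :: qt mfps"
  let ?O = "off_letter k p P f E"
  have R: "(?a - ?b) * two_col E (mconst tt) ?a ?b True p (?U b) =
      (1 - mconst tt) * ?a * two_col E (mconst tt) ?a ?b False p (?U b) +
      (mconst tt * ?a - ?b) * two_col E (mconst tt) ?b ?a False p (?U b)" for b
    by (rule two_col_hecke[OF E]; (erule mvar_diff_nonzero_divisor)?) (use assms(1,3) in auto)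
  have ad: "adj k (\<Sum>b\<in>?B. ?O b * two_col E (mconst tt) ?a ?b False p (?U b)) =
      (\<Sum>b\<in>?B. ?O b * two_col E (mconst tt) ?b ?a False p (?U b))"
    unfolding mperm_sum by (rule sum.cong[OF refl]) (simp add: mperm_mult adj_two_col adj_off_letter[where N = N])
  have "(?a - ?b) * (\<Sum>b\<in>?B. ?O b * two_col E (mconst tt) ?a ?b True p (?U b)) =
      (\<Sum>b\<in>?B. ?O b * ((?a - ?b) * two_col E (mconst tt) ?a ?b True p (?U b)))"
    by (simp add: sum_distrib_left mult_ac)
  also have "\<dots> = (1 - mconst tt) * ?a * (\<Sum>b\<in>?B. ?O b * two_col E (mconst tt) ?a ?b False p (?U b)) +
      (mconst tt * ?a - ?b) * (\<Sum>b\<in>?B. ?O b * two_col E (mconst tt) ?b ?a False p (?U b))"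
    by (simp only: R sum_distrib_left sum.distrib[symmetric]) (simp add: algebra_simps)
  finally show "trunc N ((?a - ?b) * col_series P (f(p := Suc k)) E {}) = trunc N
      (mconst (1 - tt) * ?a * col_series P (f(p := k)) E {} +
       (mconst tt * ?a - ?b) * adj k (col_series P (f(p := k)) E {}))"
    using N by (simp add: trunc_add trunc_mult trunc_diff trunc_mvar trunc_adj split2 ad mconst_diff del: One_nat_def)
qed

text \<open>A mark makes both series the same scaled difference of series with one mark fewer, and
  the relation is linear over constants.\<close>

lemma hecke_letter_col_series:
  assumes "dyck_graph E S" "finite P" "\<forall>i\<in>P. p < i" "1 \<le> k" "avoids P p f (E \<union> S) k"
  shows "hecke_letter k (col_series P (f(p := k)) E S) (col_series P (f(p := Suc k)) E S)"
proof -
  have "finite S" using assms(1) by (simp add: dyck_graph_def)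
  then show ?thesis using assms(1,5)
  proof (induct S arbitrary: E rule: finite_induct)
    case empty
    then show ?case using assms(2-4) by (intro hecke_letter_col_series_unmarked) auto
  next
    case (insert m S)
    note D = dyck_graph_insertD[OF insert.prems(1) insert.hyps(2)]
    show ?case
      unfolding col_series_insert_mark[OF D(4,5,3) insert.hyps(2)]
      by (intro hecke_letter_diff_scale insert.hyps(3) D) (use insert.prems(2) in \<open>auto simp: avoids_def\<close>)
  qed
qed

text \<open>Here the unused position 0 serves as an isolated vertex to the left of all others.\<close>

lemma adj_col_series_unmarked:
  assumes "finite P" "dyck_graph E {}" "0 \<notin> P" "0 \<notin> fst ` E" "1 \<le> k" "avoids P 0 f E k"
  shows "adj k (col_series P f E {}) = col_series P f E {}"
proof (rule trunc_eqI[where M = "Suc k"])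
  fix N assume N: "Suc k \<le> N"
  have E: "finite E" "\<forall>(i, j)\<in>E. i < j" "interval_closed E" using assms by (auto simp: dyck_graph_def)
  have 0: "0 \<notin> snd ` E" using E by auto
  have nP: "i \<in> P \<Longrightarrow> 0 < i" and nE: "(0, i) \<notin> E" for i
    using assms(3,4) by (metis gr0I, force)
  \<comment> \<open>No edge touches 0, so its letter can be set to \<open>k\<close>, as the
    two-letter splitting requires of its fixed position.\<close>
  have "col_wt E {} (glue P c (f(0 := k))) = col_wt E {} (glue P c f)" for c
    unfolding col_wt_def using assms(4) 0
    by (intro arg_cong2[where f = "(*)"] prod.cong refl arg_cong2[where f = edge_wt]) (force simp: glue_def)+
  then have f: "col_series P f E {} = col_series P (f(0 := k)) E {}" by (simp add: col_series_def)
  have split: "trunc N (col_series P f E {}) =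
      (\<Sum>b\<in>P \<rightarrow>\<^sub>E {1..N} - {Suc k}. off_letter k 0 P f E b *
       two_col E (mconst tt) (mvar k) (mvar (Suc k)) False 0 {i\<in>P. b i = k})"
    unfolding f using trunc_col_series_split[OF assms(1) E(1) assms(3,5) N assms(6), of False] by simp
  have sym: "two_col E (mconst tt) (mvar (Suc k)) (mvar k) False 0 {i\<in>P. b i = k} =
      (two_col E (mconst tt) (mvar k) (mvar (Suc k)) False 0 {i\<in>P. b i = k} :: qt mfps)" for b
    by (rule two_col_sym[OF E]; (erule mvar_diff_nonzero_divisor)?)
       (use assms(1) nP nE in auto)
  show "trunc N (adj k (col_series P f E {})) = trunc N (col_series P f E {})"
    unfolding trunc_adj[OF N] split mperm_sum
    by (rule sum.cong[OF refl]) (simp add: mperm_mult adj_two_col adj_off_letter[where N = N] sym)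
qed

lemma adj_col_series:
  assumes "dyck_graph E S" "finite P" "0 \<notin> P" "0 \<notin> fst ` (E \<union> S)" "1 \<le> k" "avoids P 0 f (E \<union> S) k"
  shows "adj k (col_series P f E S) = col_series P f E S"
proof -
  have "finite S" using assms(1) by (simp add: dyck_graph_def)
  then show ?thesis using assms(1,4,6)
  proof (induct S arbitrary: E rule: finite_induct)
    case empty
    then show ?case using assms(2,3,5) by (intro adj_col_series_unmarked) auto
  next
    case (insert m S)
    note D = dyck_graph_insertD[OF insert.prems(1) insert.hyps(2)]
    have "adj k (col_series P f E S) = col_series P f E S"
      "adj k (col_series P f (insert m E) S) = col_series P f (insert m E) S"
      by (intro insert.hyps(3) D; use insert.prems(2,3) in \<open>auto simp: avoids_def\<close>)+
    then show ?case
      unfolding col_series_insert_mark[OF D(4,5,3) insert.hyps(2)]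
      by (simp add: mperm_mult mperm_diff)
  qed
qed

section \<open>Symmetry in the tail variables\<close>

text \<open>This is \<open>T_k x_{k+1} = x_k (t T_k^-1)\<close>. The quotient in the definition of
  \<open>TT\<close> is \<open>(g - s_k f) / (1 - t)\<close>, unique because
  \<open>x_k - x_{k+1}\<close> is no zero divisor.\<close>

lemma TT_hecke:
  assumes "hecke k f g"
  shows "TT k (mvar (Suc k) * f) = mvar k * g"
proof -
  let ?F = "mvar (Suc k) * f"
  define h where "h = mconst (1 / (1 - tt)) * (g - adj k f)"
  have c: "mconst (1 - tt) * (mconst (1 / (1 - tt)) * u) = u" for u :: "qt mfps"
    using tt_neq_1 by (simp flip: mconst_mult mult.assoc)
  have adjF: "adj k ?F = mvar k * adj k f" by (simp add: mperm_mult mperm_mvar)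
  have "(mvar k - mvar (Suc k)) * (g - adj k f) = mconst (1 - tt) * (?F - adj k ?F)"
    using assms unfolding hecke_def adjF by (simp add: mconst_diff algebra_simps)
  then have "(mvar k - mvar (Suc k)) * h = mconst (1 / (1 - tt)) * (mconst (1 - tt) * (?F - adj k ?F))"
    unfolding h_def by (simp add: mult.left_commute)
  also have "\<dots> = ?F - adj k ?F" using c by (simp add: mult.left_commute)
  finally have h: "(mvar k - mvar (Suc k)) * h = ?F - adj k ?F" .
  have "h' = h" if "(mvar k - mvar (Suc k)) * h' = ?F - adj k ?F" for h'
  proof -
    have "(mvar k - mvar (Suc k)) * (h' - h) = 0" using that h by (simp add: right_diff_distrib)
    then show ?thesis using mvar_diff_nonzero_divisor[of k "Suc k" "h' - h"] by simp
  qed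
  then have "(THE h. (mvar k - mvar (Suc k)) * h = ?F - adj k ?F) = h"
    using h by (intro the_equality)
  then have "TT k ?F = adj k ?F + mconst (1 - tt) * mvar k * h" by (simp add: TT_def Let_def)
  also have "\<dots> = adj k ?F + mvar k * (mconst (1 - tt) * (mconst (1 / (1 - tt)) * (g - adj k f)))"
    by (simp add: h_def mult_ac)
  also have "\<dots> = mvar k * g" unfolding c adjF by (simp add: right_diff_distrib)
  finally show ?thesis .
qed

text \<open>In the union of \<open>A\<close> and its image the two complements have the same size,
  and any bijection between them completes the injection.\<close>

lemma extend_to_permutation:
  fixes f :: "nat \<Rightarrow> nat"
  assumes "finite A" "inj_on f A" "A \<subseteq> {a..}" "f ` A \<subseteq> {a..}"
  obtains \<tau> B where "finite B" "B \<subseteq> {a..}" "\<tau> permutes B" "\<And>i. i \<in> A \<Longrightarrow> \<tau> i = f i"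
proof -
  define B where "B = A \<union> f ` A"
  have fin: "finite B" using assms by (simp add: B_def)
  have "card (B - A) = card (B - f ` A)"
    using assms fin by (simp add: card_Diff_subset B_def card_image)
  then obtain g where g: "bij_betw g (B - A) (B - f ` A)"
    using fin by (metis finite_Diff finite_same_card_bij)
  define \<tau> where "\<tau> i = (if i \<in> A then f i else if i \<in> B then g i else i)" for i
  have 1: "bij_betw \<tau> A (f ` A)"
    using assms(2) by (subst bij_betw_cong[of _ _ f]) (auto simp: \<tau>_def bij_betw_imageI)
  have 2: "bij_betw \<tau> (B - A) (B - f ` A)"
    using g by (subst bij_betw_cong[of _ _ g]) (auto simp: \<tau>_def)
  have "bij_betw \<tau> (A \<union> (B - A)) (f ` A \<union> (B - f ` A))"
    by (rule bij_betw_combine[OF 1 2]) auto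
  moreover have "A \<union> (B - A) = B" "f ` A \<union> (B - f ` A) = B" by (auto simp: B_def)
  ultimately have "\<tau> permutes B"
    by (intro bij_imp_permutes) (auto simp: \<tau>_def B_def)
  then show ?thesis
    using that[of B \<tau>] fin assms by (auto simp: \<tau>_def B_def)
qed

lemma mperm_compose: "inj \<sigma> \<Longrightarrow> inj \<tau> \<Longrightarrow> mperm (\<tau> \<circ> \<sigma>) f = mperm \<tau> (mperm \<sigma> f)"
  by (rule mfps_eqI) (simp add: mcoeff_mperm map_key_compose)

lemma mperm_transpose_invariant:
  assumes "\<And>k. a \<le> k \<Longrightarrow> adj k f = f" "a \<le> i" "i < j"
  shows "mperm (transpose i j) f = f"
proof -
  have "Suc i \<le> j" using assms(3) by simp
  then show ?thesis
  proof (induct j rule: dec_induct)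
    case base
    then show ?case using assms by simp
  next
    case (step j)
    have "transpose i (Suc j) = transpose j (Suc j) \<circ> (transpose i j \<circ> transpose j (Suc j))"
      using step by (auto simp: fun_eq_iff transpose_def)
    moreover have "inj (transpose i j \<circ> transpose j (Suc j))" by (intro inj_compose inj_transpose)
    ultimately show ?case using step(1,3) assms(1)[of j] assms(2)
      by (simp only: mperm_compose inj_transpose)
  qed
qed

lemma mperm_finite_invariant:
  assumes "\<And>k. a \<le> k \<Longrightarrow> adj k f = f" "\<tau> permutes B" "finite B" "B \<subseteq> {a..}"
  shows "mperm \<tau> f = f"
  using assms(2,3)
proof (induct \<tau> rule: permutes_induct)
  case id
  then show ?case by (rule mfps_eqI) (simp add: mcoeff_mperm map_key_id id_def)
next
  case (swap i j p)
  have "mperm (transpose i j) f = f"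
    using mperm_transpose_invariant[OF assms(1), of a i j] mperm_transpose_invariant[OF assms(1), of a j i]
      swap assms(4) by (cases i j rule: linorder_cases) (auto simp: transpose_commute id)
  then show ?case using swap permutes_inj by (subst mperm_compose) auto
qed

text \<open>\<open>Lam\<close> asks for invariance under permutations of infinite support too. A
  single coefficient sees \<sigma> only on the finite preimage of the variables it involves, where
  \<sigma> can be replaced by a permutation of a finite set, that is, by a product of
  transpositions.\<close>

lemma mperm_invariant:
  assumes "\<And>k. a \<le> k \<Longrightarrow> adj k f = f" "\<sigma> permutes {a..}"
  shows "mperm \<sigma> f = f"
proof (rule mfps_eqI)
  fix \<alpha>
  define A where "A = \<sigma> -` keys \<alpha> \<inter> {a..}"
  have inj: "inj \<sigma>" using assms(2) by (rule permutes_inj)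
  have "finite A" "inj_on \<sigma> A" "A \<subseteq> {a..}" "\<sigma> ` A \<subseteq> {a..}"
    using inj permutes_in_image[OF assms(2)]
    by (auto simp: A_def finite_vimageI intro: inj_on_subset)
  then obtain \<tau> B where \<tau>: "finite B" "B \<subseteq> {a..}" "\<tau> permutes B" "\<And>i. i \<in> A \<Longrightarrow> \<tau> i = \<sigma> i"
    using extend_to_permutation by metis
  have "\<tau> permutes {a..}" using \<tau>(2,3) permutes_subset by blast
  have "lookup \<alpha> (\<sigma> i) = lookup \<alpha> (\<tau> i)" for i
  proof (cases "i \<in> A \<or> i < a")
    case True
    then show ?thesis using \<tau> permutes_not_in[OF assms(2)] permutes_not_in[OF \<open>\<tau> permutes {a..}\<close>]
      by fastforce
  next
    case False
    then have 0: "lookup \<alpha> (\<sigma> i) = 0" by (auto simp: A_def in_keys_iff)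
    have "\<tau> i \<notin> keys \<alpha>"
    proof
      assume k: "\<tau> i \<in> keys \<alpha>"
      \<comment> \<open>This point would lie in \<open>A\<close>, where \<tau> and \<sigma> agree,
        so injectivity of \<tau> would put \<open>i\<close> itself into \<open>A\<close>.\<close>
      define i' where "i' = inv \<sigma> (\<tau> i)"
      have \<sigma>i': "\<sigma> i' = \<tau> i" unfolding i'_def using permutes_inverses(1)[OF assms(2)] by simp
      have "\<tau> i \<ge> a" using False permutes_in_image[OF \<open>\<tau> permutes {a..}\<close>, of i] by auto
      then have "i' \<ge> a" using permutes_in_image[OF assms(2), of i'] \<sigma>i' by auto
      then have "i' \<in> A" using k \<sigma>i' by (simp add: A_def)
      then have "\<tau> i' = \<tau> i" using \<tau>(4) \<sigma>i' by simp
      then have "i' = i" using permutes_inj[OF \<tau>(3)] by (simp add: inj_eq)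
      then show False using \<open>i' \<in> A\<close> False by simp
    qed
    then show ?thesis using 0 by (simp add: in_keys_iff)
  qed
  then have "map_key \<sigma> \<alpha> = map_key \<tau> \<alpha>"
    using inj permutes_inj[OF \<tau>(3)] by (intro expo_eqI) (simp add: lookup_map_key)
  then have "mcoeff (mperm \<sigma> f) \<alpha> = mcoeff (mperm \<tau> f) \<alpha>" by (simp add: mcoeff_mperm)
  then show "mcoeff (mperm \<sigma> f) \<alpha> = mcoeff f \<alpha>"
    using mperm_finite_invariant[OF assms(1) \<tau>(3,1,2)] by simp
qed

section \<open>Total degree and membership in the spaces P(s)\<close>

lemma total_degree_superset:
  "finite K \<Longrightarrow> keys \<alpha> \<subseteq> K \<Longrightarrow> total_degree \<alpha> = (\<Sum>i\<in>K. lookup \<alpha> i)"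
  unfolding total_degree_def by (rule sum.mono_neutral_left) (auto simp: in_keys_iff)

lemma total_degree_add: "total_degree (\<alpha> + \<beta>) = total_degree \<alpha> + total_degree \<beta>"
  using total_degree_superset[of "keys \<alpha> \<union> keys \<beta>" "\<alpha> + \<beta>"]
    total_degree_superset[of "keys \<alpha> \<union> keys \<beta>" \<alpha>] total_degree_superset[of "keys \<alpha> \<union> keys \<beta>" \<beta>]
  by (simp add: keys_add_expo lookup_add sum.distrib)

lemma total_degree_single [simp]: "total_degree (single i n) = n"
  by (simp add: total_degree_def)

lemma total_degree_0 [simp]: "total_degree 0 = 0"
  by (simp add: total_degree_def)

lemma lookup_sum_single: "finite A \<Longrightarrow> lookup (\<Sum>i\<in>A. single i (c i)) j = (if j \<in> A then c j else 0)"
  by (simp add: lookup_sum lookup_single when_def)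

lemma finite_expos:
  assumes "finite K" shows "finite {\<eta>. keys \<eta> \<subseteq> K \<and> total_degree \<eta> \<le> n}"
proof -
  have "{\<eta>. keys \<eta> \<subseteq> K \<and> total_degree \<eta> \<le> n} \<subseteq> (\<lambda>c. \<Sum>i\<in>K. single i (c i)) ` (K \<rightarrow>\<^sub>E {..n})"
  proof
    fix \<eta> assume \<eta>: "\<eta> \<in> {\<eta>. keys \<eta> \<subseteq> K \<and> total_degree \<eta> \<le> n}"
    have "\<eta> = (\<Sum>i\<in>K. single i (restrict (lookup \<eta>) K i))"
      by (rule expo_eqI) (use assms \<eta> in \<open>auto simp: lookup_sum_single in_keys_iff\<close>)
    moreover have "lookup \<eta> i \<le> n" if "i \<in> K" for i
    proof -
      have "lookup \<eta> i \<le> (\<Sum>i\<in>K. lookup \<eta> i)" using assms that by (intro member_le_sum) auto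
      then show ?thesis using \<eta> total_degree_superset[OF assms, of \<eta>] by simp
    qed
    ultimately show "\<eta> \<in> (\<lambda>c. \<Sum>i\<in>K. single i (c i)) ` (K \<rightarrow>\<^sub>E {..n})"
      by (intro image_eqI[of _ _ "restrict (lookup \<eta>) K"]) auto
  qed
  then show ?thesis using assms by (meson finite_PiE finite_atMost finite_imageI finite_subset)
qed

definition bounded_degree :: "'a::zero mfps \<Rightarrow> bool" where
  "bounded_degree f \<longleftrightarrow> (\<exists>n. \<forall>\<alpha>. mcoeff f \<alpha> \<noteq> 0 \<longrightarrow> total_degree \<alpha> \<le> n)"

text \<open>A criterion for membership in \<open>PP s\<close> that fits series given by their
  coefficients. Invariance is asked of adjacent transpositions only, as the colouring argument
  supplies it for two neighbouring letters at a time.\<close>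

definition tail_symmetric :: "nat \<Rightarrow> qt mfps \<Rightarrow> bool" where
  "tail_symmetric s f \<longleftrightarrow> bounded_degree f \<and> (\<forall>\<alpha>. mcoeff f \<alpha> \<noteq> 0 \<longrightarrow> keys \<alpha> \<subseteq> {1..}) \<and>
     (\<forall>k>s. adj k f = f)"

lemma LamI:
  assumes "\<And>\<alpha>. mcoeff g \<alpha> \<noteq> 0 \<Longrightarrow> keys \<alpha> \<subseteq> {a..}" "bounded_degree g" "\<And>k. a \<le> k \<Longrightarrow> adj k g = g"
  shows "g \<in> Lam a"
  unfolding Lam_def using assms mperm_invariant[OF assms(3)] by (auto simp: bounded_degree_def)

lemma mcoeff_sym_part:
  "mcoeff (sym_part s \<eta> f) \<beta> = (if keys \<beta> \<subseteq> {Suc s..} then mcoeff f (\<eta> + \<beta>) else 0)"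
  by (simp add: sym_part_def)

text \<open>Exchanging two variables beyond \<open>s\<close> leaves \<open>x^\<eta>\<close> alone,
  so the symmetry of \<open>f\<close> passes to the coefficient of each
  \<open>x^\<eta>\<close>.\<close>

lemma sym_part_Lam:
  assumes "tail_symmetric s f" "keys \<eta> \<subseteq> {1..s}"
  shows "sym_part s \<eta> f \<in> Lam (Suc s)"
proof (rule LamI)
  show "keys \<alpha> \<subseteq> {Suc s..}" if "mcoeff (sym_part s \<eta> f) \<alpha> \<noteq> 0" for \<alpha>
    using that by (auto simp: mcoeff_sym_part split: if_splits)
  obtain n where n: "\<And>\<alpha>. mcoeff f \<alpha> \<noteq> 0 \<Longrightarrow> total_degree \<alpha> \<le> n"
    using assms(1) by (auto simp: tail_symmetric_def bounded_degree_def)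
  have "total_degree \<alpha> \<le> n" if "mcoeff (sym_part s \<eta> f) \<alpha> \<noteq> 0" for \<alpha>
    using that n[of "\<eta> + \<alpha>"] by (auto simp: mcoeff_sym_part total_degree_add split: if_splits)
  then show "bounded_degree (sym_part s \<eta> f)" by (auto simp: bounded_degree_def)
  show "adj k (sym_part s \<eta> f) = sym_part s \<eta> f" if k: "Suc s \<le> k" for k
  proof (rule mfps_eqI)
    fix \<beta>
    let ?\<tau> = "transpose k (Suc k)"
    have "?\<tau> permutes {Suc s..}" using k by (intro permutes_swap_id) auto
    then have "?\<tau> -` keys \<beta> \<subseteq> {Suc s..} \<longleftrightarrow> keys \<beta> \<subseteq> {Suc s..}"
      by (subst vimage_subset_eq) (simp_all only: bij_transpose permutes_image)
    moreover have "map_key ?\<tau> \<eta> = \<eta>"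
    proof (rule expo_eqI)
      fix i
      have "k \<notin> keys \<eta>" "Suc k \<notin> keys \<eta>" using k assms(2) by auto
      then show "lookup (map_key ?\<tau> \<eta>) i = lookup \<eta> i"
        by (simp add: lookup_map_key transpose_def in_keys_iff)
    qed
    moreover have "mcoeff f (\<eta> + \<beta>) = mcoeff f (map_key ?\<tau> (\<eta> + \<beta>))"
      using assms(1) k by (simp add: tail_symmetric_def flip: mcoeff_mperm)
    ultimately show "mcoeff (adj k (sym_part s \<eta> f)) \<beta> = mcoeff (sym_part s \<eta> f) \<beta>"
      by (simp add: mcoeff_mperm mcoeff_sym_part keys_map_key map_key_plus)
  qed
qed

lemma finite_sym_part_support:
  assumes "tail_symmetric s f"
  shows "finite {\<eta>. keys \<eta> \<subseteq> {1..s} \<and> sym_part s \<eta> f \<noteq> 0}"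
proof -
  obtain n where n: "\<And>\<alpha>. mcoeff f \<alpha> \<noteq> 0 \<Longrightarrow> total_degree \<alpha> \<le> n"
    using assms(1) by (auto simp: tail_symmetric_def bounded_degree_def)
  have "total_degree \<eta> \<le> n" if nz: "sym_part s \<eta> f \<noteq> 0" for \<eta>
  proof -
    obtain \<beta> where "mcoeff (sym_part s \<eta> f) \<beta> \<noteq> 0" using mfps_eqI[of "sym_part s \<eta> f" 0] nz by auto
    then show ?thesis using n[of "\<eta> + \<beta>"] by (auto simp: mcoeff_sym_part total_degree_add split: if_splits)
  qed
  then show ?thesis
    by (intro finite_subset[OF _ finite_expos[of "{1..s}" n]]) auto
qed

lemma expo_split:
  assumes "keys \<alpha> \<subseteq> {1..}"
  obtains \<eta> \<beta> where "\<alpha> = \<eta> + \<beta>" "keys \<eta> \<subseteq> {1..s}" "keys \<beta> \<subseteq> {Suc s..}"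
proof -
  let ?\<eta> = "\<Sum>i\<in>{1..s}. single i (lookup \<alpha> i)"
  let ?\<beta> = "\<Sum>i\<in>keys \<alpha> \<inter> {Suc s..}. single i (lookup \<alpha> i)"
  have "\<alpha> = ?\<eta> + ?\<beta>"
  proof (rule expo_eqI)
    fix i
    have "lookup \<alpha> i = 0" if "i < 1" using assms that by (metis atLeast_iff in_keys_iff not_le subsetD)
    then show "lookup \<alpha> i = lookup (?\<eta> + ?\<beta>) i"
      by (cases "i = 0") (auto simp: lookup_add lookup_sum_single in_keys_iff)
  qed
  moreover have "keys ?\<eta> \<subseteq> {1..s}" "keys ?\<beta> \<subseteq> {Suc s..}"
    by (auto simp: in_keys_iff lookup_sum_single split: if_splits)
  ultimately show ?thesis using that by blast
qed

lemma expo_split_unique: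
  assumes "\<eta> + \<beta> = \<eta>' + \<beta>'" "keys \<eta> \<subseteq> {1..s}" "keys \<eta>' \<subseteq> {1..s}"
    "keys \<beta> \<subseteq> {Suc s..}" "keys \<beta>' \<subseteq> {Suc s..}"
  shows "\<eta> = \<eta>'"
proof (rule expo_eqI)
  fix i
  have *: "lookup (\<eta> + \<beta>) i = lookup (\<eta>' + \<beta>') i" using assms by simp
  then show "lookup \<eta> i = lookup \<eta>' i"
  proof (cases "i \<le> s")
    case True
    then have "i \<notin> keys \<beta>" "i \<notin> keys \<beta>'" using assms(4,5) by auto
    then show ?thesis using * by (simp add: lookup_add in_keys_iff)
  next
    case False
    then have "i \<notin> keys \<eta>" "i \<notin> keys \<eta>'" using assms(2,3) by auto
    then show ?thesis by (simp add: in_keys_iff)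
  qed
qed

text \<open>Every exponent vector splits in one way only into a part up to \<open>s\<close> and a
  part beyond, so at most one summand contributes to a given coefficient. The degree bound keeps the
  sum finite.\<close>

lemma tail_symmetric_expansion:
  assumes "tail_symmetric s f"
  shows "f = (\<Sum>\<eta> | keys \<eta> \<subseteq> {1..s} \<and> sym_part s \<eta> f \<noteq> 0. mmonom \<eta> * sym_part s \<eta> f)"
proof (rule mfps_eqI)
  fix \<alpha>
  let ?H = "{\<eta>. keys \<eta> \<subseteq> {1..s} \<and> sym_part s \<eta> f \<noteq> 0}"
  note fin = finite_sym_part_support[OF assms]
  show "mcoeff f \<alpha> = mcoeff (\<Sum>\<eta>\<in>?H. mmonom \<eta> * sym_part s \<eta> f) \<alpha>"
  proof (cases "keys \<alpha> \<subseteq> {1..}")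
    case True
    then obtain \<eta> \<beta> where \<alpha>: "\<alpha> = \<eta> + \<beta>" and \<eta>: "keys \<eta> \<subseteq> {1..s}" and \<beta>: "keys \<beta> \<subseteq> {Suc s..}"
      by (rule expo_split)
    have "mcoeff (mmonom \<eta>' * sym_part s \<eta>' f) \<alpha> = (if \<eta>' = \<eta> then mcoeff f \<alpha> else 0)"
      if "keys \<eta>' \<subseteq> {1..s}" for \<eta>'
    proof (cases "\<exists>\<gamma>. \<alpha> = \<eta>' + \<gamma>")
      case True
      then obtain \<gamma> where \<gamma>: "\<alpha> = \<eta>' + \<gamma>" by blast
      show ?thesis
      proof (cases "\<eta>' = \<eta>")
        case True
        then show ?thesis using \<alpha> \<beta> by (simp add: mcoeff_mmonom_mult_add mcoeff_sym_part)
      next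
        case False
        then have "\<not> keys \<gamma> \<subseteq> {Suc s..}"
          using expo_split_unique[of \<eta> \<beta> \<eta>' \<gamma> s] \<alpha> \<gamma> \<eta> \<beta> that by auto
        then show ?thesis unfolding \<gamma> using False by (simp add: mcoeff_mmonom_mult_add mcoeff_sym_part)
      qed
    next
      case False
      then have "\<eta>' \<noteq> \<eta>" using \<alpha> by blast
      then show ?thesis using False by (simp add: mcoeff_mmonom_mult_eq_0)
    qed
    then have "mcoeff (\<Sum>\<eta>\<in>?H. mmonom \<eta> * sym_part s \<eta> f) \<alpha> = (\<Sum>\<eta>'\<in>?H. if \<eta>' = \<eta> then mcoeff f \<alpha> else 0)"
      unfolding mcoeff_sum by (intro sum.cong) auto
    also have "\<dots> = (if \<eta> \<in> ?H then mcoeff f \<alpha> else 0)" using fin by (simp add: sum.delta)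
    also have "\<dots> = mcoeff f \<alpha>"
    proof (cases "sym_part s \<eta> f = 0")
      case True
      then have "mcoeff (sym_part s \<eta> f) \<beta> = 0" by simp
      then show ?thesis using \<beta> \<alpha> by (simp add: mcoeff_sym_part)
    qed (use \<eta> in simp)
    finally show ?thesis by simp
  next
    case False
    have "mcoeff (mmonom \<eta>' * sym_part s \<eta>' f) \<alpha> = 0" if "keys \<eta>' \<subseteq> {1..s}" for \<eta>'
    proof (cases "\<exists>\<gamma>. \<alpha> = \<eta>' + \<gamma>")
      case True
      then obtain \<gamma> where \<gamma>: "\<alpha> = \<eta>' + \<gamma>" by blast
      have "\<not> keys \<gamma> \<subseteq> {Suc s..}" using False \<gamma> that by (fastforce simp: keys_add_expo)
      then show ?thesis unfolding \<gamma> by (simp add: mcoeff_mmonom_mult_add mcoeff_sym_part)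
    qed (simp add: mcoeff_mmonom_mult_eq_0)
    then have "mcoeff (\<Sum>\<eta>\<in>?H. mmonom \<eta> * sym_part s \<eta> f) \<alpha> = 0"
      unfolding mcoeff_sum by (intro sum.neutral) auto
    moreover have "mcoeff f \<alpha> = 0" using False assms by (auto simp: tail_symmetric_def)
    ultimately show ?thesis by simp
  qed
qed

lemma tail_symmetric_imp_PP: "tail_symmetric s f \<Longrightarrow> f \<in> PP s"
proof -
  assume f: "tail_symmetric s f"
  let ?H = "{\<eta>. keys \<eta> \<subseteq> {1..s} \<and> sym_part s \<eta> f \<noteq> 0}"
  have "finite ?H \<and> (\<forall>\<eta>\<in>?H. keys \<eta> \<subseteq> {1..s} \<and> sym_part s \<eta> f \<in> Lam (Suc s)) \<and>
      f = (\<Sum>\<eta>\<in>?H. mmonom \<eta> * sym_part s \<eta> f)"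
    using finite_sym_part_support[OF f] sym_part_Lam[OF f] tail_symmetric_expansion[OF f] by simp
  then show ?thesis unfolding PP_def mem_Collect_eq by (intro exI)
qed

section \<open>Power sums\<close>

text \<open>The coefficient of \<open>x\<^sup>\<alpha>\<close> in a product of \<open>l\<close> power sums vanishes if \<open>\<alpha>\<close> involves more than \<open>l\<close>
  variables; if it involves exactly \<open>l\<close>, then the multiset of its exponents determines the product.
  This triangularity gives existence and uniqueness of power sum expansions.\<close>

definition pprod :: "nat \<Rightarrow> expo \<Rightarrow> qt mfps" where
  "pprod a m = (\<Prod>k\<in>keys m. psum a k ^ lookup m k)"

text \<open>The multiset of nonzero exponents, encoded as an exponent vector in the
  \<open>p_k\<close>: its entry at \<open>k\<close> counts the variables with exponent
  \<open>k\<close>. Thus \<open>pprod a (shape \<alpha>)\<close> has one power sum for each variable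
  in \<alpha>.\<close>

definition shape :: "expo \<Rightarrow> expo" where
  "shape \<alpha> = (\<Sum>i\<in>keys \<alpha>. single (lookup \<alpha> i) 1)"

lemma expo_induct [case_names zero add]:
  assumes "P 0" "\<And>k m. P m \<Longrightarrow> P (single k 1 + m)"
  shows "P (m :: expo)"
proof (induct "total_degree m" arbitrary: m)
  case 0
  then have "lookup m i = 0" for i by (auto simp: total_degree_def in_keys_iff)
  then have "m = 0" by (intro expo_eqI) simp
  then show ?case using assms(1) by simp
next
  case (Suc n)
  then have "keys m \<noteq> {}" by (auto simp: total_degree_def)
  then obtain k where "k \<in> keys m" by blast
  then have m: "single k 1 + (m - single k 1) = m" by (intro expo_diff_add) (simp add: in_keys_iff)
  then have "total_degree (single k 1 + (m - single k 1)) = Suc n" using Suc by simp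
  then have "n = total_degree (m - single k 1)" by (simp add: total_degree_add)
  then show ?case using Suc(1) assms(2) m by metis
qed

lemma pprod_0 [simp]: "pprod a 0 = 1"
  by (simp add: pprod_def)

lemma pprod_superset: "finite K \<Longrightarrow> keys m \<subseteq> K \<Longrightarrow> pprod a m = (\<Prod>k\<in>K. psum a k ^ lookup m k)"
  unfolding pprod_def by (rule prod.mono_neutral_left) (auto simp: in_keys_iff)

lemma pprod_add: "pprod a (m + m') = pprod a m * pprod a m'"
  using pprod_superset[of "keys m \<union> keys m'" "m + m'"] pprod_superset[of "keys m \<union> keys m'" m]
    pprod_superset[of "keys m \<union> keys m'" m']
  by (simp add: keys_add_expo lookup_add power_add prod.distrib)

lemma pprod_single [simp]: "pprod a (single k 1) = psum a k"
  by (simp add: pprod_def)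

lemma mcoeff_psum: "mcoeff (psum a k) \<alpha> = (if \<exists>i\<ge>a. \<alpha> = single i k then 1 else 0)"
  by (simp add: psum_def)

lemma mcoeff_psum_mult:
  assumes "1 \<le> k"
  shows "mcoeff (psum a k * f) \<alpha> =
    (\<Sum>i\<in>{i\<in>keys \<alpha>. a \<le> i \<and> k \<le> lookup \<alpha> i}. mcoeff f (\<alpha> - single i k))"
proof -
  let ?I = "{i\<in>keys \<alpha>. a \<le> i \<and> k \<le> lookup \<alpha> i}"
  let ?h = "\<lambda>i. (single i k, \<alpha> - single i k)"
  have inj: "inj_on ?h ?I"
  proof (rule inj_onI)
    fix i j assume "?h i = ?h j"
    then have "lookup (single i k) i = lookup (single j k) i" by simp
    then show "i = j" using assms by (simp add: lookup_single when_def split: if_splits)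
  qed
  have sp: "?h ` ?I \<subseteq> splits \<alpha>"
    by (auto simp: splits_def intro!: expo_eqI simp: lookup_add lookup_minus lookup_single when_def)
  have "mcoeff (psum a k * f) \<alpha> = (\<Sum>p\<in>?h ` ?I. mcoeff (psum a k) (fst p) * mcoeff f (snd p))"
    unfolding mcoeff_mult case_prod_unfold
  proof (rule sum.mono_neutral_right[OF finite_splits sp], rule ballI)
    fix p assume p: "p \<in> splits \<alpha> - ?h ` ?I"
    have "\<not> (\<exists>i\<ge>a. fst p = single i k)"
    proof
      assume "\<exists>i\<ge>a. fst p = single i k"
      then obtain i where i: "a \<le> i" "fst p = single i k" by blast
      then have \<alpha>: "\<alpha> = single i k + snd p" using p by (auto simp: splits_def)
      then have "i \<in> ?I" using i assms by (auto simp: in_keys_iff lookup_add)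
      moreover have "p = ?h i" using \<alpha> i by (auto simp: prod_eq_iff)
      ultimately show False using p by blast
    qed
    then have "mcoeff (psum a k) (fst p) = 0" unfolding mcoeff_psum by (rule if_not_P)
    then show "mcoeff (psum a k) (fst p) * mcoeff f (snd p) = 0" by simp
  qed
  also have "\<dots> = (\<Sum>i\<in>?I. mcoeff (psum a k) (single i k) * mcoeff f (\<alpha> - single i k))"
    by (simp add: sum.reindex[OF inj])
  also have "\<dots> = (\<Sum>i\<in>?I. mcoeff f (\<alpha> - single i k))"
    by (rule sum.cong) (auto simp: mcoeff_psum)
  finally show ?thesis .
qed

lemma total_degree_sum: "total_degree (\<Sum>i\<in>A. f i) = (\<Sum>i\<in>A. total_degree (f i))"
  by (induct A rule: infinite_finite_induct) (auto simp: total_degree_add)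

lemma total_degree_shape: "total_degree (shape \<alpha>) = card (keys \<alpha>)"
  by (simp add: shape_def total_degree_sum)

lemma lookup_shape: "lookup (shape \<alpha>) k = card {i\<in>keys \<alpha>. lookup \<alpha> i = k}"
proof -
  have "lookup (shape \<alpha>) k = (\<Sum>i\<in>keys \<alpha>. if lookup \<alpha> i = k then 1 else 0)"
    by (simp add: shape_def lookup_sum lookup_single when_def flip: One_nat_def)
  then show ?thesis by (simp only: card_eq_sum sum.inter_filter finite_keys)
qed

lemma keys_shape: "keys (shape \<alpha>) = lookup \<alpha> ` keys \<alpha>"
  unfolding shape_def by (rule keys_sum_single) simp

lemma shape_add_single:
  assumes "i \<notin> keys \<beta>" "1 \<le> k"
  shows "shape (single i k + \<beta>) = single k 1 + shape \<beta>"
proof -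
  have "keys (single i k + \<beta>) = insert i (keys \<beta>)" using assms by (auto simp: keys_add_expo)
  then show ?thesis
    unfolding shape_def using assms
    by (auto simp: lookup_add lookup_single when_def in_keys_iff intro!: sum.cong arg_cong2[where f = "(+)"])
qed

lemma ex_shape:
  assumes "keys m \<subseteq> {1..}" shows "\<exists>\<alpha>. shape \<alpha> = m \<and> keys \<alpha> \<subseteq> {a..}"
  using assms
proof (induct m rule: expo_induct)
  case zero
  show ?case by (rule exI[of _ 0]) (simp add: shape_def)
next
  case (add k m)
  then obtain \<alpha> where \<alpha>: "shape \<alpha> = m" "keys \<alpha> \<subseteq> {a..}" by (auto simp: keys_add_expo)
  define i where "i = Suc (a + Max (insert 0 (keys \<alpha>)))"
  have "i \<notin> keys \<alpha>"
  proof
    assume "i \<in> keys \<alpha>"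
    then have "i \<le> Max (insert 0 (keys \<alpha>))" by (intro Max_ge) auto
    then show False by (simp add: i_def)
  qed
  moreover have "a \<le> i" by (simp add: i_def)
  moreover have "1 \<le> k" using add.prems by (simp add: keys_add_expo)
  ultimately show ?case using \<alpha>
    by (intro exI[of _ "single i k + \<alpha>"]) (auto simp: shape_add_single keys_add_expo)
qed

text \<open>Each factor \<open>p_k\<close> picks one variable and raises its exponent by
  \<open>k\<close>. The number of variables reaches the number of factors only if all picks are
  different, and then the exponents are the indices of the factors.\<close>

lemma mcoeff_pprod_nonzero:
  assumes "keys m \<subseteq> {1..}" "mcoeff (pprod a m) \<alpha> \<noteq> 0"
  shows "card (keys \<alpha>) \<le> total_degree m \<and> (card (keys \<alpha>) = total_degree m \<longrightarrow> shape \<alpha> = m)"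
  using assms
proof (induct m arbitrary: \<alpha> rule: expo_induct)
  case zero
  then show ?case by (simp add: mcoeff_1 shape_def split: if_splits)
next
  case (add k m)
  have k: "1 \<le> k" and m: "keys m \<subseteq> {1..}" using add.prems by (auto simp: keys_add_expo)
  have "(\<Sum>i\<in>{i\<in>keys \<alpha>. a \<le> i \<and> k \<le> lookup \<alpha> i}. mcoeff (pprod a m) (\<alpha> - single i k)) \<noteq> 0"
    using add.prems(2) unfolding pprod_add pprod_single mcoeff_psum_mult[OF k] .
  then obtain i where "i \<in> {i\<in>keys \<alpha>. a \<le> i \<and> k \<le> lookup \<alpha> i}"
    and "mcoeff (pprod a m) (\<alpha> - single i k) \<noteq> 0"
    by (rule sum.not_neutral_contains_not_neutral)
  then have i: "i \<in> keys \<alpha>" "k \<le> lookup \<alpha> i" "mcoeff (pprod a m) (\<alpha> - single i k) \<noteq> 0" by auto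
  define \<beta> where "\<beta> = \<alpha> - single i k"
  have \<alpha>: "\<alpha> = single i k + \<beta>"
    by (rule expo_eqI) (use i in \<open>auto simp: \<beta>_def lookup_add lookup_minus lookup_single when_def\<close>)
  have IH: "card (keys \<beta>) \<le> total_degree m" "card (keys \<beta>) = total_degree m \<Longrightarrow> shape \<beta> = m"
    using add.hyps[OF m] i(3) unfolding \<beta>_def by blast+
  have keys: "keys \<alpha> = insert i (keys \<beta>)" using k by (auto simp: \<alpha> keys_add_expo)
  have deg: "total_degree (single k 1 + m) = Suc (total_degree m)" by (simp add: total_degree_add)
  show ?case
  proof (cases "i \<in> keys \<beta>")
    case True
    then show ?thesis unfolding keys deg using IH by (simp add: insert_absorb)
  next
    case False
    then show ?thesis unfolding keys deg using IH shape_add_single[OF False k] \<alpha> by simp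
  qed
qed

text \<open>The coefficient counts the ways of distributing the factors over the variables. Being a
  natural number it suffers no cancellation, and a positive one stays nonzero in characteristic
  zero.\<close>

lemma mcoeff_pprod_of_nat:
  assumes "keys m \<subseteq> {1..}"
  shows "\<exists>n. mcoeff (pprod a m) \<alpha> = of_nat n \<and> (keys \<alpha> \<subseteq> {a..} \<and> shape \<alpha> = m \<longrightarrow> 0 < n)"
  using assms
proof (induct m arbitrary: \<alpha> rule: expo_induct)
  case zero
  have "shape \<alpha> = 0 \<longleftrightarrow> \<alpha> = 0"
    using total_degree_shape[of \<alpha>] by (auto simp: shape_def)
  then show ?case by (intro exI[of _ "if \<alpha> = 0 then 1 else 0"]) (simp add: mcoeff_1)
next
  case (add k m)
  have k: "1 \<le> k" and m: "keys m \<subseteq> {1..}" using add.prems by (auto simp: keys_add_expo)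
  let ?I = "{i\<in>keys \<alpha>. a \<le> i \<and> k \<le> lookup \<alpha> i}"
  from add.hyps[OF m] obtain n where n: "\<And>\<beta>. mcoeff (pprod a m) \<beta> = of_nat (n \<beta>)"
    "\<And>\<beta>. keys \<beta> \<subseteq> {a..} \<Longrightarrow> shape \<beta> = m \<Longrightarrow> 0 < n \<beta>" by metis
  have "mcoeff (pprod a (single k 1 + m)) \<alpha> = of_nat (\<Sum>i\<in>?I. n (\<alpha> - single i k))"
    unfolding pprod_add pprod_single mcoeff_psum_mult[OF k] by (simp add: n(1))
  moreover have "0 < (\<Sum>i\<in>?I. n (\<alpha> - single i k))" if \<alpha>: "keys \<alpha> \<subseteq> {a..}" "shape \<alpha> = single k 1 + m"
  proof -
    have "k \<in> keys (shape \<alpha>)" unfolding \<alpha>(2) by (simp add: keys_add_expo)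
    then obtain i where i: "i \<in> keys \<alpha>" "lookup \<alpha> i = k" by (auto simp: keys_shape)
    have i': "i \<notin> keys (\<alpha> - single i k)" using i by (simp add: in_keys_iff lookup_minus)
    have "\<alpha> = single i k + (\<alpha> - single i k)"
      by (rule expo_eqI) (use i in \<open>auto simp: lookup_add lookup_minus lookup_single when_def\<close>)
    then have "shape (\<alpha> - single i k) = m"
      using shape_add_single[OF i' k] \<alpha>(2) by (metis add_left_cancel)
    moreover have "keys (\<alpha> - single i k) \<subseteq> {a..}"
      using \<alpha>(1) by (auto simp: in_keys_iff lookup_minus subset_iff)
    ultimately have "0 < n (\<alpha> - single i k)" by (intro n(2))
    then show ?thesis using i \<alpha>(1) by (intro sum_pos2[of _ i]) auto
  qed
  ultimately show ?case by blast
qed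

lemma mcoeff_pprod_shape:
  assumes "keys \<alpha> \<subseteq> {a..}" "keys (shape \<alpha>) \<subseteq> {1..}"
  shows "mcoeff (pprod a (shape \<alpha>)) \<alpha> \<noteq> 0"
  using mcoeff_pprod_of_nat[OF assms(2), of a \<alpha>] assms by auto

lemma keys_shape_pos: "keys (shape \<alpha>) \<subseteq> {1..}"
  by (auto simp: keys_shape in_keys_iff)

section \<open>Uniqueness of power sum expansions\<close>

definition admissible :: "(expo \<Rightarrow>\<^sub>0 qt) \<Rightarrow> bool" where
  "admissible c \<longleftrightarrow> (\<forall>m\<in>Poly_Mapping.keys c. keys m \<subseteq> {1..})"

lemma ppoly_eval_superset:
  assumes "finite K" "Poly_Mapping.keys c \<subseteq> K" "emb 0 = 0"
  shows "ppoly_eval emb c A =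
    (\<Sum>m\<in>K. emb (Poly_Mapping.lookup c m) * (\<Prod>k\<in>keys m. A k ^ lookup m k))"
  unfolding ppoly_eval_def using assms
  by (intro sum.mono_neutral_left) (auto simp: in_keys_iff)

text \<open>Among the monomials where \<open>c\<close> and \<open>d\<close> differ, one of maximal
  degree is chosen, and an exponent vector \<alpha> of that shape. By maximality and triangularity
  no other monomial of the difference contributes to the coefficient at \<alpha>.\<close>

lemma ppoly_eval_inject:
  assumes "admissible c" "admissible d" "ppoly_eval mconst c (psum a) = ppoly_eval mconst d (psum a)"
  shows "c = d"
proof (rule ccontr)
  assume "c \<noteq> d"
  define K where "K = Poly_Mapping.keys c \<union> Poly_Mapping.keys d"
  define e where "e m = Poly_Mapping.lookup c m - Poly_Mapping.lookup d m" for m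
  define D where "D = {m\<in>K. e m \<noteq> 0}"
  have K: "finite K" "\<And>m. m \<in> K \<Longrightarrow> keys m \<subseteq> {1..}"
    using assms by (auto simp: K_def admissible_def)
  have "D \<noteq> {}"
  proof
    assume D: "D = {}"
    have "Poly_Mapping.lookup c m = Poly_Mapping.lookup d m" for m
      using D by (cases "m \<in> K") (auto simp: D_def K_def e_def in_keys_iff)
    then show False using \<open>c \<noteq> d\<close> poly_mapping_eqI by blast
  qed
  moreover have "finite D" using K by (simp add: D_def)
  ultimately obtain m0 where m0: "m0 \<in> D" "\<And>m. m \<in> D \<Longrightarrow> total_degree m \<le> total_degree m0"
    using Max_in[of "total_degree ` D"] Max_ge[of "total_degree ` D"] by (metis (no_types, lifting) finite_imageI image_iff image_is_empty)
  then have k0: "keys m0 \<subseteq> {1..}" using K by (auto simp: D_def)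
  then obtain \<alpha> where \<alpha>: "shape \<alpha> = m0" "keys \<alpha> \<subseteq> {a..}" using ex_shape by blast
  have "(\<Sum>m\<in>K. mconst (Poly_Mapping.lookup c m) * pprod a m) -
      (\<Sum>m\<in>K. mconst (Poly_Mapping.lookup d m) * pprod a m) = 0"
    using assms(3) ppoly_eval_superset[OF K(1), of c mconst "psum a"]
      ppoly_eval_superset[OF K(1), of d mconst "psum a"]
    by (simp add: K_def pprod_def)
  then have "mcoeff ((\<Sum>m\<in>K. mconst (Poly_Mapping.lookup c m) * pprod a m) -
      (\<Sum>m\<in>K. mconst (Poly_Mapping.lookup d m) * pprod a m)) \<alpha> = 0" by simp
  then have "0 = (\<Sum>m\<in>K. e m * mcoeff (pprod a m) \<alpha>)"
    by (simp add: mcoeff_sum e_def left_diff_distrib sum_subtractf)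
  also have "\<dots> = (\<Sum>m\<in>K. if m = m0 then e m0 * mcoeff (pprod a m0) \<alpha> else 0)"
  proof (rule sum.cong[OF refl])
    fix m assume m: "m \<in> K"
    have "e m * mcoeff (pprod a m) \<alpha> = 0" if "m \<noteq> m0"
    proof (rule ccontr)
      assume nz: "e m * mcoeff (pprod a m) \<alpha> \<noteq> 0"
      then have "m \<in> D" using m by (simp add: D_def)
      then have "total_degree m \<le> card (keys \<alpha>)" using m0(2) \<alpha>(1) total_degree_shape by metis
      moreover have "mcoeff (pprod a m) \<alpha> \<noteq> 0" using nz by simp
      ultimately have "shape \<alpha> = m" using mcoeff_pprod_nonzero[OF K(2)[OF m]] by (meson le_antisym)
      then show False using that \<alpha> by simp
    qed
    then show "e m * mcoeff (pprod a m) \<alpha> = (if m = m0 then e m0 * mcoeff (pprod a m0) \<alpha> else 0)" by simp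
  qed
  also have "\<dots> = e m0 * mcoeff (pprod a m0) \<alpha>" using K m0 by (simp add: D_def)
  finally show False using m0 mcoeff_pprod_shape[OF \<alpha>(2) keys_shape_pos] \<alpha> by (simp add: D_def)
qed

lemma power_sum_expansion_eqI:
  "admissible c \<Longrightarrow> ppoly_eval mconst c (psum a) = f \<Longrightarrow> power_sum_expansion a f = c"
  unfolding power_sum_expansion_def admissible_def[symmetric]
  by (rule the_equality) (auto intro: ppoly_eval_inject)

section \<open>Existence of power sum expansions\<close>

lemma LamD:
  assumes "g \<in> Lam a"
  shows "mcoeff g \<alpha> \<noteq> 0 \<Longrightarrow> keys \<alpha> \<subseteq> {a..}" "bounded_degree g" "\<sigma> permutes {a..} \<Longrightarrow> mperm \<sigma> g = g"
  using assms by (auto simp: Lam_def bounded_degree_def)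

lemma LamI_permutes:
  assumes "\<And>\<alpha>. mcoeff g \<alpha> \<noteq> 0 \<Longrightarrow> keys \<alpha> \<subseteq> {a..}" "bounded_degree g"
    "\<And>\<sigma>. \<sigma> permutes {a..} \<Longrightarrow> mperm \<sigma> g = g"
  shows "g \<in> Lam a"
  using assms unfolding Lam_def bounded_degree_def by blast

lemma mcoeff_mult_nonzeroE:
  fixes f g :: "'a::comm_ring_1 mfps"
  assumes "mcoeff (f * g) \<alpha> \<noteq> 0"
  obtains \<beta> \<gamma> where "\<alpha> = \<beta> + \<gamma>" "mcoeff f \<beta> \<noteq> 0" "mcoeff g \<gamma> \<noteq> 0"
proof -
  have "(\<Sum>p\<in>splits \<alpha>. mcoeff f (fst p) * mcoeff g (snd p)) \<noteq> 0"
    using assms by (simp add: mcoeff_mult case_prod_unfold)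
  then obtain p where p: "p \<in> splits \<alpha>" "mcoeff f (fst p) * mcoeff g (snd p) \<noteq> 0"
    by (rule sum.not_neutral_contains_not_neutral)
  then have "mcoeff f (fst p) \<noteq> 0" "mcoeff g (snd p) \<noteq> 0" by auto
  moreover have "\<alpha> = fst p + snd p" using p(1) by (auto simp: splits_def)
  ultimately show ?thesis by (rule that[rotated])
qed

lemma bounded_degree_mult:
  fixes f g :: "'a::comm_ring_1 mfps"
  assumes "bounded_degree f" "bounded_degree g" shows "bounded_degree (f * g)"
proof -
  obtain n m where n: "\<And>\<alpha>. mcoeff f \<alpha> \<noteq> 0 \<Longrightarrow> total_degree \<alpha> \<le> n"
    and m: "\<And>\<alpha>. mcoeff g \<alpha> \<noteq> 0 \<Longrightarrow> total_degree \<alpha> \<le> m"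
    using assms by (auto simp: bounded_degree_def)
  have "total_degree \<alpha> \<le> n + m" if "mcoeff (f * g) \<alpha> \<noteq> 0" for \<alpha>
  proof -
    obtain \<beta> \<gamma> where "\<alpha> = \<beta> + \<gamma>" "mcoeff f \<beta> \<noteq> 0" "mcoeff g \<gamma> \<noteq> 0"
      using mcoeff_mult_nonzeroE[OF \<open>mcoeff (f * g) \<alpha> \<noteq> 0\<close>] by blast
    then show ?thesis using n[of \<beta>] m[of \<gamma>] by (auto simp: total_degree_add add_mono)
  qed
  then show ?thesis by (auto simp: bounded_degree_def)
qed

lemma Lam_mult:
  assumes "f \<in> Lam a" "g \<in> Lam a" shows "f * g \<in> Lam a"
proof (rule LamI_permutes)
  show "keys \<alpha> \<subseteq> {a..}" if "mcoeff (f * g) \<alpha> \<noteq> 0" for \<alpha>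
  proof -
    obtain \<beta> \<gamma> where "\<alpha> = \<beta> + \<gamma>" "mcoeff f \<beta> \<noteq> 0" "mcoeff g \<gamma> \<noteq> 0"
      using mcoeff_mult_nonzeroE[OF \<open>mcoeff (f * g) \<alpha> \<noteq> 0\<close>] by blast
    then show ?thesis using LamD(1)[OF assms(1), of \<beta>] LamD(1)[OF assms(2), of \<gamma>]
      by (auto simp: keys_add_expo)
  qed
  show "bounded_degree (f * g)" using LamD(2)[OF assms(1)] LamD(2)[OF assms(2)] by (rule bounded_degree_mult)
  show "mperm \<sigma> (f * g) = f * g" if "\<sigma> permutes {a..}" for \<sigma>
    using LamD(3)[OF assms(1) that] LamD(3)[OF assms(2) that] by (simp add: mperm_mult permutes_bij[OF that])
qed

lemma Lam_diff:
  assumes "f \<in> Lam a" "g \<in> Lam a" shows "f - g \<in> Lam a"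
proof -
  obtain n m where n: "\<And>\<alpha>. mcoeff f \<alpha> \<noteq> 0 \<Longrightarrow> total_degree \<alpha> \<le> n"
    and m: "\<And>\<alpha>. mcoeff g \<alpha> \<noteq> 0 \<Longrightarrow> total_degree \<alpha> \<le> m"
    using LamD(2)[OF assms(1)] LamD(2)[OF assms(2)] unfolding bounded_degree_def by blast
  have *: "keys \<alpha> \<subseteq> {a..} \<and> total_degree \<alpha> \<le> max n m" if "mcoeff (f - g) \<alpha> \<noteq> 0" for \<alpha>
  proof (cases "mcoeff f \<alpha> = 0")
    case True
    then have "mcoeff g \<alpha> \<noteq> 0" using that by auto
    then show ?thesis using LamD(1)[OF assms(2), of \<alpha>] m[of \<alpha>] by simp
  next
    case False
    then show ?thesis using LamD(1)[OF assms(1), of \<alpha>] n[of \<alpha>] by simp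
  qed
  then have "bounded_degree (f - g)" unfolding bounded_degree_def by blast
  moreover have "mperm \<sigma> (f - g) = f - g" if "\<sigma> permutes {a..}" for \<sigma>
    using LamD(3)[OF assms(1) that] LamD(3)[OF assms(2) that] by (simp add: mperm_diff)
  ultimately show ?thesis using * by (intro LamI_permutes) blast+
qed

lemma Lam_mconst: "mconst c \<in> Lam a"
proof (rule LamI_permutes)
  have *: "keys \<alpha> \<subseteq> {a..} \<and> total_degree \<alpha> \<le> 0" if "mcoeff (mconst c) \<alpha> \<noteq> 0" for \<alpha>
    using that by (simp add: mcoeff_mconst split: if_splits)
  then show "keys \<alpha> \<subseteq> {a..}" if "mcoeff (mconst c) \<alpha> \<noteq> 0" for \<alpha> using that by blast
  show "bounded_degree (mconst c)" using * unfolding bounded_degree_def by blast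
qed (simp add: permutes_bij)

lemma Lam_sum: "(\<And>i. i \<in> A \<Longrightarrow> f i \<in> Lam a) \<Longrightarrow> (\<Sum>i\<in>A. f i) \<in> Lam a"
proof (induct A rule: infinite_finite_induct)
  case (insert x A)
  have "f x - (0 - sum f A) \<in> Lam a"
    using insert Lam_mconst[of 0 a] by (intro Lam_diff) auto
  then show ?case using insert by simp
qed (use Lam_mconst[of 0] in auto)

lemma mperm_psum:
  assumes "\<sigma> permutes {a..}" "1 \<le> k" shows "mperm \<sigma> (psum a k) = psum a k"
proof (rule mfps_eqI)
  fix \<alpha>
  have b: "bij \<sigma>" using assms(1) by (rule permutes_bij)
  have "(\<exists>i\<ge>a. map_key \<sigma> \<alpha> = single i k) \<longleftrightarrow> (\<exists>i\<ge>a. \<alpha> = single i k)"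
  proof
    assume "\<exists>i\<ge>a. map_key \<sigma> \<alpha> = single i k"
    then obtain i where i: "i \<ge> a" "map_key \<sigma> \<alpha> = single i k" by blast
    then have "map_key \<sigma> \<alpha> = map_key \<sigma> (single (\<sigma> i) k)"
      by (simp add: map_key_single bij_is_inj[OF b])
    then have "\<alpha> = single (\<sigma> i) k" using map_key_inv_cancel[OF b] by metis
    moreover have "\<sigma> i \<ge> a" using i permutes_in_image[OF assms(1), of i] by simp
    ultimately show "\<exists>i\<ge>a. \<alpha> = single i k" by blast
  next
    assume "\<exists>i\<ge>a. \<alpha> = single i k"
    then obtain i where i: "i \<ge> a" "\<alpha> = single i k" by blast
    have si: "\<sigma> (inv \<sigma> i) = i" using permutes_inverses(1)[OF assms(1)] .
    have "map_key \<sigma> \<alpha> = single (inv \<sigma> i) k"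
      using map_key_single[OF bij_is_inj[OF b], of "inv \<sigma> i" k] si i by simp
    moreover have "inv \<sigma> i \<ge> a" using i permutes_in_image[OF assms(1), of "inv \<sigma> i"] si by simp
    ultimately show "\<exists>i\<ge>a. map_key \<sigma> \<alpha> = single i k" by blast
  qed
  then show "mcoeff (mperm \<sigma> (psum a k)) \<alpha> = mcoeff (psum a k) \<alpha>"
    by (simp only: mcoeff_mperm mcoeff_psum)
qed

lemma Lam_psum:
  assumes "1 \<le> k" shows "psum a k \<in> Lam a"
proof (rule LamI_permutes)
  have *: "keys \<alpha> \<subseteq> {a..} \<and> total_degree \<alpha> \<le> k" if nz: "mcoeff (psum a k) \<alpha> \<noteq> 0" for \<alpha>
  proof -
    obtain i where "a \<le> i" "\<alpha> = single i k" using nz unfolding mcoeff_psum by metis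
    then show ?thesis by simp
  qed
  then show "keys \<alpha> \<subseteq> {a..}" if "mcoeff (psum a k) \<alpha> \<noteq> 0" for \<alpha> using that by blast
  show "bounded_degree (psum a k)" using * unfolding bounded_degree_def by blast
qed (use mperm_psum assms in blast)

lemma Lam_pprod: "keys m \<subseteq> {1..} \<Longrightarrow> pprod a m \<in> Lam a"
proof (induct m rule: expo_induct)
  case zero
  then show ?case using Lam_mconst[of 1] by simp
next
  case (add k m)
  then show ?case unfolding pprod_add pprod_single
    by (intro Lam_mult Lam_psum) (auto simp: keys_add_expo)
qed

text \<open>Vectors of the same shape differ by a permutation of the finitely many variables that
  occur in them, and \<open>h\<close> is invariant under it.\<close>

lemma Lam_same_shape:
  assumes "h \<in> Lam a" "keys \<alpha> \<subseteq> {a..}" "keys \<beta> \<subseteq> {a..}" "shape \<alpha> = shape \<beta>"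
  shows "mcoeff h \<alpha> = mcoeff h \<beta>"
proof -
  define K where "K = keys \<alpha> \<union> keys \<beta>"
  have K: "finite K" "K \<subseteq> {a..}" using assms by (auto simp: K_def)
  \<comment> \<open>The exponent 0 does not enter the shape. Its multiplicity within
    \<open>K\<close> follows from the number of nonzero exponents, which is the degree of the
    shape.\<close>
  have c: "card {i\<in>K. lookup \<gamma> i = k} = (if k = 0 then card K - total_degree (shape \<gamma>) else lookup (shape \<gamma>) k)"
    if "keys \<gamma> \<subseteq> K" for \<gamma> k
  proof (cases "k = 0")
    case True
    have "{i\<in>K. lookup \<gamma> i = 0} = K - keys \<gamma>" by (auto simp: in_keys_iff)
    then show ?thesis using True that K by (simp add: total_degree_shape card_Diff_subset)
  next
    case False
    then have "{i\<in>K. lookup \<gamma> i = k} = {i\<in>keys \<gamma>. lookup \<gamma> i = k}" using that by (auto simp: in_keys_iff)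
    then show ?thesis using False by (simp add: lookup_shape)
  qed
  have cnt: "count (image_mset (lookup \<gamma>) (mset_set K)) k = card {i\<in>K. lookup \<gamma> i = k}" for \<gamma> k
  proof -
    have "lookup \<gamma> -` {k} \<inter> K = {i\<in>K. lookup \<gamma> i = k}" by auto
    then show ?thesis using K(1) by (simp add: count_image_mset)
  qed
  have eq: "image_mset (lookup \<beta>) (mset_set K) = image_mset (lookup \<alpha>) (mset_set K)"
  proof (rule multiset_eqI)
    fix k
    have "card {i\<in>K. lookup \<beta> i = k} = card {i\<in>K. lookup \<alpha> i = k}"
      using c[of \<alpha> k] c[of \<beta> k] assms(4) by (simp add: K_def)
    then show "count (image_mset (lookup \<beta>) (mset_set K)) k = count (image_mset (lookup \<alpha>) (mset_set K)) k"
      unfolding cnt .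
  qed
  obtain p where p: "p permutes K" "\<forall>i\<in>K. lookup \<beta> i = lookup \<alpha> (p i)"
    by (rule image_mset_eq_implies_permutes[OF K(1) eq])
  have "lookup \<alpha> (p i) = lookup \<beta> i" for i
  proof (cases "i \<in> K")
    case False
    then have "i \<notin> keys \<alpha>" "i \<notin> keys \<beta>" by (auto simp: K_def)
    then show ?thesis using permutes_not_in[OF p(1) False] by (simp add: in_keys_iff)
  qed (use p(2) in simp)
  then have "map_key p \<alpha> = \<beta>"
    using permutes_inj[OF p(1)] by (intro expo_eqI) (simp add: lookup_map_key)
  then have "mcoeff h \<beta> = mcoeff (mperm p h) \<alpha>" by (simp add: mcoeff_mperm)
  also have "mperm p h = h" using p(1) K(2) by (intro LamD(3)[OF assms(1)]) (rule permutes_subset)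
  finally show ?thesis by simp
qed

lemma power_sum_expansion_add:
  assumes "admissible c" "finite M" "\<And>m. m \<in> M \<Longrightarrow> keys m \<subseteq> {1..}"
  shows "\<exists>d. admissible d \<and> ppoly_eval mconst d (psum a) =
    ppoly_eval mconst c (psum a) + (\<Sum>m\<in>M. mconst (u m) * pprod a m)"
proof -
  define d where "d = c + (\<Sum>m\<in>M. Poly_Mapping.single m (u m))"
  define K where "K = Poly_Mapping.keys c \<union> M"
  have K: "finite K" using assms by (simp add: K_def)
  have l: "Poly_Mapping.lookup d m = Poly_Mapping.lookup c m + (if m \<in> M then u m else 0)" for m
    using assms(2) by (simp add: d_def lookup_add lookup_sum lookup_single when_def)
  have kd: "Poly_Mapping.keys d \<subseteq> K" by (auto simp: K_def in_keys_iff l split: if_splits)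
  have "ppoly_eval mconst d (psum a) = (\<Sum>m\<in>K. mconst (Poly_Mapping.lookup d m) * pprod a m)"
    using ppoly_eval_superset[OF K kd, of mconst "psum a"] by (simp add: pprod_def)
  also have "\<dots> = (\<Sum>m\<in>K. mconst (Poly_Mapping.lookup c m) * pprod a m) +
      (\<Sum>m\<in>K. if m \<in> M then mconst (u m) * pprod a m else 0)"
    unfolding sum.distrib[symmetric]
    by (rule sum.cong) (simp_all add: l mconst_add distrib_right)
  also have "(\<Sum>m\<in>K. mconst (Poly_Mapping.lookup c m) * pprod a m) = ppoly_eval mconst c (psum a)"
    using ppoly_eval_superset[OF K, of c mconst "psum a"] by (simp add: pprod_def K_def)
  also have "(\<Sum>m\<in>K. if m \<in> M then mconst (u m) * pprod a m else 0) = (\<Sum>m\<in>M. mconst (u m) * pprod a m)"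
  proof -
    have "{m\<in>K. m \<in> M} = M" by (auto simp: K_def)
    then show ?thesis using sum.inter_filter[OF K, of "\<lambda>m. mconst (u m) * pprod a m" "\<lambda>m. m \<in> M"] by simp
  qed
  finally have "ppoly_eval mconst d (psum a) =
    ppoly_eval mconst c (psum a) + (\<Sum>m\<in>M. mconst (u m) * pprod a m)" .
  moreover have "admissible d" using kd assms by (auto simp: admissible_def K_def)
  ultimately show ?thesis by blast
qed

text \<open>Induction on a bound for the number of variables in the monomials of \<open>g\<close>.
  The monomials with the largest number \<open>l\<close> of variables are removed by subtracting
  multiples of the power sum products indexed by their shapes; by triangularity these products add
  no monomial with more variables.\<close>

lemma Lam_power_sums:
  assumes "g \<in> Lam a"
  shows "\<exists>c. admissible c \<and> ppoly_eval mconst c (psum a) = g"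
proof -
  have *: "\<exists>c. admissible c \<and> ppoly_eval mconst c (psum a) = g"
    if "\<And>\<alpha>. mcoeff g \<alpha> \<noteq> 0 \<Longrightarrow> card (keys \<alpha>) < l" "g \<in> Lam a" for l and g
    using that
  proof (induct l arbitrary: g)
    case 0
    then have "g = 0" by (intro mfps_eqI) auto
    then show ?case by (intro exI[of _ 0]) (simp add: admissible_def ppoly_eval_def)
  next
    case (Suc l g)
    obtain n where n: "\<And>\<alpha>. mcoeff g \<alpha> \<noteq> 0 \<Longrightarrow> total_degree \<alpha> \<le> n"
      using LamD(2)[OF Suc.prems(2)] by (auto simp: bounded_degree_def)
    define M where "M = shape ` {\<alpha>. mcoeff g \<alpha> \<noteq> 0 \<and> card (keys \<alpha>) = l}"
    have M1: "keys m \<subseteq> {1..}" if "m \<in> M" for m using that keys_shape_pos by (auto simp: M_def)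
    have "keys (shape \<alpha>) \<subseteq> {..n}" if "mcoeff g \<alpha> \<noteq> 0" for \<alpha>
    proof -
      have "lookup \<alpha> i \<le> total_degree \<alpha>" if "i \<in> keys \<alpha>" for i
        unfolding total_degree_def using that by (intro member_le_sum) auto
      then show ?thesis using n[OF that] by (force simp: keys_shape)
    qed
    \<comment> \<open>Only finitely many shapes occur: their parts are bounded by the degree of
      \<open>g\<close>, and the number of parts is \<open>l\<close>.\<close>
    then have "M \<subseteq> {m. keys m \<subseteq> {..n} \<and> total_degree m \<le> l}"
      by (auto simp: M_def total_degree_shape)
    then have fin: "finite M" using finite_expos[of "{..n}" l] finite_subset by blast
    have "\<forall>m\<in>M. \<exists>\<alpha>. shape \<alpha> = m \<and> keys \<alpha> \<subseteq> {a..}" using ex_shape M1 by blast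
    then obtain rep where rep: "\<And>m. m \<in> M \<Longrightarrow> shape (rep m) = m \<and> keys (rep m) \<subseteq> {a..}" by metis
    \<comment> \<open>Coefficients of symmetric series depend on the shape alone, so one
      representative of each shape fixes the multiplier.\<close>
    define u where "u m = mcoeff g (rep m) / mcoeff (pprod a m) (rep m)" for m
    define g' where "g' = g - (\<Sum>m\<in>M. mconst (u m) * pprod a m)"
    have L: "g' \<in> Lam a" unfolding g'_def
      by (intro Lam_diff Suc.prems(2) Lam_sum Lam_mult Lam_mconst Lam_pprod M1)
    have "card (keys \<alpha>) < l" if nz: "mcoeff g' \<alpha> \<noteq> 0" for \<alpha>
    proof (rule ccontr)
      assume "\<not> card (keys \<alpha>) < l"
      then have ge: "l \<le> card (keys \<alpha>)" by simp
      have k\<alpha>: "keys \<alpha> \<subseteq> {a..}" using LamD(1)[OF L nz] .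
      have tm: "total_degree m = l" if "m \<in> M" for m using that by (auto simp: M_def total_degree_shape)
      have P: "mcoeff (pprod a m) \<alpha> = 0" if "m \<in> M" "m \<noteq> shape \<alpha>" for m
        using mcoeff_pprod_nonzero[OF M1[OF that(1)], of a \<alpha>] that ge tm[OF that(1)] by fastforce
      have "(\<Sum>m\<in>M. u m * mcoeff (pprod a m) \<alpha>) =
          (\<Sum>m\<in>M. if m = shape \<alpha> then u m * mcoeff (pprod a m) \<alpha> else 0)"
        by (rule sum.cong) (auto simp: P)
      also have "\<dots> = (if shape \<alpha> \<in> M then u (shape \<alpha>) * mcoeff (pprod a (shape \<alpha>)) \<alpha> else 0)"
        using fin by simp
      also have "\<dots> = mcoeff g \<alpha>"
      proof (cases "shape \<alpha> \<in> M")
        case True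
        note r = rep[OF True]
        have "mcoeff g (rep (shape \<alpha>)) = mcoeff g \<alpha>"
          by (rule Lam_same_shape[OF Suc.prems(2)]) (use r k\<alpha> in auto)
        moreover have "mcoeff (pprod a (shape \<alpha>)) (rep (shape \<alpha>)) = mcoeff (pprod a (shape \<alpha>)) \<alpha>"
          by (rule Lam_same_shape[OF Lam_pprod[OF keys_shape_pos]]) (use r k\<alpha> in auto)
        ultimately show ?thesis using True mcoeff_pprod_shape[OF k\<alpha> keys_shape_pos] by (simp add: u_def)
      next
        case False
        then have "mcoeff g \<alpha> = 0 \<or> card (keys \<alpha>) \<noteq> l" by (auto simp: M_def)
        then have "mcoeff g \<alpha> = 0" using Suc.prems(1)[of \<alpha>] ge by (metis le_antisym less_Suc_eq_le)
        then show ?thesis using False by simp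
      qed
      finally show False using nz by (simp add: g'_def mcoeff_sum)
    qed
    then obtain c where c: "admissible c" "ppoly_eval mconst c (psum a) = g'"
      using Suc.hyps L by blast
    show ?case using power_sum_expansion_add[OF c(1) fin M1, of a u] c(2) by (auto simp: g'_def)
  qed
  obtain n where n: "\<And>\<alpha>. mcoeff g \<alpha> \<noteq> 0 \<Longrightarrow> total_degree \<alpha> \<le> n"
    using LamD(2)[OF assms] by (auto simp: bounded_degree_def)
  moreover have "card (keys \<alpha>) \<le> total_degree \<alpha>" for \<alpha>
    unfolding total_degree_def card_eq_sum by (rule sum_mono) (simp add: in_keys_iff Suc_leI)
  ultimately have "mcoeff g \<alpha> \<noteq> 0 \<Longrightarrow> card (keys \<alpha>) < Suc n" for \<alpha>
    by (meson le_imp_less_Suc order_trans)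
  then show ?thesis using * assms by blast
qed

lemma plethysm_eq:
  "admissible c \<Longrightarrow> plethysm emb a (ppoly_eval mconst c (psum a)) A = ppoly_eval emb c A"
  by (simp add: plethysm_def power_sum_expansion_eqI)

section \<open>The operator \<open>d\<^sub>-\<close> as a substitution\<close>

lemma ppoly_eval_hom:
  assumes "\<phi> 0 = 0" "\<phi> 1 = 1" "\<And>x y. \<phi> (x + y) = \<phi> x + \<phi> y" "\<And>x y. \<phi> (x * y) = \<phi> x * \<phi> y"
  shows "\<phi> (ppoly_eval emb c A) = ppoly_eval (\<lambda>a. \<phi> (emb a)) c (\<lambda>k. \<phi> (A k))"
proof -
  have sum: "\<phi> (\<Sum>i\<in>I. f i) = (\<Sum>i\<in>I. \<phi> (f i))" for I :: "expo set" and f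
    by (induct I rule: infinite_finite_induct) (auto simp: assms)
  have prod: "\<phi> (\<Prod>i\<in>I. f i) = (\<Prod>i\<in>I. \<phi> (f i))" for I :: "nat set" and f
    by (induct I rule: infinite_finite_induct) (auto simp: assms)
  have power: "\<phi> (x ^ n) = \<phi> x ^ n" for x n by (induct n) (auto simp: assms)
  show ?thesis by (simp add: ppoly_eval_def sum prod power assms(4))
qed

lemma ppoly_eval_cong:
  assumes "admissible c" "\<And>k. 1 \<le> k \<Longrightarrow> A k = B k"
  shows "ppoly_eval emb c A = ppoly_eval emb c B"
  unfolding ppoly_eval_def using assms
  by (intro sum.cong prod.cong refl arg_cong2[where f = "(*)"] arg_cong2[where f = "(^)"])
     (auto simp: admissible_def subset_iff)

section \<open>Evaluation of polynomials at \<open>u\<close> in Laurent series\<close>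

definition uhom :: "'a::comm_ring_1 poly \<Rightarrow> 'a fls" where
  "uhom Q = poly (map_poly fls_const Q) fls_X_inv"

lemma uhom_pCons: "uhom (pCons a Q) = fls_const a + fls_X_inv * uhom Q"
  by (simp add: uhom_def map_poly_pCons)

lemma uhom_0 [simp]: "uhom 0 = 0"
  by (simp add: uhom_def)

lemma uhom_const [simp]: "uhom [:a:] = fls_const a"
  by (simp add: uhom_pCons)

lemma uhom_1 [simp]: "uhom 1 = 1"
  by (simp add: one_pCons)

lemma uhom_add: "uhom (P + Q) = uhom P + uhom Q"
  by (induct P Q rule: poly_induct2) (simp_all add: uhom_pCons algebra_simps flip: fls_plus_const)

lemma uhom_smult: "uhom (smult a Q) = fls_const a * uhom Q"
  by (induct Q) (simp_all add: uhom_pCons algebra_simps flip: fls_const_mult_const)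

lemma uhom_mult: "uhom (P * Q) = uhom P * uhom Q"
  by (induct P) (simp_all add: uhom_pCons uhom_add uhom_smult algebra_simps)

lemma uhom_uminus: "uhom (- Q) = - uhom Q"
  using uhom_smult[of "-1" Q] by simp

lemma uhom_diff: "uhom (P - Q) = uhom P - uhom Q"
  using uhom_add[of P "- Q"] by (simp add: uhom_uminus)

lemma uhom_monom: "uhom (monom 1 n) = fls_X_inv ^ n"
  by (induct n) (simp_all add: monom_Suc uhom_pCons monom_0)

text \<open>The linear substitution of the coefficients of \<open>W\<close> for the powers of the variable.\<close>

definition umbral :: "'a::comm_ring_1 fps \<Rightarrow> 'a poly \<Rightarrow> 'a" where
  "umbral W Q = (\<Sum>n\<le>degree Q. coeff Q n * fps_nth W n)"

text \<open>Since \<open>u\<close> is the inverse of the Laurent variable, the constant term of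
  \<open>u^n W\<close> is the \<open>n\<close>-th coefficient of \<open>W\<close>.\<close>

lemma fls_nth_uhom_mult: "fls_nth (uhom Q * fps_to_fls W) 0 = umbral W Q"
proof -
  have c: "fls_nth (fls_const a * (fls_X_inv ^ n * fps_to_fls W)) 0 = a * fps_nth W n" for a n
    by (simp add: fls_X_inv_power_times_conv_shift)
  have "uhom Q = (\<Sum>n\<le>degree Q. fls_const (coeff Q n) * fls_X_inv ^ n)"
  proof -
    have "degree (map_poly fls_const Q) = degree Q" by (rule degree_map_poly) simp
    then show ?thesis by (simp add: uhom_def poly_altdef coeff_map_poly)
  qed
  then have "uhom Q * fps_to_fls W = (\<Sum>n\<le>degree Q. fls_const (coeff Q n) * (fls_X_inv ^ n * fps_to_fls W))"
    by (simp add: sum_distrib_right mult.assoc)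
  moreover have "fls_nth (\<Sum>n\<in>A. h n) 0 = (\<Sum>n\<in>A. fls_nth (h n) 0)" for A :: "nat set" and h :: "nat \<Rightarrow> 'a fls"
    by (induct A rule: infinite_finite_induct) auto
  ultimately show ?thesis by (simp only: c umbral_def)
qed

lemma umbral_add: "umbral W (P + Q) = umbral W P + umbral W Q"
  by (simp add: uhom_add distrib_right flip: fls_nth_uhom_mult)

lemma umbral_0 [simp]: "umbral W 0 = 0"
  by (simp add: umbral_def)

lemma umbral_sum: "umbral W (\<Sum>i\<in>A. f i) = (\<Sum>i\<in>A. umbral W (f i))"
  by (induct A rule: infinite_finite_induct) (auto simp: umbral_add)

lemma umbral_smult: "umbral W (smult a Q) = a * umbral W Q"
  by (simp add: uhom_smult mult.assoc flip: fls_nth_uhom_mult)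

text \<open>Required for all \<open>k \<ge> s\<close>, this says that the coefficients are symmetric
  in \<open>x_s, x_{s+1}, ...\<close>; they then act as scalars for the operators \<open>T_k\<close>
  with \<open>k \<ge> s\<close>.\<close>

definition coeffs_fixed :: "nat \<Rightarrow> qt mfps poly \<Rightarrow> bool" where
  "coeffs_fixed k Q \<longleftrightarrow> (\<forall>n. adj k (coeff Q n) = coeff Q n)"

lemma coeffs_fixed_add: "coeffs_fixed k P \<Longrightarrow> coeffs_fixed k Q \<Longrightarrow> coeffs_fixed k (P + Q)"
  and coeffs_fixed_diff: "coeffs_fixed k P \<Longrightarrow> coeffs_fixed k Q \<Longrightarrow> coeffs_fixed k (P - Q)"
  and coeffs_fixed_mult: "coeffs_fixed k P \<Longrightarrow> coeffs_fixed k Q \<Longrightarrow> coeffs_fixed k (P * Q)"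
  by (simp_all add: coeffs_fixed_def mperm_add mperm_diff coeff_mult mperm_sum mperm_mult)

lemma coeffs_fixed_const: "adj k a = a \<Longrightarrow> coeffs_fixed k [:a:]"
  by (simp add: coeffs_fixed_def coeff_pCons split: nat.split)

lemma coeffs_fixed_monom: "coeffs_fixed k (monom 1 n)"
  by (simp add: coeffs_fixed_def)

lemma coeffs_fixed_power: "coeffs_fixed k P \<Longrightarrow> coeffs_fixed k (P ^ n)"
  by (induct n) (auto simp: coeffs_fixed_mult coeffs_fixed_const one_pCons)

lemma coeffs_fixed_sum: "(\<And>i. i \<in> A \<Longrightarrow> coeffs_fixed k (f i)) \<Longrightarrow> coeffs_fixed k (\<Sum>i\<in>A. f i)"
  by (induct A rule: infinite_finite_induct) (auto simp: coeffs_fixed_add coeffs_fixed_def[of k 0])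

lemma coeffs_fixed_prod: "(\<And>i. i \<in> A \<Longrightarrow> coeffs_fixed k (f i)) \<Longrightarrow> coeffs_fixed k (\<Prod>i\<in>A. f i)"
  by (induct A rule: infinite_finite_induct) (auto simp: coeffs_fixed_mult one_pCons coeffs_fixed_const)

lemma coeffs_fixed_smult: "adj k a = a \<Longrightarrow> coeffs_fixed k P \<Longrightarrow> coeffs_fixed k (smult a P)"
  by (simp add: coeffs_fixed_def mperm_mult)

lemma psum_Suc: "1 \<le> k \<Longrightarrow> psum (Suc s) k = psum s k - mvar s ^ k"
proof (rule mfps_eqI)
  fix \<alpha> assume k: "1 \<le> k"
  show "mcoeff (psum (Suc s) k) \<alpha> = mcoeff (psum s k - mvar s ^ k) \<alpha>"
  proof (cases "\<alpha> = single s k")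
    case True
    have "single s k \<noteq> single i k" if "i \<ge> Suc s" for i
    proof
      assume "single s k = single i k"
      then have "lookup (single s k) s = lookup (single i k) s" by simp
      then show False using k that by (simp add: lookup_single when_def)
    qed
    then have "\<not> (\<exists>i\<ge>Suc s. \<alpha> = single i k)" unfolding True by blast
    moreover have "\<exists>i\<ge>s. \<alpha> = single i k" by (rule exI[of _ s]) (simp add: True)
    ultimately show ?thesis using True
      by (simp only: mcoeff_psum mcoeff_mmonom mcoeff_minus mmonom_single[symmetric] if_True if_False diff_self simp_thms)
  next
    case False
    have "Suc s \<le> i \<longleftrightarrow> s \<le> i" if "\<alpha> = single i k" for i using that False by (cases "i = s") auto
    then have "(\<exists>i\<ge>Suc s. \<alpha> = single i k) \<longleftrightarrow> (\<exists>i\<ge>s. \<alpha> = single i k)" by blast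
    then show ?thesis using False by (simp only: mcoeff_psum mcoeff_mmonom mcoeff_minus mmonom_single[symmetric] if_False diff_0_right)
  qed
qed

text \<open>Rewriting \<open>g(x\<^sub>s\<^sub>+\<^sub>1, \<dots>)\<close> as a polynomial in \<open>x\<^sub>s\<close> over the symmetric functions in
  \<open>x\<^sub>s, x\<^sub>s\<^sub>+\<^sub>1, \<dots>\<close> turns \<open>\<B>\<^sub>n\<close> into the substitution of the coefficients of \<open>\<Omega>\<close> for the powers of \<open>x\<^sub>s\<close>.\<close>

lemma BB_eq_umbral:
  assumes "g \<in> Lam (Suc s)"
  shows "\<exists>Q. poly Q (mvar s) = mvar s ^ n * g \<and> (\<forall>k\<ge>s. coeffs_fixed k Q) \<and>
    BB s n (plethysm mconst (Suc s) g (psum s)) = umbral (Omega_series s) Q"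
proof -
  obtain c where c: "admissible c" "ppoly_eval mconst c (psum (Suc s)) = g"
    using Lam_power_sums[OF assms] by blast
  \<comment> \<open>\<open>R\<close> is \<open>g[Z - v]\<close> as a polynomial in a new variable
    \<open>v\<close>. At \<open>v = x_s\<close> it becomes \<open>g(x_{s+1}, ...)\<close>, and at
    \<open>v = u\<close> it becomes the plethystic factor in \<open>BB\<close>.\<close>
  define R where "R = ppoly_eval (\<lambda>a. [:mconst a:]) c (\<lambda>k. [:psum s k:] - monom 1 k)"
  define Q where "Q = monom 1 n * R"
  have "poly R (mvar s) = ppoly_eval (\<lambda>a. poly [:mconst a:] (mvar s)) c (\<lambda>k. poly ([:psum s k:] - monom 1 k) (mvar s))"
    unfolding R_def by (rule ppoly_eval_hom) simp_all
  also have "\<dots> = ppoly_eval mconst c (\<lambda>k. psum s k - mvar s ^ k)"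
    by (simp add: poly_monom)
  also have "\<dots> = ppoly_eval mconst c (psum (Suc s))"
    by (rule ppoly_eval_cong[OF c(1)]) (simp add: psum_Suc)
  finally have "poly Q (mvar s) = mvar s ^ n * g" by (simp add: Q_def poly_monom c(2))
  moreover have "coeffs_fixed k Q" if k: "k \<ge> s" for k
  proof -
    have "adj k (psum s j) = psum s j" if "1 \<le> j" for j
      using k that by (intro mperm_psum permutes_swap_id) auto
    then show ?thesis unfolding Q_def R_def ppoly_eval_def using c(1)
      by (intro coeffs_fixed_mult coeffs_fixed_monom coeffs_fixed_sum coeffs_fixed_prod coeffs_fixed_power
            coeffs_fixed_diff coeffs_fixed_const)
         (auto simp: admissible_def)
  qed
  moreover have "BB s n (plethysm mconst (Suc s) g (psum s)) = umbral (Omega_series s) Q"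
  proof -
    have "uhom R = ppoly_eval (\<lambda>a. uhom [:mconst a:]) c (\<lambda>k. uhom ([:psum s k:] - monom 1 k))"
      unfolding R_def by (rule ppoly_eval_hom) (simp_all add: uhom_add uhom_mult)
    also have "\<dots> = ppoly_eval (\<lambda>a. fls_const (mconst a)) c (\<lambda>k. fls_const (psum s k) - fls_X_inv ^ k)"
      by (simp add: uhom_diff uhom_monom)
    also have "\<dots> = plethysm (\<lambda>a. fls_const (mconst a)) s (ppoly_eval mconst c (psum s))
        (\<lambda>k. fls_const (psum s k) - fls_X_inv ^ k)"
      by (simp add: plethysm_eq[OF c(1)])
    also have "ppoly_eval mconst c (psum s) = plethysm mconst (Suc s) g (psum s)"
      using plethysm_eq[OF c(1)] c(2) by metis
    finally show ?thesis
      by (simp add: BB_def Q_def uhom_mult uhom_monom flip: fls_nth_uhom_mult)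
  qed
  ultimately show ?thesis by blast
qed

lemma adj_mmonom:
  assumes "keys \<eta> \<subseteq> {..<k}" shows "adj k (mmonom \<eta>) = (mmonom \<eta> :: qt mfps)"
proof -
  have "\<eta> = (\<Sum>i\<in>keys \<eta>. single i (lookup \<eta> i))"
    by (rule expo_eqI) (simp add: lookup_sum_single in_keys_iff)
  then have "mmonom \<eta> = (\<Prod>i\<in>keys \<eta>. mvar i ^ lookup \<eta> i :: qt mfps)"
    by (metis (no_types, lifting) mmonom_single mmonom_sum prod.cong)
  moreover have "adj k (\<Prod>i\<in>keys \<eta>. mvar i ^ lookup \<eta> i :: qt mfps) = (\<Prod>i\<in>keys \<eta>. mvar i ^ lookup \<eta> i)"
    unfolding mperm_prod[OF bij_transpose]
    by (rule prod.cong) (use assms in \<open>auto simp: mperm_power mperm_mvar transpose_def\<close>)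
  ultimately show ?thesis by simp
qed

text \<open>In each summand \<open>x^\<eta> g_\<eta>\<close> of \<open>f\<close>, the power of
  \<open>x_s\<close> and \<open>g_\<eta>\<close> go into the polynomial of
  \<open>BB_eq_umbral\<close>. The remaining monomial in \<open>x_1, ..., x_{s-1}\<close> is a
  coefficient fixed by every transposition involved.\<close>

lemma d_minus_eq_umbral:
  assumes "tail_symmetric s f"
  shows "\<exists>Q. poly Q (mvar s) = f \<and> (\<forall>k\<ge>s. coeffs_fixed k Q) \<and> d_minus s f = umbral (Omega_series s) Q"
proof -
  let ?H = "{\<eta>. keys \<eta> \<subseteq> {1..s} \<and> sym_part s \<eta> f \<noteq> 0}"
  let ?\<eta>' = "\<lambda>\<eta>. Poly_Mapping.update s 0 \<eta> :: expo"
  define B where "B \<eta> = BB s (lookup \<eta> s) (plethysm mconst (Suc s) (sym_part s \<eta> f) (psum s))" for \<eta>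
  have "\<exists>Q. poly Q (mvar s) = mvar s ^ lookup \<eta> s * sym_part s \<eta> f \<and> (\<forall>k\<ge>s. coeffs_fixed k Q) \<and>
      B \<eta> = umbral (Omega_series s) Q" if "\<eta> \<in> ?H" for \<eta>
    unfolding B_def by (rule BB_eq_umbral, rule sym_part_Lam[OF assms]) (use that in simp)
  then have "\<forall>\<eta>\<in>?H. \<exists>Q. poly Q (mvar s) = mvar s ^ lookup \<eta> s * sym_part s \<eta> f \<and>
      (\<forall>k\<ge>s. coeffs_fixed k Q) \<and> B \<eta> = umbral (Omega_series s) Q" by blast
  from bchoice[OF this] obtain q where q: "\<forall>\<eta>\<in>?H. poly (q \<eta>) (mvar s) = mvar s ^ lookup \<eta> s * sym_part s \<eta> f \<and>
      (\<forall>k\<ge>s. coeffs_fixed k (q \<eta>)) \<and> B \<eta> = umbral (Omega_series s) (q \<eta>)" ..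
  have q1: "poly (q \<eta>) (mvar s) = mvar s ^ lookup \<eta> s * sym_part s \<eta> f"
    and q2: "\<forall>k\<ge>s. coeffs_fixed k (q \<eta>)" and q3: "B \<eta> = umbral (Omega_series s) (q \<eta>)"
    if "\<eta> \<in> ?H" for \<eta>
    by (rule conjunct1[OF bspec[OF q that]], rule conjunct1[OF conjunct2[OF bspec[OF q that]]],
        rule conjunct2[OF conjunct2[OF bspec[OF q that]]])
  define Q where "Q = (\<Sum>\<eta>\<in>?H. smult (mmonom (?\<eta>' \<eta>)) (q \<eta>))"
  have u: "?\<eta>' \<eta> + single s (lookup \<eta> s) = \<eta>" for \<eta>
    by (rule expo_eqI) (simp add: lookup_add lookup_update lookup_single when_def)
  have m: "mmonom \<eta> = mmonom (?\<eta>' \<eta>) * mvar s ^ lookup \<eta> s" for \<eta>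
    using mmonom_add[of "?\<eta>' \<eta>" "single s (lookup \<eta> s)"] by (simp only: u mmonom_single)
  have "poly Q (mvar s) = (\<Sum>\<eta>\<in>?H. mmonom (?\<eta>' \<eta>) * (mvar s ^ lookup \<eta> s * sym_part s \<eta> f))"
    unfolding Q_def poly_sum poly_smult by (rule sum.cong[OF refl]) (simp only: q1)
  also have "\<dots> = (\<Sum>\<eta>\<in>?H. mmonom \<eta> * sym_part s \<eta> f)"
    by (rule sum.cong[OF refl]) (simp only: mult.assoc[symmetric] m[symmetric])
  also have "\<dots> = f" by (rule tail_symmetric_expansion[OF assms, symmetric])
  finally have "poly Q (mvar s) = f" .
  moreover have "coeffs_fixed k Q" if "k \<ge> s" for k
    unfolding Q_def
  proof (intro coeffs_fixed_sum coeffs_fixed_smult adj_mmonom)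
    fix \<eta> assume "\<eta> \<in> ?H"
    then show "coeffs_fixed k (q \<eta>)" using q2 that by blast
    have \<eta>: "keys \<eta> \<subseteq> {1..s}" using \<open>\<eta> \<in> ?H\<close> by simp
    show "keys (?\<eta>' \<eta>) \<subseteq> {..<k}"
    proof
      fix i assume "i \<in> keys (?\<eta>' \<eta>)"
      then have "i \<noteq> s" "i \<in> keys \<eta>" by (auto simp: in_keys_iff lookup_update split: if_splits)
      then have "i \<le> s" using \<eta> by (meson atLeastAtMost_iff subsetD)
      then show "i \<in> {..<k}" using \<open>i \<noteq> s\<close> that by simp
    qed
  qed
  moreover have "d_minus s f = umbral (Omega_series s) Q"
    unfolding d_minus_def Q_def umbral_sum umbral_smult B_def[symmetric]
    by (rule sum.cong[OF refl]) (simp only: q3)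
  ultimately show ?thesis by (intro exI[of _ Q] conjI allI impI)
qed

section \<open>The series \<open>\<Omega>\<close>\<close>

text \<open>A summation range that is the same for all coefficients up to \<open>M\<close> allows
  the sums to be interchanged in the chain rule for \<open>mexp\<close>.\<close>

lemma fps_compose_nth_le:
  fixes a b :: "'a::comm_ring_1 fps"
  assumes "fps_nth b 0 = 0" "n \<le> M"
  shows "fps_nth (a oo b) n = (\<Sum>i\<le>M. fps_nth a i * fps_nth (b ^ i) n)"
proof -
  have "fps_nth (a oo b) n = (\<Sum>i\<in>{0..n}. fps_nth a i * fps_nth (b ^ i) n)"
    by (simp add: fps_compose_nth)
  also have "\<dots> = (\<Sum>i\<le>M. fps_nth a i * fps_nth (b ^ i) n)"
  proof (rule sum.mono_neutral_left)
    show "\<forall>i\<in>{..M} - {0..n}. fps_nth a i * fps_nth (b ^ i) n = 0"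
      using startsby_zero_power_prefix[OF assms(1)] by auto
  qed (use assms(2) in auto)
  finally show ?thesis .
qed

text \<open>The chain rule for the exponential, from \<open>i c_i = c_{i-1}\<close> for
  \<open>c_i = 1/i!\<close>. It yields the logarithmic derivative of \<Omega>.\<close>

lemma fps_deriv_mexp:
  assumes "fps_nth g 0 = 0"
  shows "fps_deriv (mexp g) = mexp g * fps_deriv g"
proof (rule fps_ext)
  fix n
  define c :: "nat \<Rightarrow> qt mfps" where "c i = mconst (1 / of_nat (fact i))" for i
  have c: "of_nat (Suc i) * c (Suc i) = c i" for i
  proof -
    have "of_nat (Suc i) * (1 / of_nat (fact (Suc i))) = (1 / of_nat (fact i) :: qt)"
      unfolding fact_Suc of_nat_mult of_nat_id by (simp del: of_nat_Suc)
    then show ?thesis unfolding c_def mconst_of_nat[symmetric] mconst_mult[symmetric] by (rule arg_cong)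
  qed
  have "fps_nth (fps_deriv (mexp g)) n = of_nat (Suc n) * fps_nth (mexp g) (Suc n)" by simp
  also have "fps_nth (mexp g) (Suc n) = (\<Sum>i\<le>Suc n. c i * fps_nth (g ^ i) (Suc n))"
    by (simp add: mexp_def fps_compose_nth_le[OF assms order_refl] c_def)
  also have "\<dots> = (\<Sum>i\<le>n. c (Suc i) * fps_nth (g ^ Suc i) (Suc n))"
    by (subst sum.atMost_Suc_shift) simp
  also have "of_nat (Suc n) * \<dots> = (\<Sum>i\<le>n. c (Suc i) * fps_nth (fps_deriv (g ^ Suc i)) n)"
    unfolding sum_distrib_left
    by (rule sum.cong[OF refl]) (simp only: fps_deriv_nth Suc_eq_plus1 mult.left_commute)
  also have "\<dots> = (\<Sum>i\<le>n. c i * fps_nth (g ^ i * fps_deriv g) n)"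
  proof (rule sum.cong[OF refl])
    fix i
    have "fps_deriv (g ^ Suc i) = fps_const (of_nat (Suc i)) * (g ^ i * fps_deriv g)"
      by (subst fps_deriv_power) (simp add: mult_ac fps_of_nat)
    then have "c (Suc i) * fps_nth (fps_deriv (g ^ Suc i)) n = (of_nat (Suc i) * c (Suc i)) * fps_nth (g ^ i * fps_deriv g) n"
      by (simp only: fps_mult_left_const_nth) (simp only: mult_ac)
    then show "c (Suc i) * fps_nth (fps_deriv (g ^ Suc i)) n = c i * fps_nth (g ^ i * fps_deriv g) n"
      by (simp only: c)
  qed
  also have "\<dots> = (\<Sum>i\<le>n. \<Sum>j\<in>{0..n}. c i * fps_nth (g ^ i) j * fps_nth (fps_deriv g) (n - j))"
    by (simp add: fps_mult_nth sum_distrib_left mult.assoc)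
  also have "\<dots> = (\<Sum>j\<in>{0..n}. (\<Sum>i\<le>n. c i * fps_nth (g ^ i) j) * fps_nth (fps_deriv g) (n - j))"
    unfolding sum_distrib_right by (rule sum.swap)
  also have "\<dots> = (\<Sum>j\<in>{0..n}. fps_nth (mexp g) j * fps_nth (fps_deriv g) (n - j))"
    by (rule sum.cong[OF refl]) (simp add: mexp_def fps_compose_nth_le[OF assms, where M = n] c_def)
  also have "\<dots> = fps_nth (mexp g * fps_deriv g) n" by (simp add: fps_mult_nth)
  finally show "fps_nth (fps_deriv (mexp g)) n = fps_nth (mexp g * fps_deriv g) n" .
qed

lemma mexp_nth_0: "fps_nth g 0 = 0 \<Longrightarrow> fps_nth (mexp g) 0 = 1"
  by (simp add: mexp_def fps_compose_nth)

text \<open>\<open>om_factor i\<close> is \<open>(1 - t x\<^sub>i z) / (1 - x\<^sub>i z)\<close>, and \<open>om_log_deriv i\<close> its logarithmic derivative.\<close>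

definition om_factor :: "nat \<Rightarrow> qt mfps fps" where
  "om_factor i = Abs_fps (\<lambda>n. if n = 0 then 1 else mconst (1 - tt) * mvar i ^ n)"

definition om_log_deriv :: "nat \<Rightarrow> qt mfps fps" where
  "om_log_deriv i = Abs_fps (\<lambda>n. mconst (1 - tt ^ Suc n) * mvar i ^ Suc n)"

text \<open>This is the coefficient of \<open>z^n\<close> in
  \<open>om_factor i * om_log_deriv i\<close> without its factor \<open>x_i^{n+1}\<close>; the term
  outside the sum comes from the constant coefficient 1 of \<open>om_factor i\<close>.\<close>

lemma om_factor_geometric: "(\<Sum>j\<in>{1..n}. (1 - tt ^ (Suc n - j)) * (1 - tt)) + (1 - tt ^ Suc n) = of_nat (Suc n) * (1 - tt)"
proof (induct n)
  case (Suc n)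
  have "(\<Sum>j\<in>{1..Suc n}. (1 - tt ^ (Suc (Suc n) - j)) * (1 - tt)) =
      (\<Sum>j\<in>{0..n}. (1 - tt ^ (Suc n - j)) * (1 - tt))"
    by (rule sum.reindex_bij_witness[of _ Suc "\<lambda>j. j - 1"]) auto
  also have "\<dots> = (1 - tt ^ Suc n) * (1 - tt) + (\<Sum>j\<in>{1..n}. (1 - tt ^ (Suc n - j)) * (1 - tt))"
    by (subst sum.atLeast_Suc_atMost) auto
  finally show ?case using Suc by (simp add: algebra_simps)
qed simp

lemma fps_deriv_om_factor: "fps_deriv (om_factor i) = om_factor i * om_log_deriv i"
proof (rule fps_ext)
  fix n
  have "fps_nth (om_factor i * om_log_deriv i) n =
      (\<Sum>j\<in>{0..n}. fps_nth (om_factor i) j * fps_nth (om_log_deriv i) (n - j))"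
    by (simp add: fps_mult_nth)
  also have "\<dots> = fps_nth (om_log_deriv i) n +
      (\<Sum>j\<in>{1..n}. fps_nth (om_factor i) j * fps_nth (om_log_deriv i) (n - j))"
    by (subst sum.atLeast_Suc_atMost) (auto simp: om_factor_def)
  also have "(\<Sum>j\<in>{1..n}. fps_nth (om_factor i) j * fps_nth (om_log_deriv i) (n - j)) =
      (\<Sum>j\<in>{1..n}. mconst ((1 - tt ^ (Suc n - j)) * (1 - tt)) * mvar i ^ Suc n)"
  proof (rule sum.cong[OF refl])
    fix j assume j: "j \<in> {1..n}"
    then have e: "Suc (n - j) = Suc n - j" "Suc n = j + (Suc n - j)" by auto
    have "mvar i ^ Suc n = mvar i ^ j * (mvar i ^ (Suc n - j) :: qt mfps)"
      by (subst e(2)) (rule power_add)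
    moreover have "fps_nth (om_factor i) j * fps_nth (om_log_deriv i) (n - j) =
        mconst (1 - tt) * mvar i ^ j * (mconst (1 - tt ^ (Suc n - j)) * mvar i ^ (Suc n - j))"
      using j by (simp add: om_factor_def om_log_deriv_def e(1) del: power_Suc)
    ultimately show "fps_nth (om_factor i) j * fps_nth (om_log_deriv i) (n - j) =
        mconst ((1 - tt ^ (Suc n - j)) * (1 - tt)) * mvar i ^ Suc n"
      by (simp only: mconst_mult mult_ac)
  qed
  also have "fps_nth (om_log_deriv i) n + \<dots> =
      mconst ((\<Sum>j\<in>{1..n}. (1 - tt ^ (Suc n - j)) * (1 - tt)) + (1 - tt ^ Suc n)) * mvar i ^ Suc n"
    by (simp add: om_log_deriv_def mconst_add mconst_sum distrib_right sum_distrib_right del: power_Suc)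
  also have "\<dots> = fps_nth (fps_deriv (om_factor i)) n"
    unfolding om_factor_geometric by (simp add: om_factor_def mconst_mult mconst_of_nat mult.assoc del: power_Suc of_nat_Suc)
  finally show "fps_nth (fps_deriv (om_factor i)) n = fps_nth (om_factor i * om_log_deriv i) n" by simp
qed

lemma fps_deriv_prod_om_factor:
  "finite I \<Longrightarrow> fps_deriv (\<Prod>i\<in>I. om_factor i) = (\<Prod>i\<in>I. om_factor i) * (\<Sum>i\<in>I. om_log_deriv i)"
  by (induct I rule: finite_induct) (simp_all add: fps_deriv_om_factor algebra_simps)

lemma trunc_psum:
  assumes "1 \<le> k" shows "trunc N (psum a k) = (\<Sum>i\<in>{a..N}. mvar i ^ k)"
proof (rule mfps_eqI)
  fix \<alpha>
  have inj: "single i k = single j k \<longleftrightarrow> i = j" for i j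
  proof
    assume "single i k = single j k"
    then have "lookup (single i k) i = lookup (single j k) i" by simp
    then show "i = j" using assms by (simp add: lookup_single when_def split: if_splits)
  qed simp
  have "mcoeff (\<Sum>i\<in>{a..N}. mvar i ^ k) \<alpha> = (\<Sum>i\<in>{a..N}. if \<alpha> = single i k then 1 else 0 :: qt)"
    by (simp add: mcoeff_sum mcoeff_mmonom flip: mmonom_single)
  also have "\<dots> = mcoeff (trunc N (psum a k)) \<alpha>"
  proof (cases "\<exists>i\<in>{a..N}. \<alpha> = single i k")
    case True
    then obtain i where i: "i \<in> {a..N}" "\<alpha> = single i k" by blast
    then have "(\<Sum>i\<in>{a..N}. if \<alpha> = single i k then 1 else 0 :: qt) = 1"
      by (simp add: inj)
    moreover have "\<exists>i\<ge>a. \<alpha> = single i k" using i by auto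
    ultimately show ?thesis using i assms by (simp add: mcoeff_trunc mcoeff_psum)
  next
    case False
    then have 0: "(\<Sum>i\<in>{a..N}. if \<alpha> = single i k then 1 else 0 :: qt) = 0" by (intro sum.neutral) auto
    have "mcoeff (trunc N (psum a k)) \<alpha> = 0"
    proof (rule ccontr)
      assume "mcoeff (trunc N (psum a k)) \<alpha> \<noteq> 0"
      then have "keys \<alpha> \<subseteq> {..N}" "\<exists>i\<ge>a. \<alpha> = single i k"
        unfolding mcoeff_trunc mcoeff_psum by metis+
      then obtain i where "i \<ge> a" "\<alpha> = single i k" "i \<le> N" using assms by (auto split: if_splits)
      then show False using False by auto
    qed
    then show ?thesis using 0 by simp
  qed
  finally show "mcoeff (trunc N (psum a k)) \<alpha> = mcoeff (\<Sum>i\<in>{a..N}. mvar i ^ k) \<alpha>" by simp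
qed

lemma of_nat_mfps_cancel:
  assumes "of_nat (Suc n) * f = of_nat (Suc n) * (g :: qt mfps)" shows "f = g"
proof (rule mfps_eqI)
  fix \<alpha>
  have "mcoeff (mconst (of_nat (Suc n)) * f) \<alpha> = mcoeff (mconst (of_nat (Suc n)) * g) \<alpha>"
    unfolding mconst_of_nat using assms by simp
  then show "mcoeff f \<alpha> = mcoeff g \<alpha>" by (simp del: of_nat_Suc)
qed

text \<open>Both series have constant term 1 and the same logarithmic derivative. This determines
  the coefficients recursively, since positive integers can be cancelled.\<close>

lemma trunc_Omega_series:
  "trunc N (fps_nth (Omega_series s) n) = fps_nth (\<Prod>i\<in>{s..N}. om_factor i) n"
proof (induct n rule: less_induct)
  case (less n)
  define G where "G = Abs_fps (\<lambda>k. if k = 0 then 0 else mconst ((1 - tt ^ k) / of_nat k) * psum s k)"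
  have G0: "fps_nth G 0 = 0" by (simp add: G_def)
  have Om: "Omega_series s = mexp G" by (simp add: Omega_series_def G_def)
  let ?P = "\<Prod>i\<in>{s..N}. om_factor i"
  show ?case
  proof (cases n)
    case 0
    have "finite I \<Longrightarrow> fps_nth (\<Prod>i\<in>I. om_factor i) 0 = 1" for I
      by (induct I rule: finite_induct) (simp_all add: om_factor_def)
    then have "fps_nth ?P 0 = 1" by simp
    then show ?thesis using 0 by (simp add: Om mexp_nth_0[OF G0])
  next
    case (Suc m)
    have dG: "trunc N (fps_nth (fps_deriv G) k) = fps_nth (\<Sum>i\<in>{s..N}. om_log_deriv i) k" for k
    proof -
      have "fps_nth (fps_deriv G) k = of_nat (Suc k) * (mconst ((1 - tt ^ Suc k) / of_nat (Suc k)) * psum s (Suc k))"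
        by (simp add: G_def del: of_nat_Suc power_Suc)
      also have "\<dots> = mconst (of_nat (Suc k) * ((1 - tt ^ Suc k) / of_nat (Suc k))) * psum s (Suc k)"
        by (simp only: mconst_mult mconst_of_nat mult.assoc)
      also have "of_nat (Suc k) * ((1 - tt ^ Suc k) / of_nat (Suc k)) = 1 - tt ^ Suc k"
        by (simp del: of_nat_Suc power_Suc)
      finally show ?thesis
        by (simp add: trunc_mult trunc_psum fps_sum_nth om_log_deriv_def sum_distrib_left del: power_Suc)
    qed
    have "of_nat (Suc m) * trunc N (fps_nth (Omega_series s) (Suc m)) =
        trunc N (fps_nth (fps_deriv (mexp G)) m)"
      unfolding Om mconst_of_nat[symmetric] fps_deriv_nth by (simp add: trunc_mult mconst_of_nat[symmetric] del: of_nat_Suc)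
    also have "\<dots> = (\<Sum>j\<in>{0..m}. trunc N (fps_nth (Omega_series s) j) * trunc N (fps_nth (fps_deriv G) (m - j)))"
      unfolding fps_deriv_mexp[OF G0] by (simp only: fps_mult_nth trunc_sum trunc_mult Om)
    also have "\<dots> = (\<Sum>j\<in>{0..m}. fps_nth ?P j * fps_nth (\<Sum>i\<in>{s..N}. om_log_deriv i) (m - j))"
      by (rule sum.cong[OF refl]) (simp only: dG, subst less, use Suc in auto)
    also have "\<dots> = fps_nth (fps_deriv ?P) m"
      by (simp add: fps_deriv_prod_om_factor fps_mult_nth)
    also have "\<dots> = of_nat (Suc m) * fps_nth ?P (Suc m)" by simp
    finally show ?thesis unfolding Suc by (rule of_nat_mfps_cancel)
  qed
qed

section \<open>\<Omega> as a sum over letters\<close>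

definition geom :: "nat \<Rightarrow> qt mfps fps" where
  "geom i = Abs_fps (\<lambda>n. if n = 0 then 0 else mvar i ^ n)"

text \<open>\<open>geom i\<close> is \<open>x_i z / (1 - x_i z)\<close>, so
  \<open>om_factor i = 1 + (1 - t) geom i\<close>, and the product of the factors telescopes into
  these series. The one for \<open>k\<close> becomes the contribution of letter \<open>k\<close> at
  a position set free.\<close>

definition letter_series :: "nat \<Rightarrow> nat \<Rightarrow> qt mfps fps" where
  "letter_series s k = (\<Prod>i\<in>{s..<k}. om_factor i) * geom k"

lemma om_factor_eq: "om_factor i = 1 + fps_const (mconst (1 - tt)) * geom i"
  by (rule fps_ext) (simp add: om_factor_def geom_def)

lemma prod_om_factor_telescope:
  "s \<le> M \<Longrightarrow> (\<Prod>i\<in>{s..<M}. om_factor i) = 1 + fps_const (mconst (1 - tt)) * (\<Sum>k\<in>{s..<M}. letter_series s k)"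
proof (induct M rule: dec_induct)
  case (step M)
  have "(\<Prod>i\<in>{s..<Suc M}. om_factor i) =
      (\<Prod>i\<in>{s..<M}. om_factor i) + fps_const (mconst (1 - tt)) * letter_series s M"
    using step by (simp add: letter_series_def om_factor_eq[of M] algebra_simps)
  then show ?case using step by (simp add: algebra_simps)
qed simp

lemma trunc_Omega_series_letter:
  assumes "0 < n" "s \<le> Suc N"
  shows "trunc N (fps_nth (Omega_series s) n) = mconst (1 - tt) * (\<Sum>k\<in>{s..N}. fps_nth (letter_series s k) n)"
proof -
  have e: "{s..N} = {s..<Suc N}" by auto
  show ?thesis
    unfolding trunc_Omega_series e prod_om_factor_telescope[OF assms(2)]
    using assms(1) by (simp add: fps_sum_nth del: sum.op_ivl_Suc)
qed

lemma hecke_add: "hecke k f g \<Longrightarrow> hecke k f' g' \<Longrightarrow> hecke k (f + f') (g + g')"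
proof -
  assume *: "hecke k f g" "hecke k f' g'"
  have "(mvar k - mvar (Suc k)) * (g + g') = (mvar k - mvar (Suc k)) * g + (mvar k - mvar (Suc k)) * g'"
    by (simp add: distrib_left)
  also have "\<dots> = (mconst (1 - tt) * mvar (Suc k) * f + (mconst tt * mvar k - mvar (Suc k)) * adj k f) +
      (mconst (1 - tt) * mvar (Suc k) * f' + (mconst tt * mvar k - mvar (Suc k)) * adj k f')"
    using * by (simp only: hecke_def)
  finally show ?thesis unfolding hecke_def mperm_add by (simp only: distrib_left add_ac)
qed

lemma hecke_0: "hecke k 0 0"
  by (simp add: hecke_def)

lemma hecke_sum: "(\<And>i. i \<in> I \<Longrightarrow> hecke k (f i) (g i)) \<Longrightarrow> hecke k (\<Sum>i\<in>I. f i) (\<Sum>i\<in>I. g i)"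
  by (induct I rule: infinite_finite_induct) (auto intro: hecke_add simp: hecke_0)

lemma hecke_mult:
  assumes "hecke k f g" "adj k c = c" shows "hecke k (c * f) (c * g)"
proof -
  have "c * ((mvar k - mvar (Suc k)) * g) =
      c * (mconst (1 - tt) * mvar (Suc k) * f + (mconst tt * mvar k - mvar (Suc k)) * adj k f)"
    using assms(1) by (simp only: hecke_def)
  moreover have "adj k (c * f) = c * adj k f" using assms(2) by (simp add: mperm_mult)
  ultimately show ?thesis unfolding hecke_def by (simp only: distrib_left mult_ac)
qed

lemma hecke_unique: "hecke k f g \<Longrightarrow> hecke k f g' \<Longrightarrow> g = g'"
proof -
  assume "hecke k f g" "hecke k f g'"
  then have "(mvar k - mvar (Suc k)) * (g - g') = 0" by (simp add: hecke_def right_diff_distrib)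
  then have "g - g' = 0" by (rule mvar_diff_nonzero_divisor) simp
  then show ?thesis by simp
qed

text \<open>For \<open>n \<ge> 1\<close> this computes \<open>t T_k^-1 x_k^n\<close>. The
  coefficients on the right obey a recursion that multiplies by \<open>x_{k+1}\<close> and adds one
  term, and the cleared formula is verified along it.\<close>

lemma hecke_geom_step: "hecke k (fps_nth (geom k) n) (fps_nth (om_factor k * geom (Suc k)) n)"
proof (cases n)
  case 0
  then show ?thesis by (simp add: geom_def hecke_0)
next
  case (Suc m)
  let ?a = "mvar k :: qt mfps" and ?b = "mvar (Suc k) :: qt mfps"
  let ?D = "\<lambda>n. fps_nth (om_factor k * geom (Suc k)) n"
  have rec: "?D (Suc n) = fps_nth (om_factor k) n * ?b + ?b * ?D n" for n
  proof -
    have "?D (Suc n) = (\<Sum>i\<in>{0..n}. fps_nth (om_factor k) i * ?b ^ (Suc n - i))"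
      by (simp add: fps_mult_nth geom_def del: power_Suc)
    also have "\<dots> = (\<Sum>i\<in>{0..<n}. fps_nth (om_factor k) i * ?b ^ (Suc n - i)) + fps_nth (om_factor k) n * ?b"
      by (subst sum.last_plus) (auto simp: atLeastLessThanSuc_atLeastAtMost atLeast0_lessThan_Suc add.commute)
    also have "(\<Sum>i\<in>{0..<n}. fps_nth (om_factor k) i * ?b ^ (Suc n - i)) =
        (\<Sum>i\<in>{0..<n}. ?b * (fps_nth (om_factor k) i * fps_nth (geom (Suc k)) (n - i)))"
      by (rule sum.cong[OF refl]) (simp add: geom_def Suc_diff_le mult_ac)
    also have "\<dots> = ?b * (\<Sum>i\<in>{0..n}. fps_nth (om_factor k) i * fps_nth (geom (Suc k)) (n - i))"
      unfolding sum_distrib_left by (rule sum.mono_neutral_left) (auto simp: geom_def)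
    also have "\<dots> = ?b * ?D n" by (simp add: fps_mult_nth)
    finally show ?thesis by (simp add: add.commute)
  qed
  have "(?a - ?b) * ?D (Suc m) = mconst (1 - tt) * ?b * ?a ^ Suc m + (mconst tt * ?a - ?b) * ?b ^ Suc m"
  proof (induct m)
    case 0
    have "?D (Suc 0) = ?b" unfolding rec by (simp add: om_factor_def geom_def fps_mult_nth)
    then show ?case by (simp add: mconst_diff algebra_simps)
  next
    case (Suc m)
    have "(?a - ?b) * ?D (Suc (Suc m)) =
        (?a - ?b) * (mconst (1 - tt) * ?a ^ Suc m * ?b) + ?b * ((?a - ?b) * ?D (Suc m))"
      unfolding rec[of "Suc m"] by (simp add: om_factor_def algebra_simps)
    also have "\<dots> = mconst (1 - tt) * ?b * ?a ^ Suc (Suc m) + (mconst tt * ?a - ?b) * ?b ^ Suc (Suc m)"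
      unfolding Suc by (simp add: algebra_simps)
    finally show ?case .
  qed
  then show ?thesis unfolding Suc hecke_def
    by (simp add: geom_def mperm_power mperm_mvar mult.assoc mperm_mult)
qed

lemma adj_prod_om_factor:
  assumes "finite I" "k \<notin> I" "Suc k \<notin> I"
  shows "adj k (fps_nth (\<Prod>i\<in>I. om_factor i) n) = fps_nth (\<Prod>i\<in>I. om_factor i) n"
  using assms
proof (induct I arbitrary: n rule: finite_induct)
  case (insert i I)
  have "adj k (fps_nth (om_factor i) j) = fps_nth (om_factor i) j" for j
    using insert.prems by (simp add: om_factor_def mperm_mult mperm_power mperm_mvar transpose_def)
  then show ?case using insert by (simp add: fps_mult_nth mperm_sum mperm_mult)
qed simp

text \<open>The factors with index below \<open>k\<close> are fixed by the transposition of
  \<open>x_k\<close> and \<open>x_{k+1}\<close>. Iterated from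
  \<open>letter_series s s = geom s\<close>, this makes the \<open>n\<close>-th coefficient of
  \<open>letter_series s k\<close> the image of \<open>x_s^n\<close>, for \<open>n \<ge> 1\<close>,
  under \<open>(t T_{k-1}^-1) ... (t T_s^-1)\<close>.\<close>

lemma hecke_letter_series:
  assumes "s \<le> k" shows "hecke k (fps_nth (letter_series s k) n) (fps_nth (letter_series s (Suc k)) n)"
proof -
  let ?P = "\<Prod>i\<in>{s..<k}. om_factor i"
  have "letter_series s (Suc k) = ?P * (om_factor k * geom (Suc k))"
    using assms by (simp add: letter_series_def mult.assoc)
  then show ?thesis
    by (simp only: letter_series_def fps_mult_nth[of ?P] )
       (intro hecke_sum hecke_mult hecke_geom_step adj_prod_om_factor, auto)
qed

text \<open>Applying \<open>d\<^sub>-\<close> to a series divisible by \<open>x\<^sub>s\<close> amounts to summing its images under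
  successive products of the operators \<open>t T\<^sub>k\<^sup>-\<^sup>1\<close>.\<close>

lemma trunc_d_minus:
  assumes "tail_symmetric s f" "\<And>\<alpha>. lookup \<alpha> s = 0 \<Longrightarrow> mcoeff f \<alpha> = 0"
    "F s = f" "\<And>k. s \<le> k \<Longrightarrow> hecke k (F k) (F (Suc k))" "s \<le> Suc N"
  shows "trunc N (d_minus s f) = mconst (1 - tt) * (\<Sum>k\<in>{s..N}. trunc N (F k))"
proof -
  obtain Q where Q: "poly Q (mvar s) = f" "\<forall>k\<ge>s. coeffs_fixed k Q"
    "d_minus s f = umbral (Omega_series s) Q"
    using d_minus_eq_umbral[OF assms(1)] by blast
  have fixed: "adj k (coeff Q n) = coeff Q n" if "s \<le> k" for k n
    using Q(2) that by (simp add: coeffs_fixed_def)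
  have f: "f = (\<Sum>n\<le>degree Q. coeff Q n * mvar s ^ n)" using Q(1) by (simp add: poly_altdef)
  have z: "mcoeff (coeff Q 0) \<alpha> = 0" if \<alpha>: "lookup \<alpha> s = 0" for \<alpha>
  proof -
    have "mcoeff f \<alpha> = (\<Sum>n\<le>degree Q. if n = 0 then mcoeff (coeff Q 0) \<alpha> else 0)"
      unfolding f mcoeff_sum
    proof (rule sum.cong[OF refl])
      fix n
      show "mcoeff (coeff Q n * mvar s ^ n) \<alpha> = (if n = 0 then mcoeff (coeff Q 0) \<alpha> else 0)"
      proof (cases n)
        case (Suc m)
        have eq: "coeff Q n * mvar s ^ n = mvar s * (coeff Q n * mvar s ^ m)" by (simp add: Suc mult_ac)
        show ?thesis unfolding eq using Suc \<alpha> by (simp add: mcoeff_mvar_mult)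
      qed simp
    qed
    then show ?thesis using assms(2)[OF \<alpha>] by simp
  qed
  have Q0: "coeff Q 0 = 0"
  proof (rule mfps_eqI)
    fix \<alpha>
    \<comment> \<open>A variable beyond \<open>x_s\<close> that is absent from \<alpha>. Exchanging
      the two removes \<open>x_s\<close> from the exponent vector, where the coefficient is known to
      vanish, and \<open>coeff Q 0\<close> is symmetric.\<close>
    define j where "j = Suc (s + Max (insert 0 (keys \<alpha>)))"
    have "j \<notin> keys \<alpha>"
    proof
      assume "j \<in> keys \<alpha>"
      then have "j \<le> Max (insert 0 (keys \<alpha>))" by (intro Max_ge) auto
      then show False by (simp add: j_def)
    qed
    then have "lookup (map_key (transpose s j) \<alpha>) s = 0" by (simp add: lookup_map_key in_keys_iff)
    then have "mcoeff (mperm (transpose s j) (coeff Q 0)) \<alpha> = 0" unfolding mcoeff_mperm by (rule z)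
    moreover have "mperm (transpose s j) (coeff Q 0) = coeff Q 0"
      by (rule mperm_transpose_invariant[where a = s]) (auto simp: fixed j_def)
    ultimately show "mcoeff (coeff Q 0) \<alpha> = mcoeff 0 \<alpha>" by simp
  qed
  \<comment> \<open>The second argument of \<open>hecke\<close> is determined by the first, so two
    chains that agree at \<open>s\<close> agree from there on.\<close>
  have F: "F k = (\<Sum>n\<le>degree Q. coeff Q n * fps_nth (letter_series s k) n)" if "s \<le> k" for k
    using that
  proof (induct k rule: dec_induct)
    case base
    show ?case unfolding assms(3) by (subst f, rule sum.cong[OF refl]) (auto simp: letter_series_def geom_def Q0)
  next
    case (step k)
    have "hecke k (F k) (\<Sum>n\<le>degree Q. coeff Q n * fps_nth (letter_series s (Suc k)) n)"
      unfolding step(3) using step(1) by (intro hecke_sum hecke_mult hecke_letter_series fixed)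
    then show ?case using assms(4)[OF step(1)] hecke_unique by blast
  qed
  have idem: "trunc N (trunc N g) = trunc N g" for g :: "qt mfps"
    by (rule mfps_eqI) (simp add: mcoeff_trunc)
  have "trunc N (d_minus s f) = (\<Sum>n\<le>degree Q. trunc N (coeff Q n) * trunc N (fps_nth (Omega_series s) n))"
    by (simp add: Q(3) umbral_def trunc_sum trunc_mult)
  also have "\<dots> = (\<Sum>n\<le>degree Q. mconst (1 - tt) * (\<Sum>k\<in>{s..N}. trunc N (coeff Q n) * trunc N (fps_nth (letter_series s k) n)))"
  proof (rule sum.cong[OF refl])
    fix n
    show "trunc N (coeff Q n) * trunc N (fps_nth (Omega_series s) n) =
      mconst (1 - tt) * (\<Sum>k\<in>{s..N}. trunc N (coeff Q n) * trunc N (fps_nth (letter_series s k) n))"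
    \<comment> \<open>The constant coefficient of \<Omega> is 1 and not a sum over letters.
      Divisibility of \<open>f\<close> by \<open>x_s\<close> enters here, through
      \<open>coeff Q 0 = 0\<close>.\<close>
    proof (cases "n = 0")
      case False
      have "trunc N (fps_nth (Omega_series s) n) = trunc N (trunc N (fps_nth (Omega_series s) n))"
        by (simp only: idem)
      also have "\<dots> = mconst (1 - tt) * (\<Sum>k\<in>{s..N}. trunc N (fps_nth (letter_series s k) n))"
        using False assms(5) by (simp only: trunc_Omega_series_letter trunc_mult trunc_sum trunc_mconst neq0_conv)
      finally show ?thesis by (simp only: sum_distrib_left[symmetric] mult.left_commute)
    qed (simp add: Q0)
  qed
  also have "\<dots> = mconst (1 - tt) * (\<Sum>k\<in>{s..N}. \<Sum>n\<le>degree Q. trunc N (coeff Q n) * trunc N (fps_nth (letter_series s k) n))"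
    unfolding sum_distrib_left[where r = "mconst (1 - tt)", symmetric] by (subst sum.swap) (rule refl)
  also have "\<dots> = mconst (1 - tt) * (\<Sum>k\<in>{s..N}. trunc N (F k))"
    by (intro arg_cong2[where f = "(*)"] refl sum.cong) (simp add: F trunc_sum trunc_mult)
  finally show ?thesis .
qed

section \<open>The series along the path\<close>

text \<open>The series attached to the point \<open>(x, y)\<close> of a path ending at \<open>(d, d)\<close>: the positions are
  \<open>x + 1, \<dots>, d\<close>, of which those up to \<open>y\<close> carry the letters \<open>1, \<dots>, y - x\<close>.\<close>

definition state :: "nat \<Rightarrow> nat \<Rightarrow> nat \<Rightarrow> (nat \<times> nat) set \<Rightarrow> (nat \<times> nat) set \<Rightarrow> qt mfps" where
  "state x y d E S = mconst ((1 - tt) ^ (d - y)) * (\<Prod>i\<in>{1..y - x}. mvar i) *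
     col_series {Suc y..d} (\<lambda>i. i - x) E S"

text \<open>By the last clause the fixed positions \<open>x + 1, ..., y\<close> form a clique. This
  keeps a position that is set free from taking the letter of another fixed position, and at
  \<open>x = 0\<close> it is what makes the flags force \<open>T(i) = i\<close>.\<close>

definition valid_state :: "nat \<Rightarrow> nat \<Rightarrow> nat \<Rightarrow> (nat \<times> nat) set \<Rightarrow> (nat \<times> nat) set \<Rightarrow> bool" where
  "valid_state x y d E S \<longleftrightarrow> x \<le> y \<and> y \<le> d \<and> dyck_graph E S \<and> (\<forall>(i, j)\<in>E \<union> S. x < i \<and> j \<le> d) \<and>
     (\<forall>i j. x < i \<longrightarrow> i < j \<longrightarrow> j \<le> y \<longrightarrow> (i, j) \<in> E)"

lemma valid_state_vertex:
  assumes "valid_state x y d E S" "i \<in> fst ` (E \<union> S) \<union> snd ` (E \<union> S)"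
  shows "x < i" "i \<le> d"
proof -
  from assms(2) obtain a b where ab: "(a, b) \<in> E \<union> S" "i = a \<or> i = b" by fastforce
  have "x < a \<and> b \<le> d" using assms(1) ab(1) unfolding valid_state_def by blast
  moreover have "a < b"
  proof (cases "(a, b) \<in> E")
    case True
    then show ?thesis using assms(1) unfolding valid_state_def dyck_graph_def by blast
  next
    case False
    then have "addable E (a, b)" using assms(1) ab(1) unfolding valid_state_def dyck_graph_def by blast
    then show ?thesis by (simp add: addable_def)
  qed
  ultimately show "x < i" "i \<le> d" using ab(2) by auto
qed

lemma bounded_degree_mmonom: "bounded_degree (mmonom \<eta>)"
  unfolding bounded_degree_def by (rule exI[of _ "total_degree \<eta>"]) (simp add: mcoeff_mmonom)

lemma bounded_degree_mconst: "bounded_degree (mconst c)"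
  unfolding bounded_degree_def by (rule exI[of _ 0]) (simp add: mcoeff_mconst)

lemma mcoeff_col_series_nonzeroE:
  assumes "mcoeff (col_series P f E S) \<alpha> \<noteq> 0"
  obtains c where "c \<in> P \<rightarrow>\<^sub>E {1..}" "(\<Sum>i\<in>P. single (c i) 1) = \<alpha>"
proof -
  have "(\<Sum>c | c \<in> P \<rightarrow>\<^sub>E {1..} \<and> (\<Sum>i\<in>P. single (c i) 1) = \<alpha>. col_wt E S (glue P c f)) \<noteq> 0"
    using assms by (simp only: mcoeff_col_series not_False_eq_True)
  then obtain c where "c \<in> {c. c \<in> P \<rightarrow>\<^sub>E {1..} \<and> (\<Sum>i\<in>P. single (c i) 1) = \<alpha>}"
    by (rule sum.not_neutral_contains_not_neutral)
  then show ?thesis using that by blast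
qed

lemma bounded_degree_col_series: "bounded_degree (col_series P f E S)"
  unfolding bounded_degree_def
proof (intro exI[of _ "card P"] allI impI)
  fix \<alpha> assume "mcoeff (col_series P f E S) \<alpha> \<noteq> 0"
  then obtain c where "(\<Sum>i\<in>P. single (c i) 1) = \<alpha>" by (rule mcoeff_col_series_nonzeroE)
  then show "total_degree \<alpha> \<le> card P" by (auto simp: total_degree_sum)
qed

lemma tail_symmetric_state:
  assumes v: "valid_state x y d E S"
  shows "tail_symmetric (y - x) (state x y d E S)"
  unfolding tail_symmetric_def
proof (intro conjI allI impI)
  have mon: "(\<Prod>i\<in>{1..y - x}. mvar i :: qt mfps) = mmonom (\<Sum>i\<in>{1..y - x}. single i 1)"
    by (simp add: mvar_def mmonom_sum)
  show "bounded_degree (state x y d E S)"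
    unfolding state_def mon
    by (intro bounded_degree_mult bounded_degree_mmonom bounded_degree_mconst bounded_degree_col_series)
  show "keys \<alpha> \<subseteq> {1..}" if "mcoeff (state x y d E S) \<alpha> \<noteq> 0" for \<alpha>
  proof -
    have "mcoeff (mmonom (\<Sum>i\<in>{1..y - x}. single i 1) * col_series {Suc y..d} (\<lambda>i. i - x) E S) \<alpha> \<noteq> 0"
      using that unfolding state_def mon mult.assoc by auto
    then obtain \<beta> \<gamma> where \<alpha>: "\<alpha> = \<beta> + \<gamma>" and \<beta>: "mcoeff (mmonom (\<Sum>i\<in>{1..y - x}. single i 1) :: qt mfps) \<beta> \<noteq> 0"
      and \<gamma>: "mcoeff (col_series {Suc y..d} (\<lambda>i. i - x) E S) \<gamma> \<noteq> 0" by (rule mcoeff_mult_nonzeroE)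
    have "\<beta> = (\<Sum>i\<in>{1..y - x}. single i 1)" using \<beta> by (simp add: mcoeff_mmonom split: if_splits)
    then have "keys \<beta> = (\<lambda>i. i) ` {1..y - x}" by (simp only: keys_sum_single[OF finite_atLeastAtMost])
    then have "keys \<beta> \<subseteq> {1..}" by auto
    moreover obtain c where c: "c \<in> {Suc y..d} \<rightarrow>\<^sub>E {1..}" "(\<Sum>i\<in>{Suc y..d}. single (c i) 1) = \<gamma>"
      using \<gamma> by (rule mcoeff_col_series_nonzeroE)
    have "keys \<gamma> = c ` {Suc y..d}" unfolding c(2)[symmetric] by (rule keys_sum_single) simp
    then have "keys \<gamma> \<subseteq> {1..}" using c(1) by auto
    ultimately show ?thesis by (simp add: \<alpha> keys_add_expo)
  qed
  show "adj k (state x y d E S) = state x y d E S" if k: "y - x < k" for k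
  proof -
    \<comment> \<open>The fixed letters are at most \<open>y - x\<close>, hence smaller than
      \<open>k\<close>.\<close>
    have a: "avoids {Suc y..d} 0 (\<lambda>i. i - x) (E \<union> S) k"
      unfolding avoids_def
    proof (intro ballI impI)
      fix i assume i: "i \<in> fst ` (E \<union> S) \<union> snd ` (E \<union> S)" "i \<notin> {Suc y..d}" "i \<noteq> 0"
      then have "i \<le> y" using valid_state_vertex[OF v i(1)] by auto
      then have "i - x \<le> y - x" by simp
      then show "i - x \<noteq> k \<and> i - x \<noteq> Suc k" using k by simp
    qed
    have z: "0 \<notin> fst ` (E \<union> S)"
    proof
      assume "0 \<in> fst ` (E \<union> S)"
      then show False using valid_state_vertex(1)[OF v, of 0] by simp
    qed
    have "adj k (col_series {Suc y..d} (\<lambda>i. i - x) E S) = col_series {Suc y..d} (\<lambda>i. i - x) E S"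
      using v k by (intro adj_col_series a z) (auto simp: valid_state_def)
    moreover have "adj k (\<Prod>i\<in>{1..y - x}. mvar i :: qt mfps) = (\<Prod>i\<in>{1..y - x}. mvar i)"
      unfolding mperm_prod[OF bij_transpose]
      by (rule prod.cong) (use k in \<open>auto simp: mperm_mvar transpose_def\<close>)
    ultimately show ?thesis by (simp add: state_def mperm_mult)
  qed
qed

lemma trunc_col_series_insert:
  assumes "finite P" "y \<notin> P"
  shows "trunc N (col_series (insert y P) f E S) = (\<Sum>k\<in>{1..N}. mvar k * trunc N (col_series P (f(y := k)) E S))"
proof -
  let ?h = "\<lambda>(k, c). (c :: nat \<Rightarrow> nat)(y := k)"
  have inj: "inj_on ?h ({1..N} \<times> (P \<rightarrow>\<^sub>E {1..N}))"
    using inj_combinator[OF assms(2), of "\<lambda>_. {1..N}"] by simp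
  have g: "glue (insert y P) (c(y := k)) f = glue P c (f(y := k))" for c k
    using assms(2) by (auto simp: glue_def fun_eq_iff)
  have p: "(\<Prod>i\<in>insert y P. mvar ((c(y := k)) i) :: qt mfps) = mvar k * (\<Prod>i\<in>P. mvar (c i))" for c k
    using assms by (auto intro!: arg_cong2[where f = "(*)"] prod.cong)
  have "trunc N (col_series (insert y P) f E S) = (\<Sum>kc\<in>{1..N} \<times> (P \<rightarrow>\<^sub>E {1..N}).
      mconst (col_wt E S (glue (insert y P) (?h kc) f)) * (\<Prod>i\<in>insert y P. mvar (?h kc i)))"
    unfolding trunc_col_series[OF finite.insertI[OF assms(1)]] PiE_insert_eq
    by (subst sum.reindex[OF inj]) simp
  also have "\<dots> = (\<Sum>(k, c)\<in>{1..N} \<times> (P \<rightarrow>\<^sub>E {1..N}).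
      mvar k * (mconst (col_wt E S (glue P c (f(y := k)))) * (\<Prod>i\<in>P. mvar (c i))))"
    unfolding case_prod_unfold g p by (rule sum.cong[OF refl]) (rule mult.left_commute)
  also have "\<dots> = (\<Sum>k\<in>{1..N}. mvar k * trunc N (col_series P (f(y := k)) E S))"
    unfolding trunc_col_series[OF assms(1)] sum_distrib_left by (rule sum.cartesian_product[symmetric])
  finally show ?thesis .
qed

lemma col_wt_eq_0:
  assumes "finite E" "(i, j) \<in> E" "c i = c j" shows "col_wt E S c = 0"
proof -
  have "(\<Prod>e\<in>E. edge_wt (c (fst e)) (c (snd e))) = 0"
    by (rule prod_zero[OF assms(1) bexI[OF _ assms(2)]]) (simp add: edge_wt_def assms(3))
  then show ?thesis by (simp add: col_wt_def)
qed

text \<open>\<open>trunc_d_minus\<close> sums over the letters \<open>k \<ge> s\<close> of the last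
  fixed position \<open>y\<close>. The smaller letters contribute nothing, so the position becomes
  free, and the factor \<open>1 - t\<close> raises the exponent \<open>d - y\<close> by one.\<close>

lemma d_minus_state:
  assumes v: "valid_state x y d E S" and xy: "x < y"
  shows "d_minus (y - x) (state x y d E S) = state x (y - 1) d E S"
proof (rule trunc_eqI[where M = "y - x"])
  fix N assume N: "y - x \<le> N"
  define s where "s = y - x"
  have s1: "1 \<le> s" using xy by (simp add: s_def)
  define P where "P = {Suc y..d}"
  define f where "f = (\<lambda>i. i - x)"
  define C where "C = mconst ((1 - tt) ^ (d - y)) * (\<Prod>i\<in>{1..<s}. mvar i)"
  \<comment> \<open>The state with letter \<open>k\<close> in place of \<open>s\<close> at position
    \<open>y\<close>; the other fixed letters are below \<open>s\<close>, so raising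
    \<open>k\<close> meets none of them.\<close>
  define F where "F k = C * (mvar k * col_series P (f(y := k)) E S)" for k
  have dg: "dyck_graph E S" and yd: "y \<le> d" using v by (auto simp: valid_state_def)
  have iv: "{1..s} = insert s {1..<s}" using s1 by auto
  have "f(y := s) = f" by (auto simp: f_def s_def)
  then have Fs: "F s = state x y d E S"
    unfolding F_def C_def state_def s_def[symmetric] iv P_def f_def by (simp add: mult_ac)
  have hk: "hecke k (F k) (F (Suc k))" if k: "s \<le> k" for k
    unfolding F_def
  proof (rule hecke_mult[OF hecke_if_hecke_letter])
    show "adj k C = C" unfolding C_def using k
      by (auto simp: mperm_mult mperm_prod mperm_mvar transpose_def intro!: arg_cong2[where f = "(*)"] prod.cong)
    show "hecke_letter k (col_series P (f(y := k)) E S) (col_series P (f(y := Suc k)) E S)"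
    proof (rule hecke_letter_col_series[OF dg])
      show "avoids P y f (E \<union> S) k" unfolding avoids_def
      proof (intro ballI impI)
        fix i assume i: "i \<in> fst ` (E \<union> S) \<union> snd ` (E \<union> S)" "i \<notin> P" "i \<noteq> y"
        then have "x < i" "i < y" using valid_state_vertex[OF v i(1)] by (auto simp: P_def)
        then show "f i \<noteq> k \<and> f i \<noteq> Suc k" using k by (auto simp: f_def s_def)
      qed
    qed (use s1 k in \<open>auto simp: P_def\<close>)
  qed
  have div: "mcoeff (state x y d E S) \<alpha> = 0" if \<alpha>: "lookup \<alpha> s = 0" for \<alpha>
  proof -
    have "state x y d E S = mvar s * (C * col_series P f E S)"
      unfolding C_def state_def s_def[symmetric] iv P_def f_def by (simp add: mult_ac)
    then show ?thesis using \<alpha> by (simp add: mcoeff_mvar_mult)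
  qed
  have "trunc N (d_minus s (state x y d E S)) = mconst (1 - tt) * (\<Sum>k\<in>{s..N}. trunc N (F k))"
    by (rule trunc_d_minus[OF _ div Fs hk]) (use tail_symmetric_state[OF v] N in \<open>auto simp: s_def\<close>)
  also have "\<dots> = mconst (1 - tt) * (trunc N C * (\<Sum>k\<in>{s..N}. mvar k * trunc N (col_series P (f(y := k)) E S)))"
    unfolding sum_distrib_left by (rule sum.cong[OF refl]) (simp add: F_def trunc_mult trunc_mvar)
  also have "(\<Sum>k\<in>{s..N}. mvar k * trunc N (col_series P (f(y := k)) E S)) =
      (\<Sum>k\<in>{1..N}. mvar k * trunc N (col_series P (f(y := k)) E S))"
  proof (rule sum.mono_neutral_left)
    show "\<forall>k\<in>{1..N} - {s..N}. mvar k * trunc N (col_series P (f(y := k)) E S) = 0"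
    proof
      fix k assume "k \<in> {1..N} - {s..N}"
      then have k: "1 \<le> k" "k < s" by auto
      \<comment> \<open>Position \<open>x + k\<close> already carries letter \<open>k\<close>, so an
        edge to \<open>y\<close> with the same letter has weight 0.\<close>
      have "(x + k, y) \<in> E" using v k by (auto simp: valid_state_def s_def)
      moreover have "finite E" using dg by (simp add: dyck_graph_def)
      moreover have "glue P c (f(y := k)) (x + k) = glue P c (f(y := k)) y" for c
        using k by (auto simp: glue_def f_def P_def s_def)
      ultimately have "col_wt E S (glue P c (f(y := k))) = 0" for c by (metis col_wt_eq_0)
      then have "col_series P (f(y := k)) E S = 0"
        by (intro mfps_eqI) (simp add: mcoeff_col_series)
      then show "mvar k * trunc N (col_series P (f(y := k)) E S) = 0" by simp
    qed
  qed (use s1 in auto)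
  also have "\<dots> = trunc N (col_series (insert y P) f E S)"
    by (rule trunc_col_series_insert[symmetric]) (auto simp: P_def)
  also have "mconst (1 - tt) * (trunc N C * \<dots>) = trunc N (mconst (1 - tt) * (C * col_series (insert y P) f E S))"
    by (simp add: trunc_mult)
  also have "mconst (1 - tt) * (C * col_series (insert y P) f E S) = state x (y - 1) d E S"
  proof -
    have 1: "{Suc (y - 1)..d} = insert y P" using xy yd by (auto simp: P_def)
    have 2: "{1..y - 1 - x} = {1..<s}" using s1 by (auto simp: s_def)
    have 3: "d - (y - 1) = Suc (d - y)" using xy yd by simp
    show ?thesis unfolding state_def 1 2 3 C_def f_def by (simp add: mconst_mult mult_ac)
  qed
  finally show "trunc N (d_minus (y - x) (state x y d E S)) = trunc N (state x (y - 1) d E S)"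
    by (simp only: s_def)
qed

lemma col_series_cong:
  assumes "\<And>c. col_wt E S (glue P c f) = col_wt E' S' (glue P c g)"
  shows "col_series P f E S = col_series P g E' S'"
  by (simp add: col_series_def assms)

lemma col_wt_cong:
  assumes "\<And>i. i \<in> fst ` (E \<union> S) \<union> snd ` (E \<union> S) \<Longrightarrow> c i = c' i"
  shows "col_wt E S c = col_wt E S c'"
  unfolding col_wt_def by (intro arg_cong2[where f = "(*)"] prod.cong refl) (simp_all add: assms)

text \<open>Each \<open>TT k\<close> trades \<open>x_{k+1} G_{k+1}\<close> for
  \<open>x_k G_k\<close> by \<open>TT_hecke\<close>; the operator with the largest index acts
  first.\<close>

lemma foldr_TT_chain:
  assumes "\<And>k. m < k \<Longrightarrow> k \<le> s \<Longrightarrow> hecke k (G (Suc k)) (G k)" "m \<le> s"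
  shows "foldr TT [Suc m..<Suc s] (mvar (Suc s) * G (Suc s)) = mvar (Suc m) * G (Suc m)"
  using assms(2,1)
proof (induct m rule: inc_induct)
  case (step m)
  have "[Suc m..<Suc s] = Suc m # [Suc (Suc m)..<Suc s]" using step.hyps(2) by (intro upt_conv_Cons) simp
  moreover have "foldr TT [Suc (Suc m)..<Suc s] (mvar (Suc s) * G (Suc s)) = mvar (Suc (Suc m)) * G (Suc (Suc m))"
    by (rule step.hyps(3)) (rule step.prems, simp_all)
  ultimately have "foldr TT [Suc m..<Suc s] (mvar (Suc s) * G (Suc s)) = TT (Suc m) (mvar (Suc (Suc m)) * G (Suc (Suc m)))"
    by (simp only: foldr_Cons comp_apply)
  also have "\<dots> = mvar (Suc m) * G (Suc m)" using step.hyps(2) by (intro TT_hecke step.prems) simp_all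
  finally show ?case .
qed simp

text \<open>The fixed letters \<open>s, ..., 1\<close> are raised in this order, each into the gap
  left by the one before. The gap moves from \<open>s + 1\<close> down to 1, and the new position
  \<open>x\<close> takes it.\<close>

lemma d_plus_state:
  assumes v: "valid_state x y d E S" and x: "1 \<le> x"
  shows "- d_plus (y - x) (state x y d E S) = state (x - 1) y d (E \<union> Pair x ` {x<..y}) S"
proof -
  define s where "s = y - x"
  define P where "P = {Suc y..d}"
  \<comment> \<open>The fixed letters with \<open>k\<close> omitted: passing from
    \<open>h (Suc k)\<close> to \<open>h k\<close> changes only position \<open>x + k\<close>, from
    letter \<open>k\<close> to \<open>k + 1\<close>.\<close>
  define h where "h k i = (if i - x < k then i - x else Suc (i - x))" for k i
  define C where "C = mconst ((1 - tt) ^ (d - y))"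
  define G where "G k = C * (\<Prod>i\<in>{1..Suc s} - {k}. mvar i) * col_series P (h k) E S" for k
  have dg: "dyck_graph E S" and xy: "x \<le> y" using v by (auto simp: valid_state_def)
  have vtx: "x < i" "i \<le> y \<or> i \<in> P" if "i \<in> fst ` (E \<union> S) \<union> snd ` (E \<union> S)" for i
    using valid_state_vertex[OF v that] by (auto simp: P_def)
  have hk: "hecke k (G (Suc k)) (G k)" if k: "0 < k" "k \<le> s" for k
  proof -
    let ?M = "\<Prod>i\<in>{1..Suc s} - {k, Suc k}. mvar i :: qt mfps"
    have "{1..Suc s} - {Suc k} - {k} = {1..Suc s} - {k, Suc k}"
      "{1..Suc s} - {k} - {Suc k} = {1..Suc s} - {k, Suc k}" by auto
    then have M: "(\<Prod>i\<in>{1..Suc s} - {Suc k}. mvar i) = mvar k * ?M"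
      "(\<Prod>i\<in>{1..Suc s} - {k}. mvar i) = mvar (Suc k) * ?M"
      using k prod.remove[of "{1..Suc s} - {Suc k}" k "mvar :: nat \<Rightarrow> qt mfps"]
        prod.remove[of "{1..Suc s} - {k}" "Suc k" "mvar :: nat \<Rightarrow> qt mfps"]
      by (simp_all only: Diff_iff atLeastAtMost_iff finite_Diff finite_atLeastAtMost) auto
    have h: "h (Suc k) = (h (Suc k))(x + k := k)" "h k = (h (Suc k))(x + k := Suc k)"
      using k by (auto simp: h_def fun_eq_iff)
    have "hecke k (C * ?M * (mvar k * col_series P ((h (Suc k))(x + k := k)) E S))
        (C * ?M * (mvar (Suc k) * col_series P ((h (Suc k))(x + k := Suc k)) E S))"
    proof (rule hecke_mult[OF hecke_if_hecke_letter])
      show "adj k (C * ?M) = C * ?M" unfolding C_def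
        by (auto simp: mperm_mult mperm_prod mperm_mvar transpose_def intro!: arg_cong2[where f = "(*)"] prod.cong)
      show "hecke_letter k (col_series P ((h (Suc k))(x + k := k)) E S)
          (col_series P ((h (Suc k))(x + k := Suc k)) E S)"
      proof (rule hecke_letter_col_series[OF dg])
        show "avoids P (x + k) (h (Suc k)) (E \<union> S) k" unfolding avoids_def
        proof (intro ballI impI)
          fix i assume i: "i \<in> fst ` (E \<union> S) \<union> snd ` (E \<union> S)" "i \<noteq> x + k"
          then show "h (Suc k) i \<noteq> k \<and> h (Suc k) i \<noteq> Suc k"
            using vtx(1)[OF i(1)] by (auto simp: h_def)
        qed
      qed (use k in \<open>auto simp: P_def s_def\<close>)
    qed
    then show ?thesis unfolding G_def M h(1)[symmetric] h(2)[symmetric] by (simp only: mult_ac)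
  qed
  have e: "{1..Suc s} - {Suc s} = {1..s}" by auto
  have e2: "(\<Prod>i\<in>{1..Suc s}. mvar i) = mvar 1 * (\<Prod>i\<in>{1..Suc s} - {1}. mvar i :: qt mfps)"
    by (rule prod.remove) auto
  have "col_series P (\<lambda>i. i - x) E S = col_series P (h (Suc s)) E S"
  proof (rule col_series_cong, rule col_wt_cong)
    fix c :: "nat \<Rightarrow> nat" and i assume "i \<in> fst ` (E \<union> S) \<union> snd ` (E \<union> S)"
    then show "glue P c (\<lambda>i. i - x) i = glue P c (h (Suc s)) i"
      using vtx[of i] by (auto simp: glue_def h_def s_def)
  qed
  then have Gs: "state x y d E S = G (Suc s)"
    unfolding state_def G_def e s_def[symmetric] P_def[symmetric] C_def[symmetric] by simp
  have "- d_plus s (state x y d E S) = foldr TT [Suc 0..<Suc s] (mvar (Suc s) * G (Suc s))"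
    by (simp add: d_plus_def Gs del: upt_Suc)
  also have "\<dots> = mvar 1 * G 1" unfolding One_nat_def by (rule foldr_TT_chain, rule hk, assumption+, rule le0)
  also have "\<dots> = C * (\<Prod>i\<in>{1..Suc s}. mvar i) * col_series P (h 1) E S"
    by (simp only: G_def e2 mult_ac)
  also have "col_series P (h 1) E S = col_series P (\<lambda>i. i - (x - 1)) (E \<union> Pair x ` {x<..y}) S"
  proof (rule col_series_cong)
    fix c
    let ?g = "glue P c (\<lambda>i. i - (x - 1))"
    have "col_wt E S (glue P c (h 1)) = col_wt E S ?g"
    proof (rule col_wt_cong)
      fix i assume "i \<in> fst ` (E \<union> S) \<union> snd ` (E \<union> S)"
      then show "glue P c (h 1) i = ?g i" using vtx(1)[of i] x by (auto simp: glue_def h_def)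
    qed
    also have "\<dots> = col_wt (E \<union> Pair x ` {x<..y}) S ?g"
    proof -
      have "finite E" using dg by (simp add: dyck_graph_def)
      moreover have "E \<inter> Pair x ` {x<..y} = {}" using v by (auto simp: valid_state_def)
      ultimately have "(\<Prod>e\<in>E \<union> Pair x ` {x<..y}. edge_wt (?g (fst e)) (?g (snd e))) =
          (\<Prod>e\<in>E. edge_wt (?g (fst e)) (?g (snd e))) * (\<Prod>e\<in>Pair x ` {x<..y}. edge_wt (?g (fst e)) (?g (snd e)))"
        by (intro prod.union_disjoint) auto
      \<comment> \<open>The left end of each new edge has letter 1 and the right end a larger one,
        so there is no descent.\<close>
      also have "(\<Prod>e\<in>Pair x ` {x<..y}. edge_wt (?g (fst e)) (?g (snd e))) = 1"
        by (rule prod.neutral) (use x xy in \<open>auto simp: glue_def P_def edge_wt_def\<close>)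
      finally show ?thesis by (simp add: col_wt_def)
    qed
    finally show "col_wt E S (glue P c (h 1)) = col_wt (E \<union> Pair x ` {x<..y}) S ?g" .
  qed
  also have "C * (\<Prod>i\<in>{1..Suc s}. mvar i) * \<dots> = state (x - 1) y d (E \<union> Pair x ` {x<..y}) S"
  proof -
    have "Suc s = y - (x - 1)" using x xy by (simp add: s_def)
    then show ?thesis by (simp add: state_def C_def P_def)
  qed
  finally show ?thesis by (simp only: s_def)
qed

section \<open>Validity along the steps of the path\<close>

lemma valid_state_north: "valid_state x y d E S \<Longrightarrow> x < y \<Longrightarrow> valid_state x (y - 1) d E S"
  by (auto simp: valid_state_def)

lemma valid_state_east:
  assumes "valid_state x y d E S" "1 \<le> x"
  shows "valid_state (x - 1) y d (E \<union> Pair x ` {x<..y}) S"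
proof -
  let ?E = "E \<union> Pair x ` {x<..y}"
  have E: "dyck_graph E S" "x \<le> y" "y \<le> d" "\<And>i j. (i, j) \<in> E \<union> S \<Longrightarrow> x < i \<and> j \<le> d"
    "\<And>i j. x < i \<Longrightarrow> i < j \<Longrightarrow> j \<le> y \<Longrightarrow> (i, j) \<in> E"
    using assms(1) unfolding valid_state_def by blast+
  have "interval_closed ?E"
    unfolding interval_closed_def
  proof (intro allI impI)
    fix i j i' j' assume ij: "(i, j) \<in> ?E" and le: "i \<le> i'" "i' < j'" "j' \<le> j"
    show "(i', j') \<in> ?E"
    proof (cases "(i, j) \<in> E")
      case True
      then have "(i', j') \<in> E" using E(1) le unfolding dyck_graph_def interval_closed_def by blast
      then show ?thesis by simp
    next
      case False
      then have "i = x" "j \<le> y" using ij by auto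
      then show ?thesis using E(5)[of i' j'] le by (cases "i' = x") auto
    qed
  qed
  moreover have "\<forall>m\<in>S. addable ?E m" using E(1) unfolding dyck_graph_def addable_def by blast
  moreover have "?E \<inter> S = {}" using E(1,4) unfolding dyck_graph_def by fastforce
  moreover have "finite ?E" "finite S" "\<forall>(i, j)\<in>?E. i < j" using E(1) unfolding dyck_graph_def by auto
  ultimately have "dyck_graph ?E S" unfolding dyck_graph_def by blast
  moreover have "\<forall>(i, j)\<in>?E \<union> S. x - 1 < i \<and> j \<le> d" using E(3,4) assms(2) by fastforce
  moreover have "(i, j) \<in> ?E" if "x - 1 < i" "i < j" "j \<le> y" for i j
    using E(5)[of i j] that assms(2) by (cases "i = x") auto
  ultimately show ?thesis using E(2,3) unfolding valid_state_def by auto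
qed

text \<open>The column added at height \<open>y - 1\<close> stops just below the box
  \<open>(x, y)\<close>, so all proper subintervals of this pair are edges and it qualifies as a
  mark.\<close>

lemma valid_state_corner:
  assumes "valid_state x y d E S" "1 \<le> x" "x < y"
  shows "valid_state (x - 1) (y - 1) d (E \<union> Pair x ` {x<..y - 1}) (insert (x, y) S)"
proof -
  let ?E = "E \<union> Pair x ` {x<..y - 1}"
  have v: "valid_state (x - 1) (y - 1) d ?E S"
    by (rule valid_state_east[OF valid_state_north[OF assms(1,3)] assms(2)])
  have E: "y \<le> d" "\<And>i j. (i, j) \<in> E \<union> S \<Longrightarrow> x < i \<and> j \<le> d"
    "\<And>i j. x < i \<Longrightarrow> i < j \<Longrightarrow> j \<le> y \<Longrightarrow> (i, j) \<in> E"
    using assms(1) unfolding valid_state_def by blast+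
  have "addable ?E (x, y)"
    unfolding addable_def fst_conv snd_conv
  proof (intro conjI allI impI)
    fix i j assume "x \<le> i" "i < j" "j \<le> y"
    then show "(i, j) = (x, y) \<or> (i, j) \<in> ?E" using E(3)[of i j] by (cases "i = x"; cases "j = y") auto
  qed (rule assms(3))
  moreover have "(x, y) \<notin> ?E" using E(2)[of x y] assms(3) by auto
  ultimately show ?thesis using v E(1) assms(2) unfolding valid_state_def dyck_graph_def by auto
qed

text \<open>Both composites lead to the same point. With the east operator applied first, the new
  column reaches height \<open>y\<close> and contains the corner box; with the north operator first,
  it stops at \<open>y - 1\<close>. The scaled difference is the mark.\<close>

lemma corner_op_state:
  assumes v: "valid_state x y d E S" and x: "1 \<le> x" and xy: "x < y"
  shows "corner_op (y - x) (state x y d E S) =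
    state (x - 1) (y - 1) d (E \<union> Pair x ` {x<..y - 1}) (insert (x, y) S)"
proof -
  let ?E1 = "E \<union> Pair x ` {x<..y}" and ?E2 = "E \<union> Pair x ` {x<..y - 1}"
  let ?P = "{Suc (y - 1)..d}" and ?f = "\<lambda>i. i - (x - 1)"
  have 1: "d_minus (Suc (y - x)) (- d_plus (y - x) (state x y d E S)) = state (x - 1) (y - 1) d ?E1 S"
  proof -
    have "Suc (y - x) = y - (x - 1)" using x xy by simp
    then show ?thesis
      using d_minus_state[OF valid_state_east[OF v x]] x xy by (simp add: d_plus_state[OF v x])
  qed
  have 2: "- d_plus (y - x - 1) (d_minus (y - x) (state x y d E S)) = state (x - 1) (y - 1) d ?E2 S"
  proof -
    have "y - x - 1 = y - 1 - x" by simp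
    then show ?thesis
      using d_plus_state[OF valid_state_north[OF v xy] x] by (simp only: d_minus_state[OF v xy])
  qed
  have "{x<..y} = insert y {x<..y - 1}" using xy by auto
  then have E1: "?E1 = insert (x, y) ?E2" by simp
  have m: "(x, y) \<notin> ?E2" "(x, y) \<notin> S" using v xy by (auto simp: valid_state_def)
  have fin: "finite ?E2" "finite S" using v by (auto simp: valid_state_def dyck_graph_def)
  show ?thesis
    unfolding corner_op_def 1 2 unfolding state_def E1 col_series_insert_mark[OF fin m]
    by (simp only: right_diff_distrib mult_ac)
qed

section \<open>The sum over signs\<close>

text \<open>A violated mark gives weight 0 instead of excluding the word. The words summed over are
  then the same for every marking, and the weight obeys the difference rule of
  \<open>col_wt\<close>.\<close>

definition word_wt :: "nat \<Rightarrow> (nat \<times> nat) set \<Rightarrow> (nat \<times> nat) set \<Rightarrow> (nat \<Rightarrow> letter) \<Rightarrow> qt" where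
  "word_wt d E S T = (\<Prod>e\<in>E. if row_increasing (T (snd e)) (T (fst e)) then tt else 1) *
     (\<Prod>e\<in>S. if row_increasing (T (snd e)) (T (fst e)) then 1 else 0) * (- tt) ^ neg_count d T"

definition lifts :: "nat \<Rightarrow> (nat \<Rightarrow> nat) \<Rightarrow> nat \<Rightarrow> letter set" where
  "lifts r c j = {l \<in> {Pos (c j), Neg (c j)}. j \<le> r \<longrightarrow> l \<le> Pos j}"

lemma row_increasing_iff:
  "row_increasing a b \<longleftrightarrow> absl a < absl b \<or> absl a = absl b \<and> \<not> is_neg a"
  by (cases a; cases b) (auto simp: row_increasing_def less_letter_def)

lemma Pos_le_Pos: "Pos v \<le> Pos j \<longleftrightarrow> v \<le> j" and Neg_le_Pos: "Neg v \<le> Pos j \<longleftrightarrow> v < j"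
  by (auto simp: less_eq_letter_def less_letter_def)

text \<open>Whether \<open>T(j) T(i)\<close> is row-increasing depends on the two absolute values
  and the sign of \<open>T(j)\<close>, not on the sign of \<open>T(i)\<close>. Each edge can
  therefore be charged to its right end, and for given absolute values the weight is a product over
  positions.\<close>

definition sign_factor :: "(nat \<times> nat) set \<Rightarrow> (nat \<Rightarrow> nat) \<Rightarrow> nat \<Rightarrow> letter \<Rightarrow> qt" where
  "sign_factor E c j l = (if is_neg l then - tt else 1) *
     (\<Prod>i\<in>{i. (i, j) \<in> E}. if c j < c i \<or> c j = c i \<and> \<not> is_neg l then tt else 1)"

lemma prod_pairs_by_snd:
  assumes "finite E" "\<And>i j. (i, j) \<in> E \<Longrightarrow> j \<in> J" "finite J"
  shows "(\<Prod>e\<in>E. G (fst e) (snd e)) = (\<Prod>j\<in>J. \<Prod>i\<in>{i. (i, j) \<in> E}. G i j)"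
proof -
  have fin: "finite {i. (i, j) \<in> E}" for j
    by (rule finite_subset[of _ "fst ` E"]) (use assms(1) in force)+
  have "(\<Prod>j\<in>J. \<Prod>i\<in>{i. (i, j) \<in> E}. G i j) = (\<Prod>(j, i)\<in>(SIGMA j:J. {i. (i, j) \<in> E}). G i j)"
    by (rule prod.Sigma) (use assms fin in auto)
  also have "\<dots> = (\<Prod>e\<in>E. G (fst e) (snd e))"
    by (rule prod.reindex_bij_witness[of _ prod.swap prod.swap]) (use assms(2) in auto)
  finally show ?thesis by simp
qed

lemma word_wt_unmarked:
  assumes "finite E" "\<And>i j. (i, j) \<in> E \<Longrightarrow> i \<in> {1..d} \<and> j \<in> {1..d}" "\<And>j. j \<in> {1..d} \<Longrightarrow> absl (T j) = c j"
  shows "word_wt d E {} T = (\<Prod>j\<in>{1..d}. sign_factor E c j (T j))"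
proof -
  have "(- tt) ^ neg_count d T = (\<Prod>j\<in>{1..d}. if is_neg (T j) then - tt else 1)"
    unfolding neg_count_def by (simp add: prod.inter_filter[symmetric])
  moreover have "(\<Prod>e\<in>E. if row_increasing (T (snd e)) (T (fst e)) then tt else 1) =
      (\<Prod>j\<in>{1..d}. \<Prod>i\<in>{i. (i, j) \<in> E}. if row_increasing (T j) (T i) then tt else 1)"
    by (rule prod_pairs_by_snd[OF assms(1)]) (use assms(2) in auto)
  moreover have "(\<Prod>j\<in>{1..d}. \<Prod>i\<in>{i. (i, j) \<in> E}. if row_increasing (T j) (T i) then tt else 1) =
      (\<Prod>j\<in>{1..d}. \<Prod>i\<in>{i. (i, j) \<in> E}. if c j < c i \<or> c j = c i \<and> \<not> is_neg (T j) then tt else 1)"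
    by (intro prod.cong refl) (use assms(2,3) in \<open>auto simp: row_increasing_iff\<close>)
  ultimately show ?thesis
    by (simp add: word_wt_def sign_factor_def prod.distrib)
qed

lemma sum_word_wt_unmarked:
  assumes "finite E" "\<And>i j. (i, j) \<in> E \<Longrightarrow> i \<in> {1..d} \<and> j \<in> {1..d}"
  shows "(\<Sum>T\<in>PiE {1..d} (lifts r c). word_wt d E {} T) = (\<Prod>j\<in>{1..d}. \<Sum>l\<in>lifts r c j. sign_factor E c j l)"
proof -
  have "(\<Sum>T\<in>PiE {1..d} (lifts r c). word_wt d E {} T) =
      (\<Sum>T\<in>PiE {1..d} (lifts r c). \<Prod>j\<in>{1..d}. sign_factor E c j (T j))"
  proof (rule sum.cong[OF refl])
    fix T assume T: "T \<in> PiE {1..d} (lifts r c)"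
    have t: "absl (T j) = c j" if "j \<in> {1..d}" for j
      using PiE_mem[OF T that] by (auto simp: lifts_def)
    show "word_wt d E {} T = (\<Prod>j\<in>{1..d}. sign_factor E c j (T j))"
      by (rule word_wt_unmarked[OF assms t])
  qed
  also have "\<dots> = (\<Prod>j\<in>{1..d}. \<Sum>l\<in>lifts r c j. sign_factor E c j l)"
    by (rule prod_sum_PiE[symmetric]) (simp_all add: lifts_def)
  finally show ?thesis .
qed

lemma sign_factor_simps:
  fixes E :: "(nat \<times> nat) set" and c :: "nat \<Rightarrow> nat"
  assumes "finite E"
  defines "a \<equiv> \<lambda>j. \<Prod>i\<in>{i. (i, j) \<in> E}. if c j < c i then tt else 1"
  shows "sign_factor E c j (Pos v) = a j * tt ^ card {i. (i, j) \<in> E \<and> c j = c i}"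
    and "sign_factor E c j (Neg v) = - tt * a j"
proof -
  have fin: "finite {i. (i, j) \<in> E}"
    by (rule finite_subset[of _ "fst ` E"]) (use assms(1) in force)+
  have "(\<Prod>i\<in>{i. (i, j) \<in> E}. if c j < c i \<or> c j = c i then tt else 1) =
      (\<Prod>i\<in>{i. (i, j) \<in> E}. (if c j < c i then tt else 1) * (if c j = c i then tt else 1))"
    by (rule prod.cong) auto
  also have "\<dots> = a j * (\<Prod>i\<in>{i\<in>{i. (i, j) \<in> E}. c j = c i}. tt)"
    unfolding prod.distrib a_def prod.inter_filter[OF fin] ..
  finally show "sign_factor E c j (Pos v) = a j * tt ^ card {i. (i, j) \<in> E \<and> c j = c i}"
    by (simp add: sign_factor_def)
qed (simp add: sign_factor_def a_def)

text \<open>Toggling the sign at the first position that repeats the letter of a smaller neighbour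
  shows that only proper colourings survive the sum over signs.\<close>

lemma sum_signs_unmarked:
  assumes E: "dyck_graph E {}" "\<And>i j. (i, j) \<in> E \<Longrightarrow> i \<in> {1..d} \<and> j \<in> {1..d}"
    and clique: "\<And>i j. 1 \<le> i \<Longrightarrow> i < j \<Longrightarrow> j \<le> r \<Longrightarrow> (i, j) \<in> E"
    and rd: "r \<le> d" and c: "\<And>j. j \<in> {1..d} \<Longrightarrow> 1 \<le> c j"
  shows "(\<Sum>T\<in>PiE {1..d} (lifts r c). word_wt d E {} T) =
    (if \<forall>i\<in>{1..r}. c i = i then (1 - tt) ^ (d - r) * col_wt E {} c else 0)"
proof -
  have fin: "finite E" and lt: "\<And>i j. (i, j) \<in> E \<Longrightarrow> i < j"
    and closed: "\<And>i j i' j'. (i, j) \<in> E \<Longrightarrow> i \<le> i' \<Longrightarrow> i' < j' \<Longrightarrow> j' \<le> j \<Longrightarrow> (i', j') \<in> E"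
    using E(1) unfolding dyck_graph_def interval_closed_def by blast+
  define a where "a j = (\<Prod>i\<in>{i. (i, j) \<in> E}. if c j < c i then tt else 1)" for j
  define n where "n j = card {i. (i, j) \<in> E \<and> c j = c i}" for j
  have sf: "sign_factor E c j (Pos v) = a j * tt ^ n j" "sign_factor E c j (Neg v) = - tt * a j" for j v
    using sign_factor_simps[OF fin, of c j v] by (simp_all add: a_def n_def)
  \<comment> \<open>With \<open>n j\<close> equal neighbours to the left, the two signs give
    \<open>t^n\<close> and \<open>-t\<close>: they cancel for \<open>n j = 1\<close> and leave
    \<open>1 - t\<close> for \<open>n j = 0\<close>.\<close>
  have both: "(\<Sum>l\<in>lifts r c j. sign_factor E c j l) = a j * tt ^ n j - tt * a j"
    if "j \<le> r \<longrightarrow> c j < j" for j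
  proof -
    have "lifts r c j = {Pos (c j), Neg (c j)}"
      using that by (auto simp: lifts_def Pos_le_Pos Neg_le_Pos)
    then show ?thesis by (simp add: sf)
  qed
  have S: "(\<Sum>T\<in>PiE {1..d} (lifts r c). word_wt d E {} T) =
      (\<Prod>j\<in>{1..d}. \<Sum>l\<in>lifts r c j. sign_factor E c j l)"
    by (rule sum_word_wt_unmarked[OF fin E(2)])
  consider (proper) "\<forall>i\<in>{1..r}. c i = i" "\<forall>(i, j)\<in>E. c j \<noteq> c i"
    | (large) j where "j \<in> {1..r}" "j < c j"
    | (rest) "\<forall>j\<in>{1..r}. c j \<le> j" "(\<forall>i\<in>{1..r}. c i = i) \<longrightarrow> (\<exists>i j. (i, j) \<in> E \<and> c j = c i)"
  proof (cases "\<exists>j\<in>{1..r}. j < c j")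
    case True
    then show ?thesis using large by blast
  next
    case False
    then have le: "\<forall>j\<in>{1..r}. c j \<le> j" by (simp add: not_less)
    show ?thesis
    proof (cases "(\<forall>i\<in>{1..r}. c i = i) \<and> (\<forall>(i, j)\<in>E. c j \<noteq> c i)")
      case True
      then show ?thesis using proper by blast
    next
      case False
      then show ?thesis using rest[OF le] by blast
    qed
  qed
  then show ?thesis
  proof cases
    case proper
    have n0: "n j = 0" for j
    proof -
      have "{i. (i, j) \<in> E \<and> c j = c i} = {}" using proper(2) by auto
      then show ?thesis by (simp only: n_def card.empty)
    qed
    have "(\<Sum>l\<in>lifts r c j. sign_factor E c j l) = (if j \<in> {Suc r..d} then 1 - tt else 1) * a j"
      if "j \<in> {1..d}" for j
    proof (cases "j \<le> r")
      case True
      then have "c j = j" using proper(1) that by simp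
      \<comment> \<open>The flag at \<open>j\<close> excludes the negative letter of value
        \<open>j\<close>, so a fixed position contributes no factor \<open>1 - t\<close>.\<close>
      then have "lifts r c j = {Pos (c j)}" using True by (auto simp: lifts_def Pos_le_Pos Neg_le_Pos)
      then show ?thesis using True by (simp add: sf n0)
    next
      case False
      then show ?thesis using that by (simp add: both n0 algebra_simps)
    qed
    then have "(\<Sum>T\<in>PiE {1..d} (lifts r c). word_wt d E {} T) =
        (\<Prod>j\<in>{1..d}. if j \<in> {Suc r..d} then 1 - tt else 1) * (\<Prod>j\<in>{1..d}. a j)"
      unfolding S prod.distrib[symmetric] by (intro prod.cong) auto
    also have "(\<Prod>j\<in>{1..d}. if j \<in> {Suc r..d} then 1 - tt else 1) = (1 - tt) ^ (d - r)"
    proof -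
      have "{j\<in>{1..d}. j \<in> {Suc r..d}} = {Suc r..d}" by auto
      then show ?thesis using prod.inter_filter[of "{1..d}" "\<lambda>_. 1 - tt" "\<lambda>j. j \<in> {Suc r..d}"] by simp
    qed
    also have "(\<Prod>j\<in>{1..d}. a j) = col_wt E {} c"
    proof -
      have "(\<Prod>e\<in>E. edge_wt (c (fst e)) (c (snd e))) = (\<Prod>j\<in>{1..d}. \<Prod>i\<in>{i. (i, j) \<in> E}. edge_wt (c i) (c j))"
        by (rule prod_pairs_by_snd[OF fin]) (use E(2) in auto)
      also have "\<dots> = (\<Prod>j\<in>{1..d}. a j)"
        unfolding a_def by (intro prod.cong refl) (use proper(2) in \<open>auto simp: edge_wt_def\<close>)
      finally show ?thesis by (simp add: col_wt_def)
    qed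
    finally show ?thesis using proper(1) by simp
  next
    case large
    then have "lifts r c j = {}" by (auto simp: lifts_def Pos_le_Pos Neg_le_Pos)
    then have "(\<Prod>j\<in>{1..d}. \<Sum>l\<in>lifts r c j. sign_factor E c j l) = 0"
      using large(1) rd by (intro prod_zero bexI[of _ j]) auto
    moreover have "\<not> (\<forall>i\<in>{1..r}. c i = i)" using large by force
    ultimately show ?thesis unfolding S by (simp only: if_False)
  next
    case rest
    have "\<exists>j i. (i, j) \<in> E \<and> c j = c i"
    proof (cases "\<forall>i\<in>{1..r}. c i = i")
      case True
      then show ?thesis using rest(2) by blast
    next
      case False
      \<comment> \<open>By the flags the first deviating letter is smaller than its position, hence
        equals the letter of position \<open>c j\<close>, which is adjacent to \<open>j\<close> in
        the clique.\<close>
      define j where "j = (LEAST j. j \<in> {1..r} \<and> c j \<noteq> j)"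
      have "\<exists>j. j \<in> {1..r} \<and> c j \<noteq> j" using False by blast
      then have j: "j \<in> {1..r}" "c j \<noteq> j" unfolding j_def by (rule LeastI2_ex, simp)+
      have min: "c i = i" if "i \<in> {1..r}" "i < j" for i
        using not_less_Least[of i "\<lambda>j. j \<in> {1..r} \<and> c j \<noteq> j"] that unfolding j_def by blast
      have "c j \<le> j" using rest(1) j(1) by blast
      moreover have "1 \<le> c j" using c[of j] j(1) rd by simp
      ultimately have "c j < j" "1 \<le> c j" using j(2) by simp_all
      then have "c (c j) = c j" "(c j, j) \<in> E" using min[of "c j"] clique[of "c j" j] j by auto
      then show ?thesis by metis
    qed
    then have ex: "\<exists>j. \<exists>i. (i, j) \<in> E \<and> c j = c i" .
    define j where "j = (LEAST j. \<exists>i. (i, j) \<in> E \<and> c j = c i)"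
    obtain i where i: "(i, j) \<in> E" "c j = c i" using LeastI_ex[OF ex] unfolding j_def by blast
    have min: "c j' \<noteq> c i'" if "(i', j') \<in> E" "j' < j" for i' j'
      using not_less_Least[of j' "\<lambda>j. \<exists>i. (i, j) \<in> E \<and> c j = c i"] that unfolding j_def by blast
    have jd: "j \<in> {1..d}" "i \<in> {1..d}" using E(2)[OF i(1)] by auto
    \<comment> \<open>Two left neighbours of \<open>j\<close> are adjacent to each other by interval
      closure. If both had the letter of \<open>j\<close>, the later one would be a repetition
      before \<open>j\<close>.\<close>
    have "{i'. (i', j) \<in> E \<and> c j = c i'} = {i}"
    proof (intro equalityI subsetI)
      fix i' assume "i' \<in> {i'. (i', j) \<in> E \<and> c j = c i'}"
      then have i': "(i', j) \<in> E" "c j = c i'" by auto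
      show "i' \<in> {i}"
      proof (cases i i' rule: linorder_cases)
        case less
        then have "(i, i') \<in> E" using closed[OF i(1), of i i'] lt[OF i'(1)] by simp
        then show ?thesis using min[of i i'] lt[OF i'(1)] i(2) i'(2) by simp
      next
        case greater
        then have "(i', i) \<in> E" using closed[OF i'(1), of i' i] lt[OF i(1)] by simp
        then show ?thesis using min[of i' i] lt[OF i(1)] i(2) i'(2) by simp
      qed simp
    qed (use i in simp)
    then have n1: "n j = 1" by (simp add: n_def)
    \<comment> \<open>The repeated letter obeys the flag at the smaller position \<open>i\<close>,
      so the flag at \<open>j\<close> admits both signs and the cancellation applies.\<close>
    have "c j < j" if "j \<le> r"
    proof -
      have "c j \<le> j" "c i \<le> i" using rest(1) that jd lt[OF i(1)] by auto
      then show ?thesis using i(2) lt[OF i(1)] by simp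
    qed
    then have "(\<Sum>l\<in>lifts r c j. sign_factor E c j l) = 0" using both[of j] n1 by simp
    then have "(\<Prod>j\<in>{1..d}. \<Sum>l\<in>lifts r c j. sign_factor E c j l) = 0"
      using jd(1) by (intro prod_zero bexI[of _ j]) auto
    moreover have "col_wt E {} c = 0" by (rule col_wt_eq_0[OF fin i(1) i(2)[symmetric]])
    ultimately show ?thesis unfolding S by (simp only: mult_zero_right if_cancel)
  qed
qed

lemma valid_state_insertD:
  assumes "valid_state x y d E (insert m S)" "m \<notin> S"
  shows "valid_state x y d E S" "valid_state x y d (insert m E) S" "m \<notin> E" "finite E" "finite S"
proof -
  have "dyck_graph E (insert m S)" using assms(1) by (simp add: valid_state_def)
  note D = dyck_graph_insertD[OF this assms(2)]
  show "m \<notin> E" "finite E" "finite S" by (rule D)+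
  show "valid_state x y d E S" "valid_state x y d (insert m E) S"
    using assms(1) D(1,2) unfolding valid_state_def by auto
qed

lemma word_wt_insert_mark:
  assumes "finite E" "finite S" "m \<notin> E" "m \<notin> S"
  shows "word_wt d E (insert m S) T = (word_wt d (insert m E) S T - word_wt d E S T) / (tt - 1)"
  using assms tt_neq_1 by (simp add: word_wt_def field_simps)

text \<open>Words and colourings satisfy the same difference rule for inserting a mark, so induction
  on the marks reduces the claim to the unmarked case.\<close>

lemma sum_signs:
  assumes "valid_state 0 r d E S" and c: "\<And>j. j \<in> {1..d} \<Longrightarrow> 1 \<le> c j"
  shows "(\<Sum>T\<in>PiE {1..d} (lifts r c). word_wt d E S T) =
    (if \<forall>i\<in>{1..r}. c i = i then (1 - tt) ^ (d - r) * col_wt E S c else 0)"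
proof -
  have "finite S" using assms(1) by (simp add: valid_state_def dyck_graph_def)
  then show ?thesis using assms(1)
  proof (induct S arbitrary: E rule: finite_induct)
    case empty
    show ?case
    proof (rule sum_signs_unmarked)
      show "i \<in> {1..d} \<and> j \<in> {1..d}" if "(i, j) \<in> E" for i j
      proof -
        have "i \<in> fst ` (E \<union> {}) \<union> snd ` (E \<union> {})" "j \<in> fst ` (E \<union> {}) \<union> snd ` (E \<union> {})"
          using that by force+
        then show ?thesis using valid_state_vertex[OF empty] by (simp add: Suc_le_eq)
      qed
    qed (use empty c in \<open>auto simp: valid_state_def\<close>)
  next
    case (insert m S)
    note D = valid_state_insertD[OF insert.prems insert.hyps(2)]
    show ?case
      unfolding word_wt_insert_mark[OF D(4,5,3) insert.hyps(2)] col_wt_insert_mark[OF D(4,5,3) insert.hyps(2)]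
        sum_divide_distrib[symmetric] sum_subtractf insert.hyps(3)[OF D(1)] insert.hyps(3)[OF D(2)]
      by (simp add: right_diff_distrib)
  qed
qed

lemma mcoeff_GG:
  assumes "finite (Area r w)" "finite S"
  shows "mcoeff (GG r d w S) \<alpha> =
    (\<Sum>T | T \<in> {1..d} \<rightarrow>\<^sub>E alphabet \<and> (\<forall>i\<in>{1..r}. T i \<le> Pos i) \<and> weight d T = \<alpha>. word_wt d (Area r w) S T)"
    (is "_ = sum _ ?A")
  and "finite {T. T \<in> {1..d} \<rightarrow>\<^sub>E alphabet \<and> (\<forall>i\<in>{1..r}. T i \<le> Pos i) \<and> weight d T = \<alpha>}"
proof -
  have "?A \<subseteq> {1..d} \<rightarrow>\<^sub>E (Pos ` keys \<alpha> \<union> Neg ` keys \<alpha>)"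
  proof
    fix T assume T: "T \<in> ?A"
    have "keys \<alpha> = (\<lambda>i. absl (T i)) ` {1..d}"
      using T keys_sum_single[of "{1..d}" "\<lambda>i. absl (T i)"] by (simp add: weight_def)
    moreover have "l \<in> Pos ` {absl l} \<union> Neg ` {absl l}" for l by (cases l) auto
    ultimately have "T i \<in> Pos ` keys \<alpha> \<union> Neg ` keys \<alpha>" if "i \<in> {1..d}" for i
      using that by (cases "T i") (force simp: image_iff)+
    then show "T \<in> {1..d} \<rightarrow>\<^sub>E (Pos ` keys \<alpha> \<union> Neg ` keys \<alpha>)" using T by (auto simp: PiE_iff)
  qed
  then show fin: "finite ?A" by (rule finite_subset) (auto intro!: finite_PiE)
  have "mcoeff (GG r d w S) \<alpha> = (\<Sum>T\<in>{T \<in> flagged_row_words r d S. weight d T = \<alpha>}. word_wt d (Area r w) S T)"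
    unfolding GG_def mcoeff_Mfps
  proof (rule sum.cong)
    fix T assume T: "T \<in> {T \<in> flagged_row_words r d S. weight d T = \<alpha>}"
    have "tt ^ inv_count r w T = (\<Prod>e\<in>Area r w. if row_increasing (T (snd e)) (T (fst e)) then tt else 1)"
      unfolding inv_count_def prod.inter_filter[OF assms(1), symmetric] by (simp add: case_prod_unfold)
    moreover have "(\<Prod>e\<in>S. if row_increasing (T (snd e)) (T (fst e)) then 1 else 0 :: qt) = 1"
      by (rule prod.neutral) (use T in \<open>auto simp: flagged_row_words_def\<close>)
    ultimately show "tt ^ inv_count r w T * (- tt) ^ neg_count d T = word_wt d (Area r w) S T"
      by (simp add: word_wt_def)
  qed simp
  also have "\<dots> = sum (word_wt d (Area r w) S) ?A"
  proof (rule sum.mono_neutral_left[OF fin])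
    show "\<forall>T\<in>?A - {T \<in> flagged_row_words r d S. weight d T = \<alpha>}. word_wt d (Area r w) S T = 0"
    proof
      fix T assume "T \<in> ?A - {T \<in> flagged_row_words r d S. weight d T = \<alpha>}"
      then obtain e where "e \<in> S" "\<not> row_increasing (T (snd e)) (T (fst e))"
        by (auto simp: flagged_row_words_def)
      then have "(\<Prod>e\<in>S. if row_increasing (T (snd e)) (T (fst e)) then 1 else 0 :: qt) = 0"
        using assms(2) by (intro prod_zero bexI[of _ e]) auto
      then show "word_wt d (Area r w) S T = 0" by (simp add: word_wt_def)
    qed
  qed (auto simp: flagged_row_words_def)
  finally show "mcoeff (GG r d w S) \<alpha> = sum (word_wt d (Area r w) S) ?A" .
qed

text \<open>Words are grouped by their absolute values; the words over one colouring are the choices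
  of letters in \<open>lifts\<close>, summed by \<open>sum_signs\<close>. In the surviving
  colourings the first \<open>r\<close> letters are \<open>1, ..., r\<close>, and their monomial is
  the one split off in \<open>state\<close>.\<close>

lemma GG_eq_state:
  assumes v: "valid_state 0 r d (Area r w) S"
  shows "GG r d w S = state 0 r d (Area r w) S"
proof (rule mfps_eqI)
  fix \<alpha>
  define E where "E = Area r w"
  define P where "P = {Suc r..d}"
  define \<mu> where "\<mu> = (\<Sum>i\<in>{1..r}. single i 1)"
  define K where "K = (1 - tt) ^ (d - r)"
  define A where "A = {T. T \<in> {1..d} \<rightarrow>\<^sub>E alphabet \<and> (\<forall>i\<in>{1..r}. T i \<le> Pos i) \<and> weight d T = \<alpha>}"
  define B where "B = {c. c \<in> {1..d} \<rightarrow>\<^sub>E {1..} \<and> (\<Sum>i\<in>{1..d}. single (c i) 1) = \<alpha>}"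
  define g where "g T = (\<lambda>i\<in>{1..d}. absl (T i))" for T
  have fin: "finite (Area r w)" "finite S" and rd: "r \<le> d" using v by (auto simp: valid_state_def dyck_graph_def)
  have finA: "finite A" unfolding A_def by (rule mcoeff_GG(2)[OF fin])
  have "B \<subseteq> {1..d} \<rightarrow>\<^sub>E keys \<alpha>"
  proof
    fix c assume c: "c \<in> B"
    then have "\<alpha> = (\<Sum>i\<in>{1..d}. single (c i) 1)" "c \<in> extensional {1..d}" unfolding B_def PiE_def by blast+
    then show "c \<in> {1..d} \<rightarrow>\<^sub>E keys \<alpha>"
      using keys_sum_single[of "{1..d}" c] unfolding PiE_def by blast
  qed
  then have finB: "finite B" by (rule finite_subset) (auto intro!: finite_PiE)
  have gAB: "g ` A \<subseteq> B"
  proof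
    fix c assume "c \<in> g ` A"
    then obtain T where T: "T \<in> A" "c = g T" by blast
    have "(\<Sum>i\<in>{1..d}. single (c i) 1) = weight d T"
      unfolding weight_def T(2) g_def by (rule sum.cong) auto
    moreover have "c \<in> {1..d} \<rightarrow>\<^sub>E {1..}" using T by (auto simp: A_def g_def PiE_iff alphabet_def)
    ultimately show "c \<in> B" using T(1) by (simp add: A_def B_def)
  qed
  have fibre: "{T \<in> A. g T = c} = PiE {1..d} (lifts r c)" if c: "c \<in> B" for c
  proof (intro equalityI subsetI)
    fix T assume T: "T \<in> {T \<in> A. g T = c}"
    have "T j \<in> {Pos (c j), Neg (c j)}" if "j \<in> {1..d}" for j
    proof -
      have "absl (T j) = c j" using T that by (auto simp: g_def)
      then show ?thesis by (cases "T j") auto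
    qed
    moreover have "T \<in> extensional {1..d}" "\<forall>i\<in>{1..r}. T i \<le> Pos i" using T by (auto simp: A_def PiE_def)
    ultimately have "T j \<in> lifts r c j" if "j \<in> {1..d}" for j using that unfolding lifts_def by simp
    then show "T \<in> PiE {1..d} (lifts r c)" using \<open>T \<in> extensional {1..d}\<close> unfolding PiE_def by blast
  next
    fix T assume T: "T \<in> PiE {1..d} (lifts r c)"
    have a: "absl (T j) = c j" if "j \<in> {1..d}" for j using PiE_mem[OF T that] by (auto simp: lifts_def)
    have ext: "c i = undefined" if "i \<notin> {1..d}" for i using c that by (auto simp: B_def PiE_iff extensional_def)
    have "g T = c"
    proof
      fix i show "g T i = c i" using a[of i] ext[of i] by (cases "i \<in> {1..d}") (simp_all add: g_def)
    qed
    moreover have "T \<in> A"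
    proof -
      have "T i \<le> Pos i" if "i \<in> {1..r}" for i using PiE_mem[OF T, of i] that rd by (auto simp: lifts_def)
      moreover have "T \<in> {1..d} \<rightarrow>\<^sub>E alphabet" using T c a by (auto simp: PiE_iff alphabet_def B_def)
      moreover have "weight d T = \<alpha>"
      proof -
        have "weight d T = (\<Sum>i\<in>{1..d}. single (c i) 1)" unfolding weight_def by (rule sum.cong) (simp_all add: a)
        then show ?thesis using c by (simp add: B_def)
      qed
      ultimately show ?thesis by (simp add: A_def)
    qed
    ultimately show "T \<in> {T \<in> A. g T = c}" by simp
  qed
  have "mcoeff (GG r d w S) \<alpha> = (\<Sum>T\<in>A. word_wt d E S T)"
    unfolding A_def E_def by (rule mcoeff_GG(1)[OF fin])
  also have "\<dots> = (\<Sum>c\<in>B. \<Sum>T\<in>{T \<in> A. g T = c}. word_wt d E S T)"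
    by (rule sum.group[OF finA finB gAB, symmetric])
  also have "\<dots> = (\<Sum>c\<in>B. if \<forall>i\<in>{1..r}. c i = i then K * col_wt E S c else 0)"
  proof (rule sum.cong[OF refl])
    fix c assume c: "c \<in> B"
    show "(\<Sum>T\<in>{T \<in> A. g T = c}. word_wt d E S T) = (if \<forall>i\<in>{1..r}. c i = i then K * col_wt E S c else 0)"
      unfolding fibre[OF c] K_def by (rule sum_signs) (use v c in \<open>auto simp: E_def B_def PiE_iff\<close>)
  qed
  also have "\<dots> = K * (\<Sum>c\<in>{c\<in>B. \<forall>i\<in>{1..r}. c i = i}. col_wt E S c)"
    unfolding sum_distrib_left by (rule sum.inter_filter[OF finB, symmetric])
  also have "(\<Sum>c\<in>{c\<in>B. \<forall>i\<in>{1..r}. c i = i}. col_wt E S c) =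
      mcoeff (mmonom \<mu> * col_series P (\<lambda>i. i) E S) \<alpha>"
  proof -
    have dP: "{1..d} = {1..r} \<union> P" "{1..r} \<inter> P = {}" using rd by (auto simp: P_def)
    have split: "(\<Sum>i\<in>{1..d}. single (c i) 1) = \<mu> + (\<Sum>i\<in>P. single (c i) 1)"
      if "\<forall>i\<in>{1..r}. c i = i" for c
    proof -
      have "(\<Sum>i\<in>{1..d}. single (c i) 1) = (\<Sum>i\<in>{1..r}. single (c i) 1) + (\<Sum>i\<in>P. single (c i) 1)"
        unfolding dP(1) by (rule sum.union_disjoint) (use dP(2) in \<open>auto simp: P_def\<close>)
      also have "(\<Sum>i\<in>{1..r}. single (c i) 1) = \<mu>" unfolding \<mu>_def by (rule sum.cong) (use that in auto)
      finally show ?thesis .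
    qed
    show ?thesis
    proof (cases "\<exists>\<gamma>. \<alpha> = \<mu> + \<gamma>")
      case True
      then obtain \<gamma> where \<gamma>: "\<alpha> = \<mu> + \<gamma>" by blast
      let ?ext = "\<lambda>c i. if i \<in> P then c i else if i \<in> {1..r} then i else undefined :: nat"
      have "(\<Sum>c\<in>{c\<in>B. \<forall>i\<in>{1..r}. c i = i}. col_wt E S c) =
          (\<Sum>c | c \<in> P \<rightarrow>\<^sub>E {1..} \<and> (\<Sum>i\<in>P. single (c i) 1) = \<gamma>. col_wt E S (glue P c (\<lambda>i. i)))"
      proof (rule sum.reindex_bij_witness[where i = ?ext and j = "\<lambda>c. restrict c P"])
        fix c assume c: "c \<in> {c\<in>B. \<forall>i\<in>{1..r}. c i = i}"
        then have ci: "\<forall>i\<in>{1..r}. c i = i" and cB: "c \<in> B" by auto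
        have cd: "c i = undefined" if "i \<notin> P" "i \<notin> {1..r}" for i
          using cB that dP(1) by (auto simp: B_def PiE_iff extensional_def)
        show "?ext (restrict c P) = c" using ci cd by (auto simp: fun_eq_iff)
        have "\<mu> + (\<Sum>i\<in>P. single (c i) 1) = \<mu> + \<gamma>" using split[OF ci] cB \<gamma> by (simp add: B_def)
        then have "(\<Sum>i\<in>P. single (restrict c P i) 1) = \<gamma>" by simp
        moreover have "restrict c P \<in> P \<rightarrow>\<^sub>E {1..}" using cB by (auto simp: B_def PiE_iff P_def)
        ultimately show "restrict c P \<in> {c. c \<in> P \<rightarrow>\<^sub>E {1..} \<and> (\<Sum>i\<in>P. single (c i) 1) = \<gamma>}" by simp
        show "col_wt E S (glue P (restrict c P) (\<lambda>i. i)) = col_wt E S c"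
        proof (rule col_wt_cong)
          fix i assume "i \<in> fst ` (E \<union> S) \<union> snd ` (E \<union> S)"
          then have "0 < i" "i \<le> d" using valid_state_vertex[OF v] unfolding E_def by blast+
          then have "i \<in> {1..r} \<union> P" unfolding dP(1)[symmetric] by simp
          then show "glue P (restrict c P) (\<lambda>i. i) i = c i" using ci by (auto simp: glue_def)
        qed
      next
        fix c assume c: "c \<in> {c. c \<in> P \<rightarrow>\<^sub>E {1..} \<and> (\<Sum>i\<in>P. single (c i) 1) = \<gamma>}"
        show "restrict (?ext c) P = c" using c by (auto simp: fun_eq_iff PiE_iff extensional_def)
        have e: "\<forall>i\<in>{1..r}. ?ext c i = i" using dP(2) by auto
        have "(\<Sum>i\<in>P. single (?ext c i) 1) = (\<Sum>i\<in>P. single (c i) 1)" by (rule sum.cong) auto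
        then have "(\<Sum>i\<in>{1..d}. single (?ext c i) 1) = \<alpha>" using split[OF e] c \<gamma> by simp
        moreover have "?ext c \<in> {1..d} \<rightarrow>\<^sub>E {1..}" unfolding dP(1) using c by (auto simp: PiE_iff extensional_def)
        ultimately show "?ext c \<in> {c\<in>B. \<forall>i\<in>{1..r}. c i = i}" using e by (simp add: B_def)
      qed
      also have "\<dots> = mcoeff (mmonom \<mu> * col_series P (\<lambda>i. i) E S) \<alpha>"
        unfolding \<gamma> mcoeff_mmonom_mult_add mcoeff_col_series ..
      finally show ?thesis .
    next
      case False
      then have empty: "{c\<in>B. \<forall>i\<in>{1..r}. c i = i} = {}" using split by (fastforce simp: B_def)
      show ?thesis unfolding empty using False by (simp add: mcoeff_mmonom_mult_eq_0)
    qed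
  qed
  also have "K * \<dots> = mcoeff (state 0 r d E S) \<alpha>"
  proof -
    have "mmonom \<mu> = (\<Prod>i\<in>{1..r}. mvar i :: qt mfps)" by (simp add: \<mu>_def mmonom_sum mvar_def)
    then show ?thesis by (simp add: state_def K_def P_def mult.assoc)
  qed
  finally show "mcoeff (GG r d w S) \<alpha> = mcoeff (state 0 r d (Area r w) S) \<alpha>" by (simp only: E_def)
qed

section \<open>Traversing the path\<close>

lemma norths_simps [simp]:
  "norths [] = 0" "norths (u @ v) = norths u + norths v" "norths (North # v) = Suc (norths v)"
  "norths (East # v) = norths v"
  by (simp_all add: norths_def)

lemma easts_simps [simp]:
  "easts [] = 0" "easts (u @ v) = easts u + easts v" "easts (North # v) = easts v"
  "easts (East # v) = Suc (easts v)"
  by (simp_all add: easts_def)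

lemma norths_replicate [simp]: "norths (replicate r North) = r"
  and easts_replicate [simp]: "easts (replicate r North) = 0"
  by (induct r) simp_all

section \<open>Boxes and corners in terms of prefixes of the path\<close>

lemma boxes_below_iff:
  "(i, j) \<in> boxes_below r w \<longleftrightarrow>
     (\<exists>u v. w = u @ East # v \<and> i = Suc (easts u) \<and> 1 \<le> j \<and> j \<le> r + norths u)"
proof
  let ?e = "replicate r North @ w"
  assume "(i, j) \<in> boxes_below r w"
  then obtain k where k: "k < length ?e" "?e ! k = East" "i = easts (take (Suc k) ?e)"
    "1 \<le> j" "j \<le> norths (take (Suc k) ?e)" by (auto simp: boxes_below_def Let_def)
  have kr: "r \<le> k"
  proof (rule ccontr)
    assume "\<not> r \<le> k"
    then have "?e ! k = North" by (simp add: nth_append)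
    then show False using k(2) by simp
  qed
  define m where "m = k - r"
  have m: "m < length w" "w ! m = East" using k(1,2) kr by (auto simp: m_def nth_append)
  have w: "w = take m w @ East # drop (Suc m) w" using id_take_nth_drop[OF m(1)] m(2) by simp
  have "take (Suc k) ?e = replicate r North @ take (Suc m) w" using kr by (simp add: m_def Suc_diff_le)
  also have "take (Suc m) w = take m w @ [East]" using take_Suc_conv_app_nth[OF m(1)] m(2) by simp
  finally show "\<exists>u v. w = u @ East # v \<and> i = Suc (easts u) \<and> 1 \<le> j \<and> j \<le> r + norths u"
    using k(3-5) w by (intro exI[of _ "take m w"] exI[of _ "drop (Suc m) w"]) simp
next
  assume "\<exists>u v. w = u @ East # v \<and> i = Suc (easts u) \<and> 1 \<le> j \<and> j \<le> r + norths u"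
  then obtain u v where "w = u @ East # v" "i = Suc (easts u)" "1 \<le> j" "j \<le> r + norths u" by blast
  then show "(i, j) \<in> boxes_below r w"
    unfolding boxes_below_def Let_def mem_Collect_eq prod.case
    by (intro exI[of _ "r + length u"]) (simp add: nth_append)
qed

lemma prefix_before_east_unique:
  assumes "u @ East # v = u' @ East # v'" "easts u = easts u'"
  shows "u = u'"
proof -
  obtain us where "u = u' @ us \<and> us @ East # v = East # v' \<or> u @ us = u' \<and> East # v = us @ East # v'"
    using assms(1) unfolding append_eq_append_conv2 by blast
  then show ?thesis
    using assms(2) by (cases us) auto
qed

lemma boxes_below_column:
  assumes "w = u @ East # v"
  shows "(Suc (easts u), j) \<in> boxes_below r w \<longleftrightarrow> 1 \<le> j \<and> j \<le> r + norths u"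
proof
  assume "(Suc (easts u), j) \<in> boxes_below r w"
  then obtain u' v' where u': "w = u' @ East # v'" "Suc (easts u) = Suc (easts u')" "1 \<le> j" "j \<le> r + norths u'"
    unfolding boxes_below_iff by (elim exE conjE)
  have eq: "u @ East # v = u' @ East # v'" using assms u'(1) by simp
  have "easts u = easts u'" using u'(2) by simp
  then have "u = u'" by (rule prefix_before_east_unique[OF eq])
  then show "1 \<le> j \<and> j \<le> r + norths u" using u' by simp
next
  assume "1 \<le> j \<and> j \<le> r + norths u"
  then show "(Suc (easts u), j) \<in> boxes_below r w"
    unfolding boxes_below_iff using assms by (intro exI[of _ u] exI[of _ v]) simp
qed

lemma boxes_below_range: "(i, j) \<in> boxes_below r w \<Longrightarrow> 1 \<le> i \<and> i \<le> easts w"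
  unfolding boxes_below_iff by (elim exE conjE) simp

lemma cornersD:
  assumes "(i, j) \<in> corners r w"
  shows "1 \<le> i" "i < easts w" "(Suc i, j) \<in> boxes_below r w"
proof -
  have *: "(i, j - 1) \<in> boxes_below r w" "(Suc i, j) \<in> boxes_below r w"
    using assms by (simp_all add: corners_def)
  show "1 \<le> i" "i < easts w" "(Suc i, j) \<in> boxes_below r w"
    using boxes_below_range[OF *(1)] boxes_below_range[OF *(2)] *(2) by simp_all
qed

text \<open>The boxes of a column below the path fill the heights from 1 up to the path, so a corner
  can only be the box directly above them. A column thus carries at most one mark.\<close>

lemma corners_height:
  assumes "w = u @ East # v" "(Suc (easts u), j) \<in> corners r w"
  shows "j = Suc (r + norths u)"
proof -
  have "(Suc (easts u), j) \<notin> boxes_below r w" "(Suc (easts u), j - 1) \<in> boxes_below r w"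
    using assms(2) by (simp_all add: corners_def)
  then show ?thesis unfolding boxes_below_column[OF assms(1)] by arith
qed

text \<open>The columns whose east steps the backward traversal has passed on reaching abscissa
  \<open>x\<close>. As edges, these are the pairs whose left end is one of the positions present at
  that moment.\<close>

definition cols_after :: "nat \<Rightarrow> (nat \<times> nat) set \<Rightarrow> (nat \<times> nat) set" where
  "cols_after x A = {e \<in> A. x < fst e}"

lemma cols_after_Area:
  assumes "w = u @ East # v"
  shows "cols_after (easts u) (Area r w) =
    cols_after (Suc (easts u)) (Area r w) \<union> Pair (Suc (easts u)) ` {Suc (easts u)<..r + norths u}"
proof (intro set_eqI)
  fix e :: "nat \<times> nat"
  obtain i j where e: "e = (i, j)" by (cases e)
  show "e \<in> cols_after (easts u) (Area r w) \<longleftrightarrow> e \<in> cols_after (Suc (easts u)) (Area r w) \<union>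
      Pair (Suc (easts u)) ` {Suc (easts u)<..r + norths u}"
  proof (cases "i = Suc (easts u)")
    case True
    then show ?thesis using boxes_below_column[OF assms, of j r] by (auto simp: e cols_after_def Area_def)
  next
    case False
    then show ?thesis by (auto simp: e cols_after_def)
  qed
qed

lemma state_final: "state d d d {} {} = 1"
proof -
  have "{c. c \<in> {} \<rightarrow>\<^sub>E {1..} \<and> (\<Sum>i\<in>{}. single (c i) 1) = \<alpha>} = (if \<alpha> = 0 then {\<lambda>_. undefined} else {})"
    for \<alpha> :: expo and c :: "nat \<Rightarrow> nat" by (auto simp: PiE_empty_domain)
  then have "col_series {} f {} {} = 1" for f
    by (intro mfps_eqI) (simp add: mcoeff_col_series mcoeff_1 col_wt_def)
  then show ?thesis by (simp add: state_def)
qed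

text \<open>The induction is on the length of the remaining prefix \<open>u\<close> and not step by
  step, because a marked corner consumes two steps. The last hypothesis on \<open>u\<close> says
  that an east step about to be traversed is not half of a marked corner whose north step was
  treated separately.\<close>

lemma traverse_state:
  assumes path: "w \<in> Dyck r d" and marking: "S \<subseteq> corners r w"
  shows "w = u @ v \<Longrightarrow> x = easts u \<Longrightarrow> y = r + norths u \<Longrightarrow>
    valid_state x y d (cols_after x (Area r w)) (cols_after x S) \<Longrightarrow>
    (u \<noteq> [] \<and> last u = East \<longrightarrow> (x, Suc y) \<notin> S) \<Longrightarrow>
    traverse S x y (rev u) (state x y d (cols_after x (Area r w)) (cols_after x S)) = state 0 r d (Area r w) S \<and>
    valid_state 0 r d (Area r w) S"
proof (induct "length u" arbitrary: u v x y rule: less_induct)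
  case less
  note w = less.prems(1) and x = less.prems(2) and y = less.prems(3) and v = less.prems(4)
  have above: "easts u' \<le> r + norths u'" if "w = u' @ v'" for u' v'
  proof -
    have "easts (take (length u') w) \<le> r + norths (take (length u') w)"
      using path that by (simp add: Dyck_def del: take_append)
    then show ?thesis using that by simp
  qed
  show ?case
  proof (cases u rule: rev_cases)
    case Nil
    have "cols_after 0 (Area r w) = Area r w"
      using boxes_below_range by (fastforce simp: cols_after_def Area_def)
    moreover have "cols_after 0 S = S"
      using marking cornersD(1) by (fastforce simp: cols_after_def)
    ultimately show ?thesis using v by (simp add: Nil x y)
  next
    case (snoc u' a)
    have len: "length u' < length u" by (simp add: snoc)
    show ?thesis
    proof (cases a)
      case East
      have u: "u = u' @ [East]" and wE: "w = u' @ East # v" using snoc East w by auto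
      have x1: "x = Suc (easts u')" and y1: "y = r + norths u'" using x y u by simp_all
      have A: "cols_after (x - 1) (Area r w) = cols_after x (Area r w) \<union> Pair x ` {x<..y}"
        using cols_after_Area[OF wE, of r] by (simp add: x1 y1)
      \<comment> \<open>The only possible mark in column \<open>x\<close> is at height
        \<open>y + 1\<close>, and the hypothesis on the last step of \<open>u\<close> excludes
        it.\<close>
      have nS: "(x, j) \<notin> S" for j
      proof
        assume j: "(x, j) \<in> S"
        then have "j = Suc y" using corners_height[OF wE, of j r] marking by (auto simp: x1 y1)
        then show False using j less.prems(5) u by simp
      qed
      have S: "cols_after (x - 1) S = cols_after x S"
      proof -
        have "x - 1 < fst e \<longleftrightarrow> x < fst e" if "e \<in> S" for e
        proof -
          have "fst e \<noteq> x" using nS[of "snd e"] that by auto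
          then show ?thesis using x1 by linarith
        qed
        then show ?thesis by (auto simp: cols_after_def)
      qed
      \<comment> \<open>Such a corner would need its east neighbour \<open>(x, y + 1)\<close> below
        the path, but column \<open>x\<close> ends at height \<open>y\<close>.\<close>
      have "(x - 1, Suc y) \<notin> S"
      proof
        assume "(x - 1, Suc y) \<in> S"
        then have "(x, Suc y) \<in> boxes_below r w" using cornersD(3) marking x1 by fastforce
        then show False using boxes_below_column[OF wE, of "Suc y" r] by (simp add: x1 y1)
      qed
      moreover have "valid_state (x - 1) y d (cols_after (x - 1) (Area r w)) (cols_after (x - 1) S)"
        unfolding A S by (rule valid_state_east[OF v]) (simp add: x1)
      moreover have "x - 1 = easts u'" using x1 by simp
      ultimately have IH: "traverse S (x - 1) y (rev u') (state (x - 1) y d (cols_after (x - 1) (Area r w))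
          (cols_after (x - 1) S)) = state 0 r d (Area r w) S \<and> valid_state 0 r d (Area r w) S"
        using less.hyps[OF len wE _ y1] by blast
      have "- d_plus (y - x) (state x y d (cols_after x (Area r w)) (cols_after x S)) =
          state (x - 1) y d (cols_after (x - 1) (Area r w)) (cols_after (x - 1) S)"
        unfolding A S by (rule d_plus_state[OF v]) (simp add: x1)
      then show ?thesis using IH by (simp add: u)
    next
      case North
      have u: "u = u' @ [North]" and wN: "w = u' @ North # v" using snoc North w by auto
      have x1: "x = easts u'" and y1: "y = Suc (r + norths u')" using x y u by simp_all
      have xy: "x < y" using above[OF wN] by (simp add: x1 y1)
      show ?thesis
      proof (cases "(x, y) \<in> S \<and> rev u' \<noteq> [] \<and> hd (rev u') = East")
        case True
        then obtain u'' where u'': "u' = u'' @ [East]" by (cases u' rule: rev_cases) auto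
        have wE: "w = u'' @ East # North # v" using wN u'' by simp
        have x2: "x = Suc (easts u'')" and y2: "y = Suc (r + norths u'')" using x1 y1 u'' by simp_all
        have A: "cols_after (x - 1) (Area r w) = cols_after x (Area r w) \<union> Pair x ` {x<..y - 1}"
          using cols_after_Area[OF wE, of r] by (simp add: x2 y2)
        have S: "cols_after (x - 1) S = insert (x, y) (cols_after x S)"
        proof (intro set_eqI)
          fix e :: "nat \<times> nat"
          obtain i j where e: "e = (i, j)" by (cases e)
          have "j = y" if "(x, j) \<in> S" for j
            using corners_height[OF wE, of j r] marking that by (auto simp: x2 y2)
          then show "e \<in> cols_after (x - 1) S \<longleftrightarrow> e \<in> insert (x, y) (cols_after x S)"
            using True x2 by (cases "i = x") (auto simp: e cols_after_def)
        qed
        have "(x - 1, Suc (y - 1)) \<notin> S"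
        proof
          assume "(x - 1, Suc (y - 1)) \<in> S"
          then have "(x, y) \<in> boxes_below r w" using cornersD(3) marking x2 y2 by fastforce
          then show False using boxes_below_column[OF wE, of y r] by (simp add: x2 y2)
        qed
        moreover have "valid_state (x - 1) (y - 1) d (cols_after (x - 1) (Area r w)) (cols_after (x - 1) S)"
          unfolding A S by (rule valid_state_corner[OF v _ xy]) (simp add: x2)
        moreover have "x - 1 = easts u''" "y - 1 = r + norths u''" using x2 y2 by simp_all
        moreover have "length u'' < length u" by (simp add: u u'')
        ultimately have IH: "traverse S (x - 1) (y - 1) (rev u'') (state (x - 1) (y - 1) d
            (cols_after (x - 1) (Area r w)) (cols_after (x - 1) S)) = state 0 r d (Area r w) S \<and>
            valid_state 0 r d (Area r w) S"
          using less.hyps[OF _ wE] by blast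
        have "corner_op (y - x) (state x y d (cols_after x (Area r w)) (cols_after x S)) =
            state (x - 1) (y - 1) d (cols_after (x - 1) (Area r w)) (cols_after (x - 1) S)"
          unfolding A S by (rule corner_op_state[OF v _ xy]) (simp add: x2)
        then show ?thesis using IH True by (simp add: u u'')
      next
        case False
        have hyp: "u' \<noteq> [] \<and> last u' = East \<longrightarrow> (x, Suc (y - 1)) \<notin> S"
          using False y1 by (auto simp: hd_rev)
        have y3: "y - 1 = r + norths u'" using y1 by simp
        have IH: "traverse S x (y - 1) (rev u') (state x (y - 1) d (cols_after x (Area r w)) (cols_after x S)) =
            state 0 r d (Area r w) S \<and> valid_state 0 r d (Area r w) S"
          by (rule less.hyps[OF len wN x1 y3 valid_state_north[OF v xy] hyp])
        have "traverse S x y (rev u) f = traverse S x (y - 1) (rev u') (d_minus (y - x) f)" for f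
          using False by (simp only: u rev_append rev.simps append.simps traverse.simps if_False)
        then show ?thesis using IH d_minus_state[OF v xy] by simp
      qed
    qed
  qed
qed

theorem theorem5p14:
  fixes r d :: nat and w :: "step list" and S :: "(nat \<times> nat) set"
  assumes path: "w \<in> Dyck r d"
    and marking: "S \<subseteq> corners r w"
  shows "GG r d w S \<in> PP r \<and> GG r d w S = chi d w S"
proof -
  have ew: "easts w = d" "r + norths w = d" using path by (auto simp: Dyck_def)
  have A: "cols_after d (Area r w) = {}"
    using boxes_below_range ew by (fastforce simp: cols_after_def Area_def)
  have S: "cols_after d S = {}"
    using cornersD(2) marking ew by (fastforce simp: cols_after_def)
  have v: "valid_state d d d {} {}"
    by (simp add: valid_state_def dyck_graph_def interval_closed_def)
  \<comment> \<open>The condition of \<open>traverse_state\<close> at the starting point: a corner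
    has a column to its right, so none lies in column \<open>d\<close>.\<close>
  have nS: "(d, Suc d) \<notin> S"
  proof
    assume "(d, Suc d) \<in> S"
    then have "d < easts w" using marking by (intro cornersD(2)) (rule subsetD)
    then show False using ew by simp
  qed
  have "traverse S d d (rev w) (state d d d (cols_after d (Area r w)) (cols_after d S)) = state 0 r d (Area r w) S \<and>
      valid_state 0 r d (Area r w) S"
    by (rule traverse_state[OF path marking, of w "[]"]) (simp_all add: ew A S v nS)
  then have *: "traverse S d d (rev w) (state d d d {} {}) = state 0 r d (Area r w) S"
    and **: "valid_state 0 r d (Area r w) S" unfolding A S by (rule conjunct1, rule conjunct2)
  have "GG r d w S = state 0 r d (Area r w) S" by (rule GG_eq_state[OF **])
  moreover have "state 0 r d (Area r w) S \<in> PP r"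
    using tail_symmetric_imp_PP[OF tail_symmetric_state[OF **]] by simp
  ultimately show ?thesis using * by (simp add: chi_def state_final)
qed

end
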